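(* Let $d\ge1$ and let $g:\mathbb{R}^d\to\mathrm{Sym}^+(d)$ be a random Riemannian metric satisfying: 1. (Ergodicity) $g$ is ergodic under the translations of $\mathbb{R}^d$: its law is invariant under translations, and invariant events have probability $0$ or $1$; 2. (Regularity) almost surely $g$ is continuous; 3. (Weak finite moment condition) for every $v\in\mathbb{R}^d$, $\mathbb{E}(\|v\|_{g(0)})<\infty$. Let $T$ be the random distance associated with $g$, and assume moreover that $T$ satisfies the exponential quasi independence condition: there exists $\beta>0$ such that for every $\alpha>0$ there exists $Q_0$ such that for every $Q\ge Q_0$, $\mathrm{Ind}^-(Q,Q^{1+\alpha})\le\exp(-Q^\beta)$. Then the time constant $\mu(v)=\lim_{n\to\infty}\frac1nT(0,nv)$ (deterministic almost sure and $L^1$ limit, for $v\in\mathbb{R}^d$) associated with $T$ is a norm.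
   Context: $\mathrm{Sym}^+(d)$ is the open cone of positive definite real symmetric $d\times d$ matrices; $\|w\|_{g(x)}=\sqrt{w^{\top}g(x)w}$. The associated distance is $T(x,y)=\inf_\gamma\mathrm{Length}_g(\gamma)$ over piecewise $C^1$ paths from $x$ to $y$, where $\mathrm{Length}_g(\gamma)=\int_a^b\|\gamma'(s)\|_{g(\gamma(s))}\,ds$ for $\gamma:[a,b]\to\mathbb{R}^d$. Ergodicity under translations means: for every $v\ne0$, the law of $g$ is invariant under $g\mapsto g(\cdot+v)$ and every event invariant under this map has probability $0$ or $1$. The set of pseudometrics on $\mathbb{R}^d$ carries the pointwise partial order. An event $E$ is decreasing if $\varphi\in E$ and $\varphi\ge\psi$ imply $\psi\in E$. For $A\subset\mathbb{R}^d$, $\mathcal{A}^-$ is the set of decreasing events depending only on the values of $T$ over $A$ (i.e. on $T|_{A\times A}$). For $Q,S>0$, $$\mathrm{Ind}^-(Q,S)=\sup\big|\mathbb{P}[E_A\cap E_B]-\mathbb{P}[E_A]\mathbb{P}[E_B]\big|,$$ the supremum being over $A,B\subset\mathbb{R}^d$ of diameter at most $S$ with $\mathrm{dist}(A,B)>Q$, and $E_A\in\mathcal{A}^-$, $E_B\in\mathcal{B}^-$. *)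

theory Defs
  imports "HOL-Probability.Probability"
begin

definition pos_def_matrices :: "(real^'n^'n) set" where
  "pos_def_matrices = {A. transpose A = A \<and> (\<forall>w. w \<noteq> 0 \<longrightarrow> 0 < w \<bullet> (A *v w))}"

definition riem_norm :: "real^'n^'n \<Rightarrow> real^'n \<Rightarrow> real" where
  "riem_norm A w = sqrt (w \<bullet> (A *v w))"

(* The constant piecewise_C1_differentiable_on lets the velocity blow up at the finitely many
   break points, so the length takes values in [0, \<infinity>].  Such curves do not change the infimum
   below when h is continuous.  The values of vector_derivative at the break points and at the
   end points are immaterial. *)
definition riem_length ::
    "(real^'n \<Rightarrow> real^'n^'n) \<Rightarrow> real \<Rightarrow> real \<Rightarrow> (real \<Rightarrow> real^'n) \<Rightarrow> ennreal" where
  "riem_length h a b \<gamma> =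
     (\<integral>\<^sup>+s\<in>{a..b}. ennreal (riem_norm (h (\<gamma> s)) (vector_derivative \<gamma> (at s))) \<partial>lborel)"

definition riem_dist :: "(real^'n \<Rightarrow> real^'n^'n) \<Rightarrow> real^'n \<Rightarrow> real^'n \<Rightarrow> real" where
  "riem_dist h x y = enn2real (Inf {riem_length h a b \<gamma> | a b \<gamma>.
     a \<le> b \<and> \<gamma> piecewise_C1_differentiable_on {a..b} \<and> \<gamma> a = x \<and> \<gamma> b = y})"

definition random_riem_metric ::
    "'w measure \<Rightarrow> ('w \<Rightarrow> real^'n \<Rightarrow> real^'n^'n) \<Rightarrow> bool" where
  "random_riem_metric M g \<longleftrightarrow>
     (\<forall>x. (\<lambda>\<omega>. g \<omega> x) \<in> borel_measurable M) \<and>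
     (\<forall>\<omega>\<in>space M. \<forall>x. g \<omega> x \<in> pos_def_matrices)"

definition field_space :: "('a \<Rightarrow> 'b::topological_space) measure" where
  "field_space = PiM UNIV (\<lambda>_. borel)"

definition field_law :: "'w measure \<Rightarrow> ('w \<Rightarrow> 'a \<Rightarrow> 'b::topological_space) \<Rightarrow> ('a \<Rightarrow> 'b) measure" where
  "field_law M g = distr M field_space g"

definition shift :: "'a::plus \<Rightarrow> ('a \<Rightarrow> 'b) \<Rightarrow> 'a \<Rightarrow> 'b" where
  "shift v h = (\<lambda>x. h (x + v))"

definition translation_ergodic ::
    "'w measure \<Rightarrow> ('w \<Rightarrow> 'a::real_vector \<Rightarrow> 'b::topological_space) \<Rightarrow> bool" where
  "translation_ergodic M g \<longleftrightarrow> (\<forall>v. v \<noteq> 0 \<longrightarrow>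
     distr (field_law M g) field_space (shift v) = field_law M g \<and>
     (\<forall>E \<in> sets field_space. shift v -` E = E \<longrightarrow>
        measure (field_law M g) E = 0 \<or> measure (field_law M g) E = 1))"

definition pseudometric :: "('a \<Rightarrow> 'a \<Rightarrow> real) \<Rightarrow> bool" where
  "pseudometric \<phi> \<longleftrightarrow>
     (\<forall>x y. 0 \<le> \<phi> x y) \<and> (\<forall>x. \<phi> x x = 0) \<and> (\<forall>x y. \<phi> x y = \<phi> y x) \<and>
     (\<forall>x y z. \<phi> x z \<le> \<phi> x y + \<phi> y z)"

(* The sigma-algebra generated by the evaluations at pairs of points; the measure itself is
   irrelevant. *)
definition pseudometric_space :: "('a \<Rightarrow> 'a \<Rightarrow> real) measure" where
  "pseudometric_space =
     restrict_space (PiM UNIV (\<lambda>_. PiM UNIV (\<lambda>_. borel))) (Collect pseudometric)"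

definition decreasing_events :: "'a set \<Rightarrow> ('a \<Rightarrow> 'a \<Rightarrow> real) set set" where
  "decreasing_events A = {E \<in> sets pseudometric_space.
     (\<forall>\<phi> \<psi>. \<phi> \<in> E \<and> pseudometric \<psi> \<and> \<psi> \<le> \<phi> \<longrightarrow> \<psi> \<in> E) \<and>
     (\<forall>\<phi> \<psi>. \<phi> \<in> E \<and> pseudometric \<psi> \<and> (\<forall>x\<in>A. \<forall>y\<in>A. \<phi> x y = \<psi> x y) \<longrightarrow> \<psi> \<in> E)}"

(* The Riemannian distance is a pseudometric, and is measurable, only outside the null set of
   discontinuous metrics; hence probabilities are taken in the completion of M. *)
definition prob_in :: "'w measure \<Rightarrow> ('w \<Rightarrow> 'b) \<Rightarrow> 'b set \<Rightarrow> real" where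
  "prob_in M T E = measure (completion M) {\<omega> \<in> space M. T \<omega> \<in> E}"

(* Boundedness is stated separately because diameter is real-valued. *)
definition Ind_minus ::
    "'w measure \<Rightarrow> ('w \<Rightarrow> 'a::metric_space \<Rightarrow> 'a \<Rightarrow> real) \<Rightarrow> real \<Rightarrow> real \<Rightarrow> real" where
  "Ind_minus M T Q S = Sup {\<bar>prob_in M T (EA \<inter> EB) - prob_in M T EA * prob_in M T EB\<bar> | A B EA EB.
     bounded A \<and> bounded B \<and> diameter A \<le> S \<and> diameter B \<le> S \<and> setdist A B > Q \<and>
     EA \<in> decreasing_events A \<and> EB \<in> decreasing_events B}"

definition exp_quasi_independent ::
    "'w measure \<Rightarrow> ('w \<Rightarrow> 'a::metric_space \<Rightarrow> 'a \<Rightarrow> real) \<Rightarrow> bool" where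
  "exp_quasi_independent M T \<longleftrightarrow>
     (\<exists>\<beta>>0. \<forall>\<alpha>>0. \<exists>Q0>0. \<forall>Q\<ge>Q0. Ind_minus M T Q (Q powr (1 + \<alpha>)) \<le> exp (- (Q powr \<beta>)))"

definition time_constant ::
    "'w measure \<Rightarrow> ('w \<Rightarrow> 'a::real_vector \<Rightarrow> 'a \<Rightarrow> real) \<Rightarrow> ('a \<Rightarrow> real) \<Rightarrow> bool" where
  "time_constant M T \<mu> \<longleftrightarrow> (\<forall>v.
     (AE \<omega> in M. (\<lambda>n. T \<omega> 0 (real n *\<^sub>R v) / real n) \<longlonglongrightarrow> \<mu> v) \<and>
     (\<forall>n. integrable (completion M) (\<lambda>\<omega>. T \<omega> 0 (real n *\<^sub>R v))) \<and>
     (\<lambda>n. \<integral>\<omega>. \<bar>T \<omega> 0 (real n *\<^sub>R v) / real n - \<mu> v\<bar> \<partial>completion M) \<longlonglongrightarrow> 0)"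

definition is_norm :: "('a::real_vector \<Rightarrow> real) \<Rightarrow> bool" where
  "is_norm \<mu> \<longleftrightarrow>
     (\<forall>v. 0 \<le> \<mu> v) \<and> (\<forall>v. \<mu> v = 0 \<longleftrightarrow> v = 0) \<and>
     (\<forall>c v. \<mu> (c *\<^sub>R v) = \<bar>c\<bar> * \<mu> v) \<and> (\<forall>v w. \<mu> (v + w) \<le> \<mu> v + \<mu> w)"

end

theory Submission
  imports Defs "HOL-Real_Asymp.Real_Asymp"
begin

text \<open>The time constant exists by the subadditive ergodic theorem, and stationarity together with
  \<open>E (T 0 v) \<le> E \<parallel>v\<parallel>\<close> makes it a seminorm. It remains to see that it does not vanish.

  Call a unit ball bad at scale \<open>L\<close> if some point of it is joined to a point at distance between \<open>L\<close> and \<open>2 L\<close>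
  by a path of length less than \<open>\<delta> L\<close>; this is a decreasing event depending only on the distance near that
  ball. If all bad balls at scale \<open>L\<close> near the origin lie within distance about \<open>6 L\<close> of a single point, then,
  cutting a path into steps of length \<open>L\<close>, one sees that the unit ball at the origin is not bad at scale \<open>L'\<close>
  for a \<open>\<delta>\<close> smaller only by the factor \<open>1 - 13 L / L'\<close>. A bad ball at scale \<open>L'\<close> thus forces two
  separated bad balls at scale \<open>L\<close>, and quasi independence gives
  \<open>p(L') \<le> (C L') ^ (2 d) * (p(L)\<^sup>2 + exp (- (L powr \<beta>)))\<close>. With \<open>L' = L * sqrt L\<close> this iterates to
  \<open>p(L) \<longlongrightarrow> 0\<close> with \<open>\<delta>\<close> bounded below, provided \<open>p\<close> is small at one large scale; the latter is achieved
  by decreasing \<open>\<delta>\<close>, because a continuous metric is positive definite, uniformly on compact sets.\<close>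

section \<open>The subadditive ergodic theorem\<close>

text \<open>Continuity of \<open>g\<close> is no event of the product sigma-algebra
  \<open>field_space\<close>, and the distance is an infimum over uncountably many paths. Hence the
  ergodic theorem is run on the law of \<open>g\<close> with a measurable substitute
  \<open>poly_dist\<close>, equal to \<open>riem_dist\<close> at continuous metrics, and events on
  the distance itself are handled in the completion. Similarly,
  \<open>E (T 0 v) \<le> E \<parallel>v\<parallel>\<close> comes from Riemann sums and Fatou's
  lemma, which look at the field at finitely many points at a time. Since the limit is known to
  exist, positivity needs a lower bound on \<open>mean_dist (n v) / n\<close> only for infinitely
  many \<open>n\<close>, one for each scale at which \<open>p\<close> is at most 1/2. The numbers
  are linked: dependence on balls of radius \<open>1 + 2 L\<close> and a gap \<open>L\<close> make
  centres separated beyond \<open>2 + 5 L\<close>; adding the unit radius gives \<open>6 L\<close>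
  once \<open>L \<ge> 3\<close>; two points \<open>12 L\<close> apart are not both closer than
  \<open>6 L\<close> to a third; rounding \<open>sqrt L\<close> down turns 12 into 13. Quasi
  independence enters with \<open>\<alpha> = 1\<close>, as the diameter \<open>2 + 4 L\<close> is at
  most \<open>L ^ 2\<close> for large \<open>L\<close>.\<close>

lemma frequently_sequentially_Suc:
  "(\<exists>\<^sub>F n in sequentially. P (Suc n)) \<longleftrightarrow> (\<exists>\<^sub>F n in sequentially. P n)"
  unfolding frequently_def using eventually_sequentially_Suc[of "\<lambda>n. \<not> P n"] by simp

text \<open>Greedy cutting of the times from \<open>i\<close> to \<open>L\<close>: at each time
  either a block of average at most \<open>c\<close> starts, or a single step is taken at the extra
  cost \<open>\<psi>\<close>. Strong induction on the remaining length.\<close>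

lemma covering_bound:
  fixes a :: "nat \<Rightarrow> nat \<Rightarrow> real"
  assumes sub: "\<And>i m n. a i (m + n) \<le> a i m + a (i + m) n"
    and zero: "\<And>i. a i 0 = 0"
    and nonneg: "\<And>i. 0 \<le> \<psi> i"
    and step: "\<And>i. i < L \<Longrightarrow> a i 1 \<le> c + \<psi> i \<or> (\<exists>n\<ge>1. i + n \<le> L \<and> a i n \<le> real n * c)"
    and "i \<le> L"
  shows "a i (L - i) \<le> real (L - i) * c + (\<Sum>j\<in>{i..<L}. \<psi> j)"
  using \<open>i \<le> L\<close>
proof (induction "L - i" arbitrary: i rule: less_induct)
  case less
  show ?case
  proof (cases "i = L")
    case True
    then show ?thesis by (simp add: zero)
  next
    case False
    then have "i < L" using less.prems by simp
    have *: ?thesis if n: "1 \<le> n" "i + n \<le> L" and an: "a i n \<le> real n * c + (\<Sum>j\<in>{i..<i+n}. \<psi> j)" for n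
    proof -
      have "a i (L - i) \<le> a i n + a (i + n) (L - (i + n))"
        using sub[of i n "L - (i + n)"] n by simp
      also have "\<dots> \<le> real n * c + (\<Sum>j\<in>{i..<i+n}. \<psi> j) + (real (L - (i + n)) * c + (\<Sum>j\<in>{i+n..<L}. \<psi> j))"
        using less.hyps[of "i + n"] n \<open>i < L\<close> an by (intro add_mono) auto
      also have "\<dots> = real (L - i) * c + (\<Sum>j\<in>{i..<L}. \<psi> j)"
      proof -
        have "(\<Sum>j\<in>{i..<L}. \<psi> j) = (\<Sum>j\<in>{i..<i+n}. \<psi> j) + (\<Sum>j\<in>{i+n..<L}. \<psi> j)"
          using n by (simp add: sum.atLeastLessThan_concat)
        moreover have "real (L - i) = real n + real (L - (i + n))"
          using n by (simp add: of_nat_diff)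
        ultimately show ?thesis by (simp add: algebra_simps)
      qed
      finally show ?thesis .
    qed
    from step[OF \<open>i < L\<close>] show ?thesis
    proof
      assume "a i 1 \<le> c + \<psi> i"
      then show ?thesis using \<open>i < L\<close> by (intro *[of 1]) auto
    next
      assume "\<exists>n\<ge>1. i + n \<le> L \<and> a i n \<le> real n * c"
      then obtain n where n: "1 \<le> n" "i + n \<le> L" "a i n \<le> real n * c" by blast
      have "0 \<le> (\<Sum>j\<in>{i..<i+n}. \<psi> j)" by (intro sum_nonneg nonneg)
      then show ?thesis using n by (intro *[of n]) auto
    qed
  qed
qed

section \<open>Measure-preserving maps and means of subadditive sequences\<close>

locale measure_preserving = prob_space N for N :: "'a measure" +
  fixes \<tau> :: "'a \<Rightarrow> 'a"
  assumes measurable_tau [measurable]: "\<tau> \<in> measurable N N"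
    and distr_tau: "distr N N \<tau> = N"
begin

lemma measurable_tau_funpow [measurable]: "(\<tau> ^^ k) \<in> measurable N N"
proof (induction k)
  case (Suc k)
  show ?case using measurable_comp[OF Suc measurable_tau] by (simp add: comp_def)
qed (simp add: id_def)

lemma distr_tau_funpow: "distr N N (\<tau> ^^ k) = N"
proof (induction k)
  case 0
  then show ?case by (simp add: id_def distr_id2)
next
  case (Suc k)
  have "distr N N (\<tau> ^^ Suc k) = distr (distr N N \<tau>) N (\<tau> ^^ k)"
    unfolding funpow_Suc_right by (subst distr_distr) auto
  then show ?case by (simp only: Suc distr_tau)
qed

lemma AE_tau_funpow:
  assumes "AE x in N. P x"
  shows "AE x in N. P ((\<tau> ^^ k) x)"
  using assms by (intro AE_distrD[OF measurable_tau_funpow]) (simp only: distr_tau_funpow)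

lemma integrable_tau_funpow:
  fixes f :: "'a \<Rightarrow> real"
  assumes "integrable N f"
  shows "integrable N (\<lambda>x. f ((\<tau> ^^ k) x))"
  using assms by (intro integrable_distr[OF measurable_tau_funpow]) (simp add: distr_tau_funpow)

lemma integral_tau_funpow:
  fixes f :: "'a \<Rightarrow> real"
  assumes [measurable]: "f \<in> borel_measurable N"
  shows "(\<integral>x. f ((\<tau> ^^ k) x) \<partial>N) = (\<integral>x. f x \<partial>N)"
  by (subst integral_distr[OF measurable_tau_funpow[of k], symmetric]) (auto simp: distr_tau_funpow)

lemma AE_subadditive_orbit:
  fixes f :: "nat \<Rightarrow> 'a \<Rightarrow> real"
  assumes "\<And>m n. AE x in N. f (m + n) x \<le> f m x + f n ((\<tau> ^^ m) x)"
  shows "AE x in N. \<forall>i m n. f (m + n) ((\<tau> ^^ i) x) \<le> f m ((\<tau> ^^ i) x) + f n ((\<tau> ^^ (i + m)) x)"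
proof (unfold AE_all_countable, intro allI)
  fix i m n
  have "(\<tau> ^^ m) ((\<tau> ^^ i) x) = (\<tau> ^^ (i + m)) x" for x
    by (simp add: add.commute[of i] funpow_add)
  with AE_tau_funpow[OF assms[of m n], of i]
  show "AE x in N. f (m + n) ((\<tau> ^^ i) x) \<le> f m ((\<tau> ^^ i) x) + f n ((\<tau> ^^ (i + m)) x)"
    by simp
qed

text \<open>The covering argument of Katznelson and Weiss: almost every orbit is cut into stretches
  along which the average is at most \<open>c\<close>, up to a set of times of small density.\<close>

lemma subadditive_mean_le:
  fixes f :: "nat \<Rightarrow> 'a \<Rightarrow> real"
  assumes int: "\<And>n. integrable N (f n)"
    and sub: "\<And>m n. AE x in N. f (m + n) x \<le> f m x + f n ((\<tau> ^^ m) x)"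
    and zero: "\<And>x. f 0 x = 0"
    and ex: "AE x in N. \<exists>n\<ge>1. f n x \<le> real n * c"
    and lower: "\<And>n. real n * \<gamma> \<le> (\<integral>x. f n x \<partial>N)"
  shows "\<gamma> \<le> c"
proof -
  have [measurable]: "f n \<in> borel_measurable N" for n using int by (rule borel_measurable_integrable)
  \<comment> \<open>The points from which no stretch of length at most \<open>K\<close> has average
    at most \<open>c\<close>; by \<open>ex\<close> they shrink to a null set as \<open>K\<close>
    grows.\<close>
  define W where "W K = {x \<in> space N. \<forall>n\<in>{1..K}. real n * c < f n x}" for K
  have [measurable]: "W K \<in> sets N" for K unfolding W_def by measurable
  define \<phi> where "\<phi> x = \<bar>f 1 x\<bar> + \<bar>c\<bar>" for x
  have \<phi>_int: "integrable N \<phi>" unfolding \<phi>_def using int[of 1] by auto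
  have [measurable]: "\<phi> \<in> borel_measurable N" using \<phi>_int by (rule borel_measurable_integrable)
  have \<phi>0: "0 \<le> \<phi> x" for x by (simp add: \<phi>_def)
  define w where "w K = (\<integral>x. \<phi> x * indicator (W K) x \<partial>N)" for K
  have int_\<phi>W: "integrable N (\<lambda>x. \<phi> x * indicator (W K) x)" for K
    using integrable_mult_indicator[OF _ \<phi>_int, of "W K"] by (simp add: mult.commute)
  have bound: "\<gamma> \<le> c + w K + real K * (\<integral>x. \<phi> x \<partial>N) / real L" if L: "L \<ge> 1" for K L
  proof -
    \<comment> \<open>The cost \<open>\<phi>\<close> is charged at times in \<open>W K\<close> and
      at the last \<open>K\<close> times, where a good stretch might overrun \<open>L\<close>. The
      latter contribute at most \<open>K\<close> times the mean of \<open>\<phi>\<close>, negligible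
      after division by \<open>L\<close>.\<close>
    define h where "h j x = \<phi> x * indicator (W K) x + of_bool (L \<le> j + K) * \<phi> x" for j x
    have h_int: "integrable N (h j)" for j
      unfolding h_def using int_\<phi>W \<phi>_int by auto
    have sub': "AE x in N. \<forall>i m n. f (m + n) ((\<tau> ^^ i) x) \<le> f m ((\<tau> ^^ i) x) + f n ((\<tau> ^^ (i + m)) x)"
      by (rule AE_subadditive_orbit[OF sub])
    have "AE x in N. f L x \<le> real L * c + (\<Sum>j\<in>{0..<L}. h j ((\<tau> ^^ j) x))"
      using sub' AE_space
    proof eventually_elim
      case (elim x)
      have sp: "(\<tau> ^^ i) x \<in> space N" for i
        using measurable_space[OF measurable_tau_funpow] elim by blast
      have "f (L - 0) ((\<tau> ^^ 0) x) \<le> real (L - 0) * c + (\<Sum>j\<in>{0..<L}. h j ((\<tau> ^^ j) x))"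
      proof (rule covering_bound[where a = "\<lambda>i n. f n ((\<tau> ^^ i) x)"])
        fix i assume "i < L"
        show "f 1 ((\<tau> ^^ i) x) \<le> c + h i ((\<tau> ^^ i) x) \<or>
            (\<exists>n\<ge>1. i + n \<le> L \<and> f n ((\<tau> ^^ i) x) \<le> real n * c)"
        proof (cases "L \<le> i + K \<or> (\<tau> ^^ i) x \<in> W K")
          case True
          then have "\<phi> ((\<tau> ^^ i) x) \<le> h i ((\<tau> ^^ i) x)"
            using \<phi>0[of "(\<tau> ^^ i) x"] by (auto simp: h_def)
          then show ?thesis unfolding \<phi>_def by auto
        next
          case False
          then obtain n where "n \<in> {1..K}" "f n ((\<tau> ^^ i) x) \<le> real n * c"
            using sp[of i] unfolding W_def by force
          then show ?thesis using False by (intro disjI2 exI[of _ n]) auto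
        qed
      qed (use elim zero \<phi>0 in \<open>auto simp: h_def\<close>)
      then show ?case by simp
    qed
    then have "(\<integral>x. f L x \<partial>N) \<le> (\<integral>x. real L * c + (\<Sum>j\<in>{0..<L}. h j ((\<tau> ^^ j) x)) \<partial>N)"
      using int h_int by (intro integral_mono_AE) (auto intro!: integrable_tau_funpow Bochner_Integration.integrable_sum Bochner_Integration.integrable_add)
    also have "\<dots> = real L * c + (\<Sum>j\<in>{0..<L}. (\<integral>x. h j x \<partial>N))"
    proof -
      have "(\<integral>x. h j ((\<tau> ^^ j) x) \<partial>N) = (\<integral>x. h j x \<partial>N)" for j
        using h_int by (intro integral_tau_funpow) auto
      then show ?thesis using h_int by (simp add: integrable_tau_funpow prob_space)
    qed
    also have "(\<Sum>j\<in>{0..<L}. (\<integral>x. h j x \<partial>N)) = (\<Sum>j\<in>{0..<L}. w K + of_bool (L \<le> j + K) * (\<integral>x. \<phi> x \<partial>N))"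
      unfolding h_def w_def using int_\<phi>W \<phi>_int by simp
    also have "\<dots> = real L * w K + real (card {j\<in>{0..<L}. L \<le> j + K}) * (\<integral>x. \<phi> x \<partial>N)"
      by (simp add: sum.distrib flip: sum_distrib_right) (simp add: Int_def of_bool_def sum.If_cases)
    also have "\<dots> \<le> real L * w K + real K * (\<integral>x. \<phi> x \<partial>N)"
    proof -
      have "card {j\<in>{0..<L}. L \<le> j + K} \<le> card {L - K..<L}"
        by (intro card_mono) auto
      also have "\<dots> \<le> K" by simp
      finally show ?thesis using \<phi>0 by (intro add_left_mono mult_right_mono) auto
    qed
    finally have "real L * \<gamma> \<le> real L * c + real L * w K + real K * (\<integral>x. \<phi> x \<partial>N)"
      using lower[of L] by simp
    then have "real L * \<gamma> \<le> real L * (c + w K + real K * (\<integral>x. \<phi> x \<partial>N) / real L)"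
      using L by (simp add: distrib_left)
    then show ?thesis using L by simp
  qed
  \<comment> \<open>The order of limits matters: \<open>L\<close> tends to infinity with
    \<open>K\<close> fixed, and only then does \<open>K\<close>.\<close>
  have "\<gamma> \<le> c + w K" for K
  proof -
    have "(\<lambda>L. c + w K + real K * (\<integral>x. \<phi> x \<partial>N) / real L) \<longlonglongrightarrow> c + w K + 0"
      by (intro tendsto_intros lim_const_over_n)
    moreover have "eventually (\<lambda>L. \<gamma> \<le> c + w K + real K * (\<integral>x. \<phi> x \<partial>N) / real L) sequentially"
      using eventually_ge_at_top[of 1] by eventually_elim (rule bound)
    ultimately show ?thesis by (intro tendsto_lowerbound[where F = sequentially]) auto
  qed
  moreover
  have "w \<longlonglongrightarrow> (\<integral>x. 0 \<partial>N)"
    unfolding w_def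
  proof (rule integral_dominated_convergence[where w = \<phi>])
    show "AE x in N. (\<lambda>K. \<phi> x * indicator (W K) x) \<longlonglongrightarrow> 0"
      using ex
    proof eventually_elim
      case (elim x)
      then obtain n where n: "n \<ge> 1" "f n x \<le> real n * c" by blast
      have "eventually (\<lambda>K. \<phi> x * indicator (W K) x = 0) sequentially"
        using eventually_ge_at_top[of n] by eventually_elim (use n in \<open>auto simp: W_def indicator_def not_less\<close>)
      then show ?case by (rule tendsto_eventually)
    qed
  qed (use \<phi>_int \<phi>0 in \<open>auto simp: indicator_def\<close>)
  then have "(\<lambda>K. c + w K) \<longlonglongrightarrow> c + 0" by (intro tendsto_intros) simp
  ultimately show ?thesis
    using tendsto_lowerbound[of "\<lambda>K. c + w K" "c + 0" sequentially \<gamma>] by simp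
qed

end

section \<open>Almost sure bounds under ergodicity\<close>

locale ergodic_preserving = measure_preserving +
  assumes ergodic: "\<And>E. E \<in> sets N \<Longrightarrow> \<tau> -` E \<inter> space N = E \<Longrightarrow> measure N E = 0 \<or> measure N E = 1"
begin

text \<open>\<open>ergodic\<close> speaks of strictly invariant sets, while \<open>B\<close> is
  almost invariant in one direction only. The set of points visiting \<open>B\<close> infinitely
  often is strictly invariant. If it is null, the measures of the iterated preimages of
  \<open>B\<close>, all equal to that of \<open>B\<close>, tend to 0; if it has full measure, some
  iterate lies in \<open>B\<close>, and \<open>sub\<close> pulls this back to the point
  itself.\<close>

lemma AE_or_AE_not:
  assumes [measurable]: "B \<in> sets N" and sub: "AE x in N. \<tau> x \<in> B \<longrightarrow> x \<in> B"
  shows "(AE x in N. x \<in> B) \<or> (AE x in N. x \<notin> B)"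
proof -
  define E where "E = {x \<in> space N. \<exists>\<^sub>\<infinity>i. (\<tau> ^^ i) x \<in> B}"
  have E [measurable]: "E \<in> sets N"
    unfolding E_def INFM_nat by measurable
  have "\<tau> -` E \<inter> space N = E"
  proof -
    have "(\<exists>\<^sub>\<infinity>i. (\<tau> ^^ i) (\<tau> x) \<in> B) = (\<exists>\<^sub>\<infinity>i. (\<tau> ^^ i) x \<in> B)" for x
      using frequently_sequentially_Suc[of "\<lambda>i. (\<tau> ^^ i) x \<in> B"]
      by (simp add: cofinite_eq_sequentially funpow_swap1)
    moreover have "x \<in> space N \<Longrightarrow> \<tau> x \<in> space N" for x
      using measurable_space[OF measurable_tau] by blast
    ultimately show ?thesis unfolding E_def by auto
  qed
  then consider "measure N E = 0" | "measure N E = 1" using ergodic[OF E] by blast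
  then show ?thesis
  proof cases
    case 1
    then have "AE x in N. x \<notin> E" using E by (simp add: prob_eq_0)
    then have ev: "AE x in N. (\<lambda>i. indicator B ((\<tau> ^^ i) x) :: real) \<longlonglongrightarrow> 0"
      using AE_space
    proof eventually_elim
      case (elim x)
      then have "eventually (\<lambda>i. (\<tau> ^^ i) x \<notin> B) sequentially"
        by (auto simp: E_def frequently_def cofinite_eq_sequentially)
      then have "eventually (\<lambda>i. (indicator B ((\<tau> ^^ i) x) :: real) = 0) sequentially"
        by eventually_elim simp
      then show ?case by (rule tendsto_eventually)
    qed
    have "(\<lambda>i. \<integral>x. indicator B ((\<tau> ^^ i) x) \<partial>N) \<longlonglongrightarrow> (\<integral>x. (0::real) \<partial>N)"
      by (rule integral_dominated_convergence[where w = "\<lambda>_. 1", OF _ _ _ ev]) (auto simp: indicator_def)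
    moreover have "(\<integral>x. indicator B ((\<tau> ^^ i) x) \<partial>N) = measure N B" for i
      by (subst integral_tau_funpow) auto
    ultimately have "measure N B = 0" by (simp add: LIMSEQ_const_iff)
    then show ?thesis by (simp add: prob_eq_0)
  next
    case 2
    have "AE x in N. \<forall>i. (\<tau> ^^ i) x \<in> B \<longrightarrow> x \<in> B"
    proof (unfold AE_all_countable, intro allI)
      fix i show "AE x in N. (\<tau> ^^ i) x \<in> B \<longrightarrow> x \<in> B"
      proof (induction i)
        case (Suc i)
        show ?case using Suc AE_tau_funpow[OF sub, of i] by eventually_elim auto
      qed auto
    qed
    moreover have "AE x in N. x \<in> E" using 2 E by (simp add: prob_eq_1)
    ultimately have "AE x in N. x \<in> B"
    proof eventually_elim
      case (elim x) then show ?case unfolding E_def by (auto dest!: INFM_EX)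
    qed
    then show ?thesis by blast
  qed
qed

text \<open>Suppose that \<open>f n / n\<close> stays infinitely often below some value less than
  \<open>c\<close>, where \<open>q < c < \<gamma>\<close>. By subadditivity this property passes
  from \<open>\<tau> x\<close> to \<open>x\<close>, so it has probability 0 or 1; probability 1
  would give \<open>\<gamma> \<le> c\<close> by \<open>subadditive_mean_le\<close>.\<close>

lemma subadditive_eventually_ge:
  fixes f :: "nat \<Rightarrow> 'a \<Rightarrow> real"
  assumes int: "\<And>n. integrable N (f n)"
    and sub: "\<And>m n. AE x in N. f (m + n) x \<le> f m x + f n ((\<tau> ^^ m) x)"
    and zero: "\<And>x. f 0 x = 0"
    and lower: "\<And>n. real n * \<gamma> \<le> (\<integral>x. f n x \<partial>N)"
    and "q < \<gamma>"
  shows "AE x in N. eventually (\<lambda>n. real n * q \<le> f n x) sequentially"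
proof -
  have [measurable]: "f n \<in> borel_measurable N" for n using int by (rule borel_measurable_integrable)
  obtain c where c: "q < c" "c < \<gamma>" using \<open>q < \<gamma>\<close> dense by blast
  \<comment> \<open>Passing from \<open>\<tau> x\<close> to \<open>x\<close> costs the constant
    \<open>f 1 x\<close>; replacing \<open>k\<close> by \<open>k + 1\<close> creates a linear slack
    that absorbs it, so the union over all \<open>k\<close> is preserved.\<close>
  define B where "B = {x \<in> space N. \<exists>k. \<exists>\<^sub>\<infinity>n. f n x < real n * (c - 1 / Suc k)}"
  have B [measurable]: "B \<in> sets N" unfolding B_def INFM_nat by measurable
  have "AE x in N. \<tau> x \<in> B \<longrightarrow> x \<in> B"
  proof -
    have "AE x in N. \<forall>n. f (1 + n) x \<le> f 1 x + f n ((\<tau> ^^ 1) x)"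
      using sub unfolding AE_all_countable by blast
    then show ?thesis using AE_space
    proof eventually_elim
      case (elim x)
      show ?case
      proof
        assume "\<tau> x \<in> B"
        then obtain k where k: "\<exists>\<^sub>\<infinity>n. f n (\<tau> x) < real n * (c - 1 / Suc k)" by (auto simp: B_def)
        define q1 where "q1 = c - 1 / Suc k"
        define q2 where "q2 = c - 1 / Suc (Suc k)"
        have "q1 < q2" unfolding q1_def q2_def by (simp add: field_simps)
        have "eventually (\<lambda>n. f 1 x + real n * q1 < real (Suc n) * q2) sequentially"
        proof -
          have "eventually (\<lambda>n. (f 1 x - q2) / (q2 - q1) < real n) sequentially"
            using filterlim_real_sequentially filterlim_at_top_dense by blast
          then show ?thesis
            by eventually_elim (use \<open>q1 < q2\<close> in \<open>simp add: field_simps\<close>)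
        qed
        then have "eventually (\<lambda>n. f n (\<tau> x) < real n * q1 \<longrightarrow> f (Suc n) x < real (Suc n) * q2) sequentially"
        proof eventually_elim
          fix n assume "f 1 x + real n * q1 < real (Suc n) * q2"
          then show "f n (\<tau> x) < real n * q1 \<longrightarrow> f (Suc n) x < real (Suc n) * q2"
            using elim(1)[rule_format, of n] by simp
        qed
        with k have "\<exists>\<^sub>\<infinity>n. f (Suc n) x < real (Suc n) * q2"
          unfolding cofinite_eq_sequentially q1_def[symmetric] by (rule frequently_rev_mp)
        then have "\<exists>\<^sub>\<infinity>n. f n x < real n * q2"
          unfolding cofinite_eq_sequentially
          by (simp only: frequently_sequentially_Suc[of "\<lambda>n. f n x < real n * q2"])
        then show "x \<in> B" using elim(2) unfolding B_def q2_def by blast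
      qed
    qed
  qed
  then have "(AE x in N. x \<in> B) \<or> (AE x in N. x \<notin> B)" by (rule AE_or_AE_not[OF B])
  then show ?thesis
  proof
    assume "AE x in N. x \<in> B"
    then have "AE x in N. \<exists>n\<ge>1. f n x \<le> real n * c"
    proof eventually_elim
      case (elim x)
      then obtain k where "\<exists>\<^sub>\<infinity>n. f n x < real n * (c - 1 / Suc k)" by (auto simp: B_def)
      then obtain n where "n > 0" "f n x < real n * (c - 1 / Suc k)"
        unfolding INFM_nat by blast
      moreover have "real n * (c - 1 / Suc k) \<le> real n * c" by (intro mult_left_mono) auto
      ultimately show ?case by (intro exI[of _ n] conjI) linarith+
    qed
    from subadditive_mean_le[OF int sub zero this lower] c show ?thesis by simp
  next
    assume "AE x in N. x \<notin> B"
    then show ?thesis using AE_space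
    proof eventually_elim
      case (elim x)
      obtain k where "inverse (real (Suc k)) < c - q" using reals_Archimedean[of "c - q"] c by auto
      then have k: "q \<le> c - 1 / Suc k" by (simp add: field_simps)
      have "eventually (\<lambda>n. real n * (c - 1 / Suc k) \<le> f n x) sequentially"
        using elim unfolding B_def cofinite_eq_sequentially frequently_def by (auto simp: not_less)
      then show ?case
      proof eventually_elim
        case (elim n)
        then show ?case using mult_left_mono[OF k, of "real n"] by linarith
      qed
    qed
  qed
qed

text \<open>The upper half of Birkhoff's theorem: orbit sums are additive, so their negatives are
  subadditive as well, and the lower bound for these is an upper bound for the sums.\<close>

lemma ergodic_average_eventually_le:
  fixes F :: "'a \<Rightarrow> real"
  assumes int: "integrable N F" and "(\<integral>x. F x \<partial>N) < c"
  shows "AE x in N. eventually (\<lambda>n. (\<Sum>i<n. F ((\<tau> ^^ i) x)) \<le> real n * c) sequentially"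
proof -
  have [measurable]: "F \<in> borel_measurable N" using int by (rule borel_measurable_integrable)
  have "AE x in N. eventually (\<lambda>n. real n * - c \<le> - (\<Sum>i<n. F ((\<tau> ^^ i) x))) sequentially"
  proof (rule subadditive_eventually_ge[where \<gamma> = "- (\<integral>x. F x \<partial>N)"])
    fix n
    show "integrable N (\<lambda>x. - (\<Sum>i<n. F ((\<tau> ^^ i) x)))"
      using int by (auto intro!: integrable_tau_funpow)
    show "real n * - (\<integral>x. F x \<partial>N) \<le> (\<integral>x. - (\<Sum>i<n. F ((\<tau> ^^ i) x)) \<partial>N)"
      using int by (simp add: integrable_tau_funpow integral_tau_funpow)
  next
    fix m n
    have "(\<Sum>i<m + n. F ((\<tau> ^^ i) x)) = (\<Sum>i<m. F ((\<tau> ^^ i) x)) + (\<Sum>i<n. F ((\<tau> ^^ i) ((\<tau> ^^ m) x)))" for x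
    proof (induction n)
      case (Suc n)
      have "(\<tau> ^^ (m + n)) x = (\<tau> ^^ n) ((\<tau> ^^ m) x)"
        by (metis add.commute comp_apply funpow_add)
      with Suc show ?case by simp
    qed simp
    then show "AE x in N. - (\<Sum>i<m + n. F ((\<tau> ^^ i) x))
        \<le> - (\<Sum>i<m. F ((\<tau> ^^ i) x)) + - (\<Sum>i<n. F ((\<tau> ^^ i) ((\<tau> ^^ m) x)))"
      by simp
  qed (use assms in auto)
  then show ?thesis by eventually_elim simp
qed

end

text \<open>\<open>\<gamma>\<close> is the infimum of \<open>e n / n\<close>. For the upper bound,
  time is cut into blocks of length \<open>k\<close> with \<open>e k / k\<close> close to
  \<open>\<gamma>\<close>, and \<open>f k\<close> is averaged along \<open>\<tau> ^^ k\<close>. This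
  requires ergodicity of all powers, which ergodicity of \<open>\<tau>\<close> does not give but
  ergodicity under all translations does.\<close>

theorem (in measure_preserving) subadditive_ergodic:
  fixes f :: "nat \<Rightarrow> 'a \<Rightarrow> real"
  assumes erg: "\<And>k. k \<ge> 1 \<Longrightarrow> ergodic_preserving N (\<tau> ^^ k)"
    and int: "\<And>n. integrable N (f n)"
    and sub: "\<And>m n. AE x in N. f (m + n) x \<le> f m x + f n ((\<tau> ^^ m) x)"
    and zero: "\<And>x. f 0 x = 0"
    and nonneg: "\<And>n x. 0 \<le> f n x"
  obtains \<gamma> where "AE x in N. (\<lambda>n. f n x / real n) \<longlonglongrightarrow> \<gamma>"
    and "(\<lambda>n. (\<integral>x. f n x \<partial>N) / real n) \<longlonglongrightarrow> \<gamma>"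
    and "(\<lambda>n. \<integral>x. \<bar>f n x / real n - \<gamma>\<bar> \<partial>N) \<longlonglongrightarrow> 0"
proof -
  interpret e1: ergodic_preserving N \<tau> using erg[of 1] by simp
  have [measurable]: "f n \<in> borel_measurable N" for n using int by (rule borel_measurable_integrable)
  define e where "e n = (\<integral>x. f n x \<partial>N)" for n
  have e0: "0 \<le> e n" for n unfolding e_def using nonneg by simp
  have e_sub: "e (m + n) \<le> e m + e n" for m n
  proof -
    have "e (m + n) \<le> (\<integral>x. f m x + f n ((\<tau> ^^ m) x) \<partial>N)"
      unfolding e_def using int sub by (intro integral_mono_AE) (auto intro!: integrable_tau_funpow)
    then show ?thesis using int by (simp add: e_def integrable_tau_funpow integral_tau_funpow)
  qed
  define \<gamma> where "\<gamma> = (INF n\<in>{1..}. e n / real n)"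
  have bdd: "bdd_below ((\<lambda>n. e n / real n) ` {1..})" using e0 by (intro bdd_belowI2[of _ 0]) auto
  have \<gamma>_le: "real n * \<gamma> \<le> e n" for n
  proof (cases "n = 0")
    case False
    then have "\<gamma> \<le> e n / real n" unfolding \<gamma>_def by (intro cINF_lower[OF bdd]) auto
    then show ?thesis using False by (simp add: field_simps)
  qed (simp add: e0)
  have \<gamma>0: "0 \<le> \<gamma>" unfolding \<gamma>_def using e0 by (intro cINF_greatest) auto
  have ex_k: "\<exists>k\<ge>1. e k / real k < q" if "\<gamma> < q" for q
    using that cINF_less_iff[OF _ bdd, of q] unfolding \<gamma>_def by auto

  \<comment> \<open>Shared by the means and by almost every single orbit. The remainder
    \<open>n mod k\<close> takes finitely many values, so its contribution is bounded and disappears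
    after division by \<open>n\<close>.\<close>
  have eventually_upper: "eventually (\<lambda>n. a n / real n < q) sequentially"
    if k: "k \<ge> 1" and b: "b \<ge> 0" "b / real k < q"
      and a: "eventually (\<lambda>n. a n \<le> a (n mod k) + real (n div k) * b) sequentially"
    for a :: "nat \<Rightarrow> real" and k b q
  proof -
    have "(\<lambda>n. Max (a ` {..<k}) / real n + b / real k) \<longlonglongrightarrow> 0 + b / real k"
      by (intro tendsto_intros lim_const_over_n)
    then have "eventually (\<lambda>n. Max (a ` {..<k}) / real n + b / real k < q) sequentially"
      using b by (intro order_tendstoD) auto
    then show ?thesis using a eventually_ge_at_top[of 1]
    proof eventually_elim
      case (elim n)
      have "real (n div k) / real n \<le> 1 / real k"
      proof -
        have "real (n div k) * real k \<le> real n" by (metis div_times_less_eq_dividend of_nat_le_iff of_nat_mult)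
        then show ?thesis using k elim by (simp add: field_simps)
      qed
      then have "real (n div k) / real n * b \<le> 1 / real k * b" using b by (intro mult_right_mono) auto
      moreover have "a (n mod k) \<le> Max (a ` {..<k})" using k by (intro Max_ge) auto
      then have "a (n mod k) / real n \<le> Max (a ` {..<k}) / real n" by (intro divide_right_mono) auto
      moreover have "a n / real n \<le> (a (n mod k) + real (n div k) * b) / real n"
        using elim by (intro divide_right_mono) auto
      ultimately show ?case using elim by (simp add: add_divide_distrib)
    qed
  qed

  have e_lim: "(\<lambda>n. e n / real n) \<longlonglongrightarrow> \<gamma>"
  proof (rule order_tendstoI)
    fix q assume "q < \<gamma>"
    show "eventually (\<lambda>n. q < e n / real n) sequentially"
      using eventually_ge_at_top[of 1]
    proof eventually_elim
      case (elim n)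
      then have "\<gamma> \<le> e n / real n" using \<gamma>_le[of n] by (simp add: field_simps)
      then show ?case using \<open>q < \<gamma>\<close> by simp
    qed
  next
    fix q assume "\<gamma> < q"
    then obtain k where k: "k \<ge> 1" "e k / real k < q" using ex_k by blast
    have e_mult: "e (j + m * k) \<le> e j + real m * e k" for j m
    proof (induction m)
      case (Suc m)
      then show ?case using e_sub[of "j + m * k" k] by (simp add: algebra_simps)
    qed simp
    show "eventually (\<lambda>n. e n / real n < q) sequentially"
    proof (intro eventually_upper[OF k(1) e0[of k] k(2)] always_eventually allI)
      fix n show "e n \<le> e (n mod k) + real (n div k) * e k"
        using e_mult[of "n mod k" "n div k"] by simp
    qed
  qed

  have "AE x in N. \<forall>i. eventually (\<lambda>n. real n * (\<gamma> - 1 / Suc i) \<le> f n x) sequentially"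
    unfolding AE_all_countable using int sub zero \<gamma>_le unfolding e_def
    by (intro allI e1.subadditive_eventually_ge[where \<gamma> = \<gamma>]) auto
  moreover have "AE x in N. \<forall>i m n. f (m + n) ((\<tau> ^^ i) x) \<le> f m ((\<tau> ^^ i) x) + f n ((\<tau> ^^ (i + m)) x)"
    by (rule AE_subadditive_orbit[OF sub])
  \<comment> \<open>The remainder is placed in front of the blocks, so the block averages are
    controlled from every starting time \<open>j\<close>; the tolerances \<open>1 / Suc i\<close>
    keep the exceptional null sets countable in number.\<close>
  moreover have "AE x in N. \<forall>k j i. k \<ge> 1 \<longrightarrow> eventually (\<lambda>m. (\<Sum>l<m. f k ((\<tau> ^^ (k * l + j)) x)) \<le> real m * (e k + 1 / Suc i)) sequentially"
    unfolding AE_all_countable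
  proof (intro allI)
    fix k j i :: nat
    show "AE x in N. k \<ge> 1 \<longrightarrow> eventually (\<lambda>m. (\<Sum>l<m. f k ((\<tau> ^^ (k * l + j)) x)) \<le> real m * (e k + 1 / Suc i)) sequentially"
    proof (cases "k \<ge> 1")
      case True
      interpret ek: ergodic_preserving N "\<tau> ^^ k" using erg[OF True] .
      have "AE x in N. eventually (\<lambda>m. (\<Sum>l<m. f k (((\<tau> ^^ k) ^^ l) x)) \<le> real m * (e k + 1 / Suc i)) sequentially"
        using int by (intro ek.ergodic_average_eventually_le) (auto simp: e_def)
      from AE_tau_funpow[OF this, of j] show ?thesis
        by (simp add: funpow_mult funpow_add)
    qed simp
  qed
  ultimately have lim: "AE x in N. (\<lambda>n. f n x / real n) \<longlonglongrightarrow> \<gamma>"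
  proof eventually_elim
    case (elim x)
    show ?case
    proof (rule order_tendstoI)
      fix q assume "q < \<gamma>"
      then obtain i where i: "inverse (real (Suc i)) < \<gamma> - q" using reals_Archimedean[of "\<gamma> - q"] by auto
      show "eventually (\<lambda>n. q < f n x / real n) sequentially"
        using eventually_ge_at_top[of 1] elim(1)[rule_format, of i]
      proof eventually_elim
        case (elim n)
        then have "\<gamma> - 1 / Suc i \<le> f n x / real n" by (simp add: field_simps)
        then show ?case using i unfolding inverse_eq_divide by linarith
      qed
    next
      fix q assume "\<gamma> < q"
      then obtain k where k: "k \<ge> 1" "e k / real k < q" using ex_k by blast
      then have "0 < q * real k - e k" by (simp add: field_simps)
      then obtain i where i: "inverse (real (Suc i)) < q * real k - e k" using reals_Archimedean by blast
      define b where "b = e k + 1 / Suc i"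
      have "b < q * real k" using i unfolding b_def inverse_eq_divide by linarith
      then have b: "b \<ge> 0" "b / real k < q" using k e0[of k] by (auto simp: b_def pos_divide_less_eq)
      have f_mult: "f (j + m * k) x \<le> f j x + (\<Sum>l<m. f k ((\<tau> ^^ (k * l + j)) x))" for j m
      proof (induction m)
        case (Suc m)
        have "f (j + m * k + k) x \<le> f (j + m * k) x + f k ((\<tau> ^^ (j + m * k)) x)"
          using elim(2)[rule_format, of "j + m * k" k 0] by simp
        with Suc show ?case by (simp add: algebra_simps)
      qed simp
      have "eventually (\<lambda>m. \<forall>j\<in>{..<k}. (\<Sum>l<m. f k ((\<tau> ^^ (k * l + j)) x)) \<le> real m * b) sequentially"
        using elim(3) k unfolding b_def by (intro eventually_ball_finite) auto
      moreover have "filterlim (\<lambda>n. n div k) sequentially sequentially"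
        using k by (intro filterlim_at_top_div_const_nat) auto
      ultimately have "eventually (\<lambda>n. \<forall>j\<in>{..<k}. (\<Sum>l<n div k. f k ((\<tau> ^^ (k * l + j)) x)) \<le> real (n div k) * b) sequentially"
        by (rule eventually_compose_filterlim)
      then have "eventually (\<lambda>n. f n x \<le> f (n mod k) x + real (n div k) * b) sequentially"
      proof eventually_elim
        case (elim n)
        have "(\<Sum>l<n div k. f k ((\<tau> ^^ (k * l + n mod k)) x)) \<le> real (n div k) * b"
          using elim k by auto
        then show ?case using f_mult[of "n mod k" "n div k"] by simp
      qed
      then show "eventually (\<lambda>n. f n x / real n < q) sequentially"
        by (rule eventually_upper[OF k(1) b, of "\<lambda>n. f n x"])
    qed
  qed

  text \<open>Scheffe's argument: the positive part of \<open>\<gamma> - f n / n\<close> is dominated by \<open>\<gamma>\<close>.\<close>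
  have int': "integrable N (\<lambda>x. f n x / real n)" for n using int by simp
  have int'': "integrable N (\<lambda>x. max 0 (\<gamma> - f n x / real n))" for n using int' by auto
  have "(\<lambda>n. \<integral>x. max 0 (\<gamma> - f n x / real n) \<partial>N) \<longlonglongrightarrow> (\<integral>x. 0 \<partial>N)"
  proof (rule integral_dominated_convergence[where w = "\<lambda>_. \<gamma>"])
    show "AE x in N. (\<lambda>n. max 0 (\<gamma> - f n x / real n)) \<longlonglongrightarrow> 0"
      using lim
    proof eventually_elim
      case (elim x)
      then have "(\<lambda>n. max 0 (\<gamma> - f n x / real n)) \<longlonglongrightarrow> max 0 (\<gamma> - \<gamma>)"
        by (intro tendsto_intros)
      then show ?case by simp
    qed
  qed (use nonneg \<gamma>0 in auto)
  then have "(\<lambda>n. e n / real n - \<gamma> + 2 * (\<integral>x. max 0 (\<gamma> - f n x / real n) \<partial>N)) \<longlonglongrightarrow> \<gamma> - \<gamma> + 2 * 0"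
    by (intro tendsto_intros e_lim) simp
  moreover have "e n / real n - \<gamma> + 2 * (\<integral>x. max 0 (\<gamma> - f n x / real n) \<partial>N) = (\<integral>x. \<bar>f n x / real n - \<gamma>\<bar> \<partial>N)" for n
  proof -
    have "(\<integral>x. \<bar>f n x / real n - \<gamma>\<bar> \<partial>N) = (\<integral>x. f n x / real n - \<gamma> + 2 * max 0 (\<gamma> - f n x / real n) \<partial>N)"
      by (intro Bochner_Integration.integral_cong) (auto simp: abs_if max_def)
    also have "\<dots> = e n / real n - \<gamma> + 2 * (\<integral>x. max 0 (\<gamma> - f n x / real n) \<partial>N)"
      using int' int'' int by (simp add: e_def prob_space)
    finally show ?thesis by simp
  qed
  ultimately have "(\<lambda>n. \<integral>x. \<bar>f n x / real n - \<gamma>\<bar> \<partial>N) \<longlonglongrightarrow> 0" by simp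
  with lim e_lim show ?thesis unfolding e_def by (rule that)
qed

section \<open>Riemannian length and distance\<close>

lemma riem_norm_eq: "riem_norm A w = sqrt (\<Sum>i\<in>UNIV. w $ i * (\<Sum>j\<in>UNIV. A $ i $ j * w $ j))"
  by (simp add: riem_norm_def inner_vec_def matrix_vector_mult_def)

lemma riem_norm_0 [simp]: "riem_norm A 0 = 0"
  by (simp add: riem_norm_def)

lemma riem_norm_scaleR: "riem_norm A (c *\<^sub>R w) = \<bar>c\<bar> * riem_norm A w"
proof -
  have "riem_norm A (c *\<^sub>R w) = sqrt (c\<^sup>2 * (w \<bullet> (A *v w)))"
    by (simp add: riem_norm_def scaleR_matrix_vector_assoc[symmetric] matrix_vector_mult_scaleR power2_eq_square mult.assoc)
  then show ?thesis by (simp add: real_sqrt_mult riem_norm_def)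
qed

lemma riem_norm_minus [simp]: "riem_norm A (- w) = riem_norm A w"
  using riem_norm_scaleR[of A "-1" w] by simp

lemma riem_norm_nonneg [simp]: "A \<in> pos_def_matrices \<Longrightarrow> 0 \<le> riem_norm A w"
  by (cases "w = 0") (auto simp: riem_norm_def pos_def_matrices_def less_imp_le)

lemma riem_norm_pos: "A \<in> pos_def_matrices \<Longrightarrow> w \<noteq> 0 \<Longrightarrow> 0 < riem_norm A w"
  by (auto simp: riem_norm_def pos_def_matrices_def)

lemma riem_norm_square: "A \<in> pos_def_matrices \<Longrightarrow> (riem_norm A w)\<^sup>2 = w \<bullet> (A *v w)"
  by (cases "w = 0") (auto simp: riem_norm_def pos_def_matrices_def less_imp_le)

lemma pos_def_inner_commute: "A \<in> pos_def_matrices \<Longrightarrow> v \<bullet> (A *v w) = w \<bullet> (A *v v)"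
proof -
  assume "A \<in> pos_def_matrices"
  then have "transpose A = A" by (simp add: pos_def_matrices_def)
  then have "v \<bullet> (A *v w) = (A *v v) \<bullet> w"
    by (metis dot_lmul_matrix transpose_matrix_vector)
  then show ?thesis by (simp add: inner_commute)
qed

text \<open>Nonnegativity of the quadratic form at \<open>b v - a w\<close>, where \<open>a\<close>
  and \<open>b\<close> are the norms of \<open>v\<close> and \<open>w\<close>.\<close>

lemma riem_norm_Cauchy_Schwarz:
  assumes A: "A \<in> pos_def_matrices"
  shows "v \<bullet> (A *v w) \<le> riem_norm A v * riem_norm A w"
proof (cases "v = 0 \<or> w = 0")
  case True
  then show ?thesis by auto
next
  case False
  define a b where "a = riem_norm A v" and "b = riem_norm A w"
  have ab: "0 < a * b" using False A by (simp add: a_def b_def riem_norm_pos)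
  let ?u = "b *\<^sub>R v - a *\<^sub>R w"
  have "0 \<le> ?u \<bullet> (A *v ?u)" using riem_norm_square[OF A, of ?u] by (metis zero_le_power2)
  also have "?u \<bullet> (A *v ?u) = b\<^sup>2 * (v \<bullet> (A *v v)) - a * b * (v \<bullet> (A *v w)) - a * b * (w \<bullet> (A *v v)) + a\<^sup>2 * (w \<bullet> (A *v w))"
    by (simp add: matrix_vector_mult_diff_distrib matrix_vector_mult_scaleR inner_diff_left inner_diff_right power2_eq_square algebra_simps)
  also have "\<dots> = 2 * (a * b) * (a * b - v \<bullet> (A *v w))"
    using riem_norm_square[OF A, of v] riem_norm_square[OF A, of w] pos_def_inner_commute[OF A, of w v]
    by (simp add: a_def[symmetric] b_def[symmetric] power2_eq_square algebra_simps)
  finally have "0 \<le> a * b - v \<bullet> (A *v w)" using ab by (simp add: zero_le_mult_iff)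
  then show ?thesis by (simp add: a_def b_def)
qed

lemma riem_norm_triangle:
  assumes A: "A \<in> pos_def_matrices"
  shows "riem_norm A (v + w) \<le> riem_norm A v + riem_norm A w"
proof (rule power2_le_imp_le)
  have "(riem_norm A (v + w))\<^sup>2 = (riem_norm A v)\<^sup>2 + 2 * (v \<bullet> (A *v w)) + (riem_norm A w)\<^sup>2"
    using pos_def_inner_commute[OF A, of w v]
    by (simp add: riem_norm_square[OF A] matrix_vector_right_distrib inner_add_left inner_add_right)
  also have "\<dots> \<le> (riem_norm A v + riem_norm A w)\<^sup>2"
    using riem_norm_Cauchy_Schwarz[OF A, of v w] by (simp add: power2_sum)
  finally show "(riem_norm A (v + w))\<^sup>2 \<le> (riem_norm A v + riem_norm A w)\<^sup>2" .
qed (use A in simp)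

lemma continuous_on_riem_norm [continuous_intros]:
  assumes "continuous_on S h" "continuous_on S w"
  shows "continuous_on S (\<lambda>x. riem_norm (h x) (w x))"
  unfolding riem_norm_eq by (intro continuous_intros assms)

lemma borel_measurable_riem_norm [measurable (raw)]:
  fixes h :: "'a \<Rightarrow> real^'n^'n"
  assumes "h \<in> borel_measurable M" "w \<in> borel_measurable M"
  shows "(\<lambda>x. riem_norm (h x) (w x)) \<in> borel_measurable M"
proof -
  have "continuous_on UNIV (\<lambda>p::(real^'n^'n) \<times> (real^'n). riem_norm (fst p) (snd p))"
    by (intro continuous_on_riem_norm continuous_on_fst continuous_on_snd continuous_on_id)
  then have m: "(\<lambda>p::(real^'n^'n) \<times> (real^'n). riem_norm (fst p) (snd p)) \<in> borel_measurable borel"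
    by (rule borel_measurable_continuous_onI)
  show ?thesis
    using measurable_compose[OF borel_measurable_Pair[OF assms] m] by simp
qed

text \<open>Extrema of a continuous positive function on the compact product of \<open>K\<close>
  with the unit sphere, extended to all vectors by homogeneity.\<close>

lemma riem_norm_bounds:
  fixes h :: "real^'n \<Rightarrow> real^'n^'n"
  assumes h: "continuous_on UNIV h" and pd: "\<And>x. h x \<in> pos_def_matrices" and K: "compact K"
  obtains c C where "c > 0" "C > 0" "\<And>p w. p \<in> K \<Longrightarrow> c * norm w \<le> riem_norm (h p) w"
    "\<And>p w. p \<in> K \<Longrightarrow> riem_norm (h p) w \<le> C * norm w"
proof (cases "K = {}")
  case True
  then show ?thesis using that[of 1 1] by auto
next
  case False
  let ?S = "K \<times> sphere (0::real^'n) 1"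
  let ?f = "\<lambda>p. riem_norm (h (fst p)) (snd p)"
  have comp: "compact ?S" using K by (intro compact_Times) auto
  have ne: "?S \<noteq> {}" using False by (simp add: sphere_eq_empty)
  have cont: "continuous_on ?S ?f"
    by (intro continuous_intros continuous_on_compose2[OF h]) auto
  obtain m where m: "m \<in> ?S" "\<And>p. p \<in> ?S \<Longrightarrow> ?f m \<le> ?f p"
    using continuous_attains_inf[OF comp ne cont] by blast
  obtain M where M: "M \<in> ?S" "\<And>p. p \<in> ?S \<Longrightarrow> ?f p \<le> ?f M"
    using continuous_attains_sup[OF comp ne cont] by blast
  have scale: "riem_norm (h p) w = norm w * ?f (p, w /\<^sub>R norm w)" for p w
    by (cases "w = 0") (simp_all add: riem_norm_scaleR)
  show ?thesis
  proof (rule that[of "?f m" "?f M"])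
    show "?f m > 0" "?f M > 0" using m(1) M(1) by (auto intro!: riem_norm_pos pd)
    fix p w assume "p \<in> K"
    show "?f m * norm w \<le> riem_norm (h p) w"
    proof (cases "w = 0")
      case False
      then have "?f m \<le> ?f (p, w /\<^sub>R norm w)" using \<open>p \<in> K\<close> by (intro m(2)) auto
      then show ?thesis unfolding scale[of p w] by (simp only: mult.commute[of _ "norm w"] mult_left_mono norm_ge_zero)
    qed simp
    show "riem_norm (h p) w \<le> ?f M * norm w"
    proof (cases "w = 0")
      case False
      then have "?f (p, w /\<^sub>R norm w) \<le> ?f M" using \<open>p \<in> K\<close> by (intro M(2)) auto
      then show ?thesis unfolding scale[of p w] by (simp only: mult.commute[of _ "norm w"] mult_left_mono norm_ge_zero)
    qed simp
  qed
qed

text \<open>Uniform continuity on \<open>K\<close> times the unit sphere gives an additive error;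
  the lower bound \<open>c\<close> for the norm there turns it into a multiplicative one.\<close>

lemma riem_norm_uniformly_comparable:
  fixes h :: "real^'n \<Rightarrow> real^'n^'n"
  assumes h: "continuous_on UNIV h" and pd: "\<And>x. h x \<in> pos_def_matrices" and K: "compact K" and "\<epsilon> > 0"
  obtains \<delta> where "\<delta> > 0" "\<And>p q w. p \<in> K \<Longrightarrow> q \<in> K \<Longrightarrow> dist p q < \<delta> \<Longrightarrow>
    riem_norm (h q) w \<le> (1 + \<epsilon>) * riem_norm (h p) w"
proof -
  obtain c where c: "c > 0" "\<And>p w. p \<in> K \<Longrightarrow> c * norm w \<le> riem_norm (h p) w"
    using riem_norm_bounds[OF h pd K] by metis
  let ?S = "K \<times> sphere (0::real^'n) 1"
  let ?f = "\<lambda>p. riem_norm (h (fst p)) (snd p)"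
  have "uniformly_continuous_on ?S ?f"
    by (intro compact_uniformly_continuous compact_Times K continuous_intros continuous_on_compose2[OF h]) auto
  then obtain \<delta> where \<delta>: "\<delta> > 0" "\<And>x y. x \<in> ?S \<Longrightarrow> y \<in> ?S \<Longrightarrow> dist y x < \<delta> \<Longrightarrow> dist (?f y) (?f x) < c * \<epsilon>"
    unfolding uniformly_continuous_on_def using mult_pos_pos[OF c(1) \<open>\<epsilon> > 0\<close>] by blast
  show ?thesis
  proof (rule that[OF \<delta>(1)])
    fix p q w assume pq: "p \<in> K" "q \<in> K" "dist p q < \<delta>"
    show "riem_norm (h q) w \<le> (1 + \<epsilon>) * riem_norm (h p) w"
    proof (cases "w = 0")
      case False
      define u where "u = w /\<^sub>R norm w"
      have u: "norm u = 1" "w = norm w *\<^sub>R u" using False by (auto simp: u_def)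
      have "dist (?f (q, u)) (?f (p, u)) < c * \<epsilon>"
        using pq u by (intro \<delta>(2)) (auto simp: dist_Pair_Pair dist_commute)
      then have "riem_norm (h q) u \<le> riem_norm (h p) u + c * \<epsilon>" by (simp add: dist_real_def)
      also have "c * \<epsilon> \<le> riem_norm (h p) u * \<epsilon>" using c(2)[OF pq(1), of u] u \<open>\<epsilon> > 0\<close> by simp
      finally have "norm w * riem_norm (h q) u \<le> norm w * ((1 + \<epsilon>) * riem_norm (h p) u)"
        by (intro mult_left_mono) (auto simp: algebra_simps)
      moreover have "riem_norm B w = norm w * riem_norm B u" for B :: "real^'n^'n"
        using riem_norm_scaleR[of B "norm w" u] u by simp
      ultimately show ?thesis by (simp only: mult.left_commute)
    qed simp
  qed
qed

section \<open>Velocity and length of piecewise C1 curves\<close>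

lemma has_integral_speed:
  fixes \<gamma> :: "real \<Rightarrow> 'a::banach"
  assumes \<gamma>: "\<gamma> piecewise_C1_differentiable_on {a..b}" and "a \<le> s" "s \<le> t" "t \<le> b"
  shows "((\<lambda>r. vector_derivative \<gamma> (at r)) has_integral (\<gamma> t - \<gamma> s)) {s..t}"
proof -
  obtain S D where S: "finite S" "continuous_on {a..b} \<gamma>"
    "\<And>x. x \<in> {a..b} - S \<Longrightarrow> (\<gamma> has_vector_derivative D x) (at x)"
    using \<gamma> unfolding piecewise_C1_differentiable_on_def C1_differentiable_on_def by blast
  \<comment> \<open>The velocity may blow up at the break points and need not be absolutely
    integrable; the gauge integral still recovers the increment, by continuity at the finitely many
    exceptional points.\<close>
  show ?thesis
  proof (rule fundamental_theorem_of_calculus_interior_strong[where S = S and f = \<gamma>])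
    show "finite S" "s \<le> t" by fact+
    show "continuous_on {s..t} \<gamma>" using S(2) assms by (auto intro: continuous_on_subset)
    fix x assume "x \<in> {s<..<t} - S"
    then have "(\<gamma> has_vector_derivative D x) (at x)" using assms by (intro S(3)) auto
    then show "(\<gamma> has_vector_derivative vector_derivative \<gamma> (at x)) (at x)"
      by (simp add: vector_derivative_at)
  qed
qed

text \<open>Off a finite set the velocity is the continuous derivative \<open>D\<close>. Nothing is
  known about the curve outside \<open>{a..b}\<close>, hence the indicators.\<close>

lemma measurable_speed:
  fixes \<gamma> :: "real \<Rightarrow> real^'n"
  assumes \<gamma>: "\<gamma> piecewise_C1_differentiable_on {a..b}"
  shows "(\<lambda>r. indicator {a..b} r *\<^sub>R \<gamma> r) \<in> borel_measurable borel"
    and "(\<lambda>r. indicator {a..b} r *\<^sub>R vector_derivative \<gamma> (at r)) \<in> borel_measurable borel"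
proof -
  obtain S D where S: "finite S" "continuous_on {a..b} \<gamma>" "continuous_on ({a..b} - S) D"
    "\<And>x. x \<in> {a..b} - S \<Longrightarrow> (\<gamma> has_vector_derivative D x) (at x)"
    using \<gamma> unfolding piecewise_C1_differentiable_on_def C1_differentiable_on_def by blast
  show "(\<lambda>r. indicator {a..b} r *\<^sub>R \<gamma> r) \<in> borel_measurable borel"
    by (intro borel_measurable_continuous_on_indicator S) auto
  have "(\<lambda>r. indicator ({a..b} - S) r *\<^sub>R D r) \<in> borel_measurable borel"
    using finite_imp_closed[OF S(1)] by (intro borel_measurable_continuous_on_indicator S) auto
  then show "(\<lambda>r. indicator {a..b} r *\<^sub>R vector_derivative \<gamma> (at r)) \<in> borel_measurable borel"
  proof (rule measurable_discrete_difference[where X = S])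
    fix x assume "x \<in> space borel" "x \<notin> S"
    then show "indicator ({a..b} - S) x *\<^sub>R D x = indicator {a..b} x *\<^sub>R vector_derivative \<gamma> (at x)"
      using vector_derivative_at[OF S(4), of x] by (auto simp: indicator_def)
  qed (use S(1) in \<open>auto intro: countable_finite\<close>)
qed

lemma measurable_length_integrand:
  fixes \<gamma> :: "real \<Rightarrow> real^'n"
  assumes \<gamma>: "\<gamma> piecewise_C1_differentiable_on {a..b}" and h: "continuous_on UNIV h" and "a \<le> s" "t \<le> b"
  shows "(\<lambda>r. ennreal (riem_norm (h (\<gamma> r)) (vector_derivative \<gamma> (at r))) * indicator {s..t} r) \<in> borel_measurable borel"
proof -
  have [measurable]: "h \<in> borel_measurable borel" using h by (rule borel_measurable_continuous_onI)
  note [measurable] = measurable_speed[OF \<gamma>]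
  have "(\<lambda>r. ennreal (riem_norm (h (indicator {a..b} r *\<^sub>R \<gamma> r)) (indicator {a..b} r *\<^sub>R vector_derivative \<gamma> (at r))) * indicator {s..t} r) \<in> borel_measurable borel"
    by measurable
  also have "?this \<longleftrightarrow> ?thesis"
    using assms by (intro measurable_cong) (auto simp: indicator_def)
  finally show ?thesis .
qed

text \<open>For \<open>f\<close> only a gauge integral is available. If the right-hand side is
  infinite there is nothing to show; otherwise \<open>g\<close> is integrable, and both functions
  are compared through gauge integrals.\<close>

lemma nn_integral_ge_has_integral:
  fixes f :: "real \<Rightarrow> real"
  assumes f: "(f has_integral I) S" and le: "\<And>x. x \<in> S \<Longrightarrow> f x \<le> g x" "\<And>x. x \<in> S \<Longrightarrow> 0 \<le> g x"
    and [measurable]: "(\<lambda>x. ennreal (g x) * indicator S x) \<in> borel_measurable borel"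
  shows "ennreal I \<le> (\<integral>\<^sup>+x\<in>S. ennreal (g x) \<partial>lborel)"
proof (cases "(\<integral>\<^sup>+x\<in>S. ennreal (g x) \<partial>lborel) = \<infinity>")
  case False
  have eq: "(\<integral>\<^sup>+x. ennreal (g x * indicator S x) \<partial>lborel) = (\<integral>\<^sup>+x\<in>S. ennreal (g x) \<partial>lborel)"
    by (intro nn_integral_cong) (auto simp: indicator_def)
  have m: "(\<lambda>x. g x * indicator S x) \<in> borel_measurable borel"
  proof -
    have "(\<lambda>x. enn2real (ennreal (g x) * indicator S x)) \<in> borel_measurable borel" by measurable
    also have "(\<lambda>x. enn2real (ennreal (g x) * indicator S x)) = (\<lambda>x. g x * indicator S x)"
      using le(2) by (auto simp: fun_eq_iff indicator_def)
    finally show ?thesis .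
  qed
  have "integrable lborel (\<lambda>x. g x * indicator S x)"
  proof (rule integrableI_nonneg)
    show "AE x in lborel. 0 \<le> g x * indicator S x" using le(2) by (auto simp: indicator_def)
    show "(\<integral>\<^sup>+x. ennreal (g x * indicator S x) \<partial>lborel) < \<infinity>"
      unfolding eq using False by (simp add: top.not_eq_extremum)
  qed (use m in simp)
  then have hi: "((\<lambda>x. g x * indicator S x) has_integral (integral\<^sup>L lborel (\<lambda>x. g x * indicator S x))) UNIV"
    by (rule has_integral_integral_lborel)
  have "I \<le> integral\<^sup>L lborel (\<lambda>x. g x * indicator S x)"
  proof (rule has_integral_le[OF _ hi])
    show "((\<lambda>x. if x \<in> S then f x else 0) has_integral I) UNIV"
      using f by (simp add: has_integral_restrict_UNIV)
  qed (use le in \<open>auto simp: indicator_def\<close>)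
  then have "ennreal I \<le> ennreal (integral\<^sup>L lborel (\<lambda>x. g x * indicator S x))" by (rule ennreal_leI)
  also have "\<dots> = (\<integral>\<^sup>+x\<in>S. ennreal (g x) \<partial>lborel)"
    unfolding eq[symmetric] using \<open>integrable lborel _\<close> le(2)
    by (intro nn_integral_eq_integral[symmetric]) (auto simp: indicator_def)
  finally show ?thesis .
qed simp

text \<open>In a constant metric straight lines are shortest. The velocity is paired with
  \<open>u\<close>, the image of \<open>A *v w\<close> after division by the norm of
  \<open>w\<close>: the pairing integrates to the norm of the displacement \<open>w\<close>, and by
  Cauchy-Schwarz it never exceeds the speed.\<close>

lemma riem_norm_displacement_le:
  fixes \<gamma> :: "real \<Rightarrow> real^'n"
  assumes \<gamma>: "\<gamma> piecewise_C1_differentiable_on {a..b}" and A: "A \<in> pos_def_matrices" and st: "a \<le> s" "s \<le> t" "t \<le> b"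
  shows "ennreal (riem_norm A (\<gamma> t - \<gamma> s)) \<le> riem_length (\<lambda>_. A) s t \<gamma>"
proof (cases "\<gamma> t = \<gamma> s")
  case False
  define w where "w = \<gamma> t - \<gamma> s"
  have w: "0 < riem_norm A w" using False A by (intro riem_norm_pos) (auto simp: w_def)
  define u where "u = (A *v w) /\<^sub>R riem_norm A w"
  have uw: "w \<bullet> u = riem_norm A w"
    using w unfolding u_def inner_scaleR_right riem_norm_square[OF A, of w, symmetric] by (simp add: power2_eq_square)
  have u: "v \<bullet> u \<le> riem_norm A v" for v
    using w riem_norm_Cauchy_Schwarz[OF A, of v w] unfolding u_def inner_scaleR_right
    by (simp add: pos_divide_le_eq divide_inverse[symmetric] mult.commute[of "inverse _"])
  have "((\<lambda>r. vector_derivative \<gamma> (at r) \<bullet> u) has_integral (w \<bullet> u)) {s..t}"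
    unfolding w_def using has_integral_speed[OF \<gamma> st]
    by (rule has_integral_linear[OF _ bounded_linear_inner_left, unfolded o_def])
  then have "ennreal (w \<bullet> u) \<le> (\<integral>\<^sup>+r\<in>{s..t}. ennreal (riem_norm A (vector_derivative \<gamma> (at r))) \<partial>lborel)"
  proof (rule nn_integral_ge_has_integral)
    show "(\<lambda>r. ennreal (riem_norm A (vector_derivative \<gamma> (at r))) * indicator {s..t} r) \<in> borel_measurable borel"
      using measurable_length_integrand[OF \<gamma> continuous_on_const[of _ A], of s t] st by simp
  qed (use u A in auto)
  then show ?thesis unfolding riem_length_def uw by (simp only: w_def)
qed simp

lemma piecewise_C1_on_Icc_subset:
  "\<gamma> piecewise_C1_differentiable_on {a..b} \<Longrightarrow> a \<le> s \<Longrightarrow> t \<le> b \<Longrightarrow> \<gamma> piecewise_C1_differentiable_on {s..t}"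
  by (rule piecewise_C1_differentiable_on_subset) auto

lemma riem_length_split:
  fixes \<gamma> :: "real \<Rightarrow> real^'n"
  assumes \<gamma>: "\<gamma> piecewise_C1_differentiable_on {a..b}" and h: "continuous_on UNIV h" and s: "a \<le> s" "s \<le> b"
  shows "riem_length h a b \<gamma> = riem_length h a s \<gamma> + riem_length h s b \<gamma>"
proof -
  let ?F = "\<lambda>r. ennreal (riem_norm (h (\<gamma> r)) (vector_derivative \<gamma> (at r)))"
  have "riem_length h a b \<gamma> = (\<integral>\<^sup>+r. ?F r * indicator {a..s} r + ?F r * indicator {s..b} r \<partial>lborel)"
    unfolding riem_length_def
  proof (rule nn_integral_cong_AE)
    show "AE r in lborel. ?F r * indicator {a..b} r = ?F r * indicator {a..s} r + ?F r * indicator {s..b} r"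
      using AE_lborel_singleton[of s] by eventually_elim (use s in \<open>auto simp: indicator_def\<close>)
  qed
  also have "\<dots> = riem_length h a s \<gamma> + riem_length h s b \<gamma>"
    unfolding riem_length_def
    using measurable_length_integrand[OF \<gamma> h, of a s] measurable_length_integrand[OF \<gamma> h, of s b] s
    by (intro nn_integral_add) auto
  finally show ?thesis .
qed

text \<open>Velocity is local on the open interval, and the two end points form a null set.\<close>

lemma riem_length_cong:
  assumes "\<And>s. s \<in> {a<..<b} \<Longrightarrow> \<gamma> s = \<gamma>' s"
  shows "riem_length h a b \<gamma> = riem_length h a b \<gamma>'"
  unfolding riem_length_def
proof (rule nn_integral_cong_AE)
  show "AE s in lborel. ennreal (riem_norm (h (\<gamma> s)) (vector_derivative \<gamma> (at s))) * indicator {a..b} s =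
      ennreal (riem_norm (h (\<gamma>' s)) (vector_derivative \<gamma>' (at s))) * indicator {a..b} s"
    using AE_lborel_singleton[of a] AE_lborel_singleton[of b]
  proof eventually_elim
    case (elim s)
    show ?case
    proof (cases "s \<in> {a<..<b}")
      case True
      then have "eventually (\<lambda>r. r \<in> {a<..<b}) (nhds s)" by (intro eventually_nhds_in_open) auto
      then have "eventually (\<lambda>r. \<gamma> r = \<gamma>' r) (nhds s)" by eventually_elim (rule assms)
      then have "vector_derivative \<gamma> (at s) = vector_derivative \<gamma>' (at s)"
        by (intro vector_derivative_cong_eq) (auto elim: eventually_mono)
      then show ?thesis using assms[OF True] by simp
    qed (use elim in \<open>auto simp: indicator_def\<close>)
  qed
qed

lemma riem_length_scale_metric:
  fixes \<gamma> :: "real \<Rightarrow> real^'n"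
  assumes \<gamma>: "\<gamma> piecewise_C1_differentiable_on {a..b}" and k: "continuous_on UNIV k" and C: "C \<ge> 0"
    and le: "\<And>r w. r \<in> {a..b} \<Longrightarrow> riem_norm (h (\<gamma> r)) w \<le> C * riem_norm (k (\<gamma> r)) w"
  shows "riem_length h a b \<gamma> \<le> ennreal C * riem_length k a b \<gamma>"
proof -
  let ?F = "\<lambda>r. ennreal (riem_norm (k (\<gamma> r)) (vector_derivative \<gamma> (at r)))"
  have "riem_length h a b \<gamma> \<le> (\<integral>\<^sup>+r. ennreal C * (?F r * indicator {a..b} r) \<partial>lborel)"
    unfolding riem_length_def
    using C le by (intro nn_integral_mono) (auto simp: indicator_def ennreal_mult'[symmetric] intro!: ennreal_leI)
  also have "\<dots> = ennreal C * riem_length k a b \<gamma>"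
    unfolding riem_length_def using measurable_length_integrand[OF \<gamma> k, of a b] by (intro nn_integral_cmult) auto
  finally show ?thesis .
qed

text \<open>Reflection is an involution, so differentiability at corresponding points is equivalent.
  Where it fails, both velocities are the same arbitrary value, a choice from the empty
  predicate.\<close>

lemma riem_norm_velocity_reflect:
  "riem_norm A (vector_derivative (\<lambda>r. \<gamma> (c - r)) (at s)) = riem_norm A (vector_derivative \<gamma> (at (c - s)))"
proof -
  have *: "((\<lambda>r. \<beta> (c - r)) has_vector_derivative - D) (at s)" if "(\<beta> has_vector_derivative D) (at (c - s))"
    for \<beta> :: "real \<Rightarrow> real^'n" and D s
  proof -
    have "((\<lambda>r. c - r) has_vector_derivative - 1) (at s)"
      by (auto intro!: derivative_eq_intros)
    from vector_diff_chain_at[OF this that] show ?thesis by (simp add: o_def)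
  qed
  show ?thesis
  proof (cases "\<exists>D. (\<gamma> has_vector_derivative D) (at (c - s))")
    case True
    then obtain D where D: "(\<gamma> has_vector_derivative D) (at (c - s))" by blast
    from vector_derivative_at[OF D] vector_derivative_at[OF *[OF D]] show ?thesis by simp
  next
    case False
    have "\<not> ((\<lambda>r. \<gamma> (c - r)) has_vector_derivative D) (at s)" for D
      using *[of "\<lambda>r. \<gamma> (c - r)" D "c - s"] False by auto
    with False show ?thesis by (simp add: vector_derivative_def)
  qed
qed

lemma piecewise_C1_reflect:
  assumes "\<gamma> piecewise_C1_differentiable_on {a..b}"
  shows "(\<lambda>s. \<gamma> (c - s)) piecewise_C1_differentiable_on {c - b..c - a}"
proof -
  have "(\<lambda>x. -1 * x + c) ` {c - b..c - a} = {a..b}"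
    by (auto simp: image_iff intro!: bexI[of _ "c - _"])
  then have "(\<gamma> \<circ> (\<lambda>x. -1 *\<^sub>R x + c)) piecewise_C1_differentiable_on {c - b..c - a}"
    using assms by (intro piecewise_C1_differentiable_affine) auto
  then show ?thesis by (simp add: o_def)
qed

lemma riem_length_reflect:
  fixes \<gamma> :: "real \<Rightarrow> real^'n"
  assumes \<gamma>: "\<gamma> piecewise_C1_differentiable_on {a..b}" and h: "continuous_on UNIV h"
  shows "riem_length h (c - b) (c - a) (\<lambda>s. \<gamma> (c - s)) = riem_length h a b \<gamma>"
proof -
  let ?F = "\<lambda>r. ennreal (riem_norm (h (\<gamma> r)) (vector_derivative \<gamma> (at r))) * indicator {a..b} r"
  have "riem_length h a b \<gamma> = ennreal \<bar>-1\<bar> * (\<integral>\<^sup>+r. ?F (c + -1 * r) \<partial>lborel)"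
    unfolding riem_length_def using measurable_length_integrand[OF \<gamma> h, of a b]
    by (intro nn_integral_real_affine) auto
  also have "\<dots> = riem_length h (c - b) (c - a) (\<lambda>s. \<gamma> (c - s))"
    unfolding riem_length_def
    by (simp add: riem_norm_velocity_reflect) (intro nn_integral_cong, auto simp: indicator_def)
  finally show ?thesis by simp
qed

lemma riem_length_shift:
  "riem_length (shift v h) a b \<gamma> = riem_length h a b (\<lambda>s. \<gamma> s + v)"
  unfolding riem_length_def shift_def vector_derivative_def
  by (simp add: has_vector_derivative_add_const)

section \<open>The distance as an infimum over paths\<close>

definition riem_paths :: "real^'n \<Rightarrow> real^'n \<Rightarrow> (real \<times> real \<times> (real \<Rightarrow> real^'n)) set" where
  "riem_paths x y = {(a, b, \<gamma>). a \<le> b \<and> \<gamma> piecewise_C1_differentiable_on {a..b} \<and> \<gamma> a = x \<and> \<gamma> b = y}"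

text \<open>Estimates are made with this extended value, before \<open>enn2real\<close>, which would
  send an infinite infimum to 0.\<close>

definition riem_edist :: "(real^'n \<Rightarrow> real^'n^'n) \<Rightarrow> real^'n \<Rightarrow> real^'n \<Rightarrow> ennreal" where
  "riem_edist h x y = (INF (a, b, \<gamma>) \<in> riem_paths x y. riem_length h a b \<gamma>)"

lemma riem_dist_eq: "riem_dist h x y = enn2real (riem_edist h x y)"
proof -
  have "{riem_length h a b \<gamma> | a b \<gamma>. a \<le> b \<and> \<gamma> piecewise_C1_differentiable_on {a..b} \<and> \<gamma> a = x \<and> \<gamma> b = y}
      = (\<lambda>(a, b, \<gamma>). riem_length h a b \<gamma>) ` riem_paths x y"
    unfolding riem_paths_def by force
  then show ?thesis by (simp add: riem_dist_def riem_edist_def)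
qed

lemma riem_edist_le:
  assumes "a \<le> b" "\<gamma> piecewise_C1_differentiable_on {a..b}" "\<gamma> a = x" "\<gamma> b = y"
  shows "riem_edist h x y \<le> riem_length h a b \<gamma>"
  unfolding riem_edist_def using assms by (intro INF_lower2[of "(a, b, \<gamma>)"]) (auto simp: riem_paths_def)

lemma riem_edist_greatest:
  assumes "\<And>a b \<gamma>. a \<le> b \<Longrightarrow> \<gamma> piecewise_C1_differentiable_on {a..b} \<Longrightarrow> \<gamma> a = x \<Longrightarrow> \<gamma> b = y \<Longrightarrow> c \<le> riem_length h a b \<gamma>"
  shows "c \<le> riem_edist h x y"
  unfolding riem_edist_def using assms by (intro INF_greatest) (auto simp: riem_paths_def)

lemma riem_edist_lessE:
  assumes "riem_edist h x y < c"
  obtains a b \<gamma> where "a \<le> b" "\<gamma> piecewise_C1_differentiable_on {a..b}" "\<gamma> a = x" "\<gamma> b = y" "riem_length h a b \<gamma> < c"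
  using assms unfolding riem_edist_def INF_less_iff by (auto simp: riem_paths_def)

lemma riem_edist_shift:
  fixes h :: "real^'n \<Rightarrow> real^'n^'n"
  shows "riem_edist (shift v h) x y = riem_edist h (x + v) (y + v)"
proof -
  have *: "riem_edist h (x + v) (y + v) \<le> riem_edist (shift v h) x y" for h :: "real^'n \<Rightarrow> real^'n^'n" and x y v
  proof (rule riem_edist_greatest)
    fix a b and \<gamma> :: "real \<Rightarrow> real^'n" assume *: "a \<le> b" "\<gamma> piecewise_C1_differentiable_on {a..b}" "\<gamma> a = x" "\<gamma> b = y"
    have "(\<lambda>s. \<gamma> s + v) piecewise_C1_differentiable_on {a..b}"
      using *(2) by (rule piecewise_C1_differentiable_add) (simp add: C1_differentiable_imp_piecewise)
    then show "riem_edist h (x + v) (y + v) \<le> riem_length (shift v h) a b \<gamma>"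
      unfolding riem_length_shift using * by (intro riem_edist_le) auto
  qed
  have "shift (- v) (shift v h) = h" by (simp add: shift_def fun_eq_iff)
  with *[of h x v y] *[of "shift v h" "x + v" "- v" "y + v"] show ?thesis by simp
qed

lemma riem_edist_triangle:
  fixes h :: "real^'n \<Rightarrow> real^'n^'n"
  assumes h: "continuous_on UNIV h"
  shows "riem_edist h x z \<le> riem_edist h x y + riem_edist h y z"
proof (rule ennreal_le_epsilon)
  fix e :: real assume fin: "riem_edist h x y + riem_edist h y z < top" and "0 < e"
  define u where "u = riem_edist h x y + ennreal (e / 2)"
  define v where "v = riem_edist h y z + ennreal (e / 2)"
  have uv: "riem_edist h x y < u" "riem_edist h y z < v"
    using fin \<open>0 < e\<close> unfolding u_def v_def by (auto simp: ennreal_add_left_cancel_less less_top[symmetric])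
  obtain a b \<gamma> where p: "a \<le> b" "\<gamma> piecewise_C1_differentiable_on {a..b}" "\<gamma> a = x" "\<gamma> b = y" "riem_length h a b \<gamma> < u"
    using riem_edist_lessE[OF uv(1)] by blast
  obtain a' b' \<gamma>' where q: "a' \<le> b'" "\<gamma>' piecewise_C1_differentiable_on {a'..b'}" "\<gamma>' a' = y" "\<gamma>' b' = z" "riem_length h a' b' \<gamma>' < v"
    using riem_edist_lessE[OF uv(2)] by blast
  define c where "c = b + (b' - a')"
  define \<beta> where "\<beta> s = \<gamma>' (a' + (s - b))" for s
  text \<open>Two reflections compose to the reparametrisation by a translation.\<close>
  have \<beta>: "\<beta> piecewise_C1_differentiable_on {b..c}" "riem_length h b c \<beta> = riem_length h a' b' \<gamma>'"
  proof -
    let ?r = "\<lambda>s. \<gamma>' (b' - s)"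
    have r: "?r piecewise_C1_differentiable_on {0..b' - a'}" "riem_length h 0 (b' - a') ?r = riem_length h a' b' \<gamma>'"
      using piecewise_C1_reflect[OF q(2), of b'] riem_length_reflect[OF q(2) h, of b'] by auto
    have "\<beta> = (\<lambda>s. ?r (c - s))" by (simp add: \<beta>_def c_def fun_eq_iff algebra_simps)
    then show "\<beta> piecewise_C1_differentiable_on {b..c}" "riem_length h b c \<beta> = riem_length h a' b' \<gamma>'"
      using piecewise_C1_reflect[OF r(1), of c] riem_length_reflect[OF r(1) h, of c] r(2) by (auto simp: c_def)
  qed
  have bc: "b \<le> c" using q by (simp add: c_def)
  define \<alpha> where "\<alpha> s = (if s \<le> b then \<gamma> s else \<beta> s)" for s
  have eq: "\<gamma> b = \<beta> b" using p q by (simp add: \<beta>_def)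
  have \<alpha>: "\<alpha> piecewise_C1_differentiable_on {a..c}"
    unfolding \<alpha>_def using p(1) bc eq by (intro piecewise_C1_differentiable_cases p(2) \<beta>(1)) auto
  have "riem_edist h x z \<le> riem_length h a c \<alpha>"
    using p(1) bc p(3) q eq by (intro riem_edist_le \<alpha>) (auto simp: \<alpha>_def \<beta>_def c_def)
  also have "\<dots> = riem_length h a b \<alpha> + riem_length h b c \<alpha>"
    by (rule riem_length_split[OF \<alpha> h p(1) bc])
  also have "riem_length h a b \<alpha> = riem_length h a b \<gamma>"
    by (rule riem_length_cong) (auto simp: \<alpha>_def)
  also have "riem_length h b c \<alpha> = riem_length h a' b' \<gamma>'"
    unfolding \<beta>(2)[symmetric] by (rule riem_length_cong) (auto simp: \<alpha>_def)
  also have "riem_length h a b \<gamma> + riem_length h a' b' \<gamma>' < u + v"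
    using p q by (intro add_strict_mono) auto
  also have "u + v = riem_edist h x y + riem_edist h y z + ennreal e"
  proof -
    have "ennreal e = ennreal (e / 2) + ennreal (e / 2)" using \<open>0 < e\<close> by (simp flip: ennreal_plus)
    then show ?thesis by (simp add: u_def v_def ac_simps)
  qed
  finally show "riem_edist h x z \<le> riem_edist h x y + riem_edist h y z + ennreal e" by simp
qed

lemma riem_edist_commute:
  fixes h :: "real^'n \<Rightarrow> real^'n^'n"
  assumes h: "continuous_on UNIV h"
  shows "riem_edist h x y = riem_edist h y x"
proof -
  have "riem_edist h x y \<le> riem_edist h y x" for x y
  proof (rule riem_edist_greatest)
    fix a b and \<gamma> :: "real \<Rightarrow> real^'n" assume *: "a \<le> b" "\<gamma> piecewise_C1_differentiable_on {a..b}" "\<gamma> a = y" "\<gamma> b = x"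
    have "riem_edist h x y \<le> riem_length h (0 - b) (0 - a) (\<lambda>s. \<gamma> (0 - s))"
      using * by (intro riem_edist_le piecewise_C1_reflect) auto
    then show "riem_edist h x y \<le> riem_length h a b \<gamma>"
      by (simp only: riem_length_reflect[OF *(2) h])
  qed
  then show ?thesis by (intro antisym)
qed

lemma riem_edist_refl [simp]: "riem_edist h x x = 0"
proof -
  have "riem_edist h x x \<le> riem_length h 0 0 (\<lambda>_. x)"
    by (intro riem_edist_le C1_differentiable_imp_piecewise) auto
  also have "\<dots> = 0" by (simp add: riem_length_def)
  finally show ?thesis by simp
qed

lemma riem_edist_segment_le:
  fixes h :: "real^'n \<Rightarrow> real^'n^'n"
  assumes "\<And>t. t \<in> {0..1} \<Longrightarrow> ennreal (riem_norm (h (p + t *\<^sub>R (q - p))) (q - p)) \<le> B"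
  shows "riem_edist h p q \<le> B"
proof -
  let ?\<gamma> = "\<lambda>t. p + t *\<^sub>R (q - p)"
  have vd: "vector_derivative ?\<gamma> (at t) = q - p" for t
    by (intro vector_derivative_at) (auto intro!: derivative_eq_intros)
  have "riem_edist h p q \<le> riem_length h 0 1 ?\<gamma>"
    by (intro riem_edist_le C1_differentiable_imp_piecewise C1_differentiable_on_add C1_differentiable_on_scaleR) auto
  also have "\<dots> \<le> (\<integral>\<^sup>+t\<in>{0..1::real}. B \<partial>lborel)"
    unfolding riem_length_def vd using assms by (intro nn_integral_mono) (auto simp: indicator_def)
  also have "\<dots> = B" by (simp add: nn_integral_cmult_indicator)
  finally show ?thesis .
qed

section \<open>Approximation by polygons\<close>

text \<open>The largest speed along the chord dominates its length, with little loss for short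
  chords in a continuous metric. A countable supremum, unlike an integral over \<open>t\<close>, is
  visibly measurable in \<open>h\<close>.\<close>

definition chord_cost :: "(real^'n \<Rightarrow> real^'n^'n) \<Rightarrow> real^'n \<Rightarrow> real^'n \<Rightarrow> ennreal" where
  "chord_cost h p q = (SUP t\<in>\<rat> \<inter> {0..1}. ennreal (riem_norm (h (p + t *\<^sub>R (q - p))) (q - p)))"

fun polygon_cost :: "(real^'n \<Rightarrow> real^'n^'n) \<Rightarrow> real^'n \<Rightarrow> (real^'n) list \<Rightarrow> real^'n \<Rightarrow> ennreal" where
  "polygon_cost h x [] y = chord_cost h x y"
| "polygon_cost h x (d # ds) y = chord_cost h x d + polygon_cost h d ds y"

text \<open>The infimum over all paths is not visibly measurable in \<open>h\<close>. With countable \<open>D\<close> and chords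
  evaluated at rational parameters, the following infimum depends on \<open>h\<close> through countably many values; for
  continuous \<open>h\<close> and dense \<open>D\<close> it is the Riemannian distance.\<close>

definition polygon_dist :: "(real^'n) set \<Rightarrow> (real^'n \<Rightarrow> real^'n^'n) \<Rightarrow> real^'n \<Rightarrow> real^'n \<Rightarrow> ennreal" where
  "polygon_dist D h x y = (INF ds\<in>lists D. polygon_cost h x ds y)"

lemma measurable_field_eval [measurable]: "(\<lambda>h. h x) \<in> borel_measurable field_space"
  unfolding field_space_def by (rule measurable_component_singleton) simp

lemma measurable_chord_cost [measurable]: "(\<lambda>h. chord_cost h p q) \<in> borel_measurable field_space"
  unfolding chord_cost_def
  by (intro borel_measurable_SUP countable_Int1 countable_rat) measurable

lemma measurable_polygon_cost [measurable]: "(\<lambda>h. polygon_cost h x ds y) \<in> borel_measurable field_space"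
  by (induction ds arbitrary: x) auto

lemma measurable_polygon_dist [measurable]:
  assumes "countable D"
  shows "(\<lambda>h. polygon_dist D h x y) \<in> borel_measurable field_space"
  unfolding polygon_dist_def using assms by (intro borel_measurable_INF countable_lists) measurable

lemma polygon_cost_snoc:
  "polygon_cost h x (ds @ [d]) y = polygon_cost h x ds d + chord_cost h d y"
  by (induction ds arbitrary: x) (auto simp: ac_simps)

lemma chord_cost_le:
  assumes "\<And>t. t \<in> {0..1} \<Longrightarrow> riem_norm (h (p + t *\<^sub>R (q - p))) (q - p) \<le> B"
  shows "chord_cost h p q \<le> ennreal B"
  unfolding chord_cost_def using assms by (intro SUP_least ennreal_leI) auto

lemma chord_cost_self [simp]: "chord_cost h p p = 0"
  using chord_cost_le[of h p p 0] by simp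

lemma polygon_dist_self [simp]: "polygon_dist D h p p = 0"
proof -
  have "polygon_dist D h p p \<le> polygon_cost h p [] p" unfolding polygon_dist_def by (intro INF_lower) auto
  then show ?thesis by simp
qed

lemma riem_norm_le_chord_cost:
  fixes h :: "real^'n \<Rightarrow> real^'n^'n"
  assumes h: "continuous_on UNIV h" and t: "t \<in> {0..1}"
  shows "ennreal (riem_norm (h (p + t *\<^sub>R (q - p))) (q - p)) \<le> chord_cost h p q"
proof -
  \<comment> \<open>Rounding down keeps the rational approximants of \<open>t\<close> inside
    \<open>{0..1}\<close>.\<close>
  define r where "r n = real_of_int \<lfloor>t * real (Suc n)\<rfloor> / real (Suc n)" for n
  have r: "r n \<in> \<rat> \<inter> {0..1}" for n
  proof -
    have "real_of_int \<lfloor>t * real (Suc n)\<rfloor> \<le> t * real (Suc n)" by simp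
    also have "\<dots> \<le> real (Suc n)" using t by (simp add: mult_le_cancel_right1)
    finally show ?thesis using t by (simp add: r_def)
  qed
  have r_lim: "r \<longlonglongrightarrow> t"
  proof (rule LIMSEQ_I)
    fix e :: real assume "0 < e"
    then obtain N where N: "inverse (real (Suc N)) < e" using reals_Archimedean by blast
    have "norm (r n - t) < e" if "n \<ge> N" for n
    proof -
      have "r n - t = (real_of_int \<lfloor>t * real (Suc n)\<rfloor> - t * real (Suc n)) / real (Suc n)"
        by (simp add: r_def field_simps)
      moreover have "\<bar>real_of_int \<lfloor>t * real (Suc n)\<rfloor> - t * real (Suc n)\<bar> \<le> 1" by linarith
      ultimately have "norm (r n - t) \<le> inverse (real (Suc n))"
        by (simp add: divide_inverse abs_mult)
      also have "\<dots> \<le> inverse (real (Suc N))" using that by (intro le_imp_inverse_le) auto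
      finally show ?thesis using N by simp
    qed
    then show "\<exists>N. \<forall>n\<ge>N. norm (r n - t) < e" by blast
  qed
  have "continuous_on UNIV (\<lambda>t. riem_norm (h (p + t *\<^sub>R (q - p))) (q - p))"
    by (intro continuous_intros continuous_on_compose2[OF h]) auto
  then have "isCont (\<lambda>t. riem_norm (h (p + t *\<^sub>R (q - p))) (q - p)) t"
    by (simp add: continuous_on_eq_continuous_at)
  from isCont_tendsto_compose[OF this r_lim]
  have "(\<lambda>n. ennreal (riem_norm (h (p + r n *\<^sub>R (q - p))) (q - p)))
      \<longlonglongrightarrow> ennreal (riem_norm (h (p + t *\<^sub>R (q - p))) (q - p))"
    by (rule tendsto_ennrealI)
  moreover have "ennreal (riem_norm (h (p + r n *\<^sub>R (q - p))) (q - p)) \<le> chord_cost h p q" for n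
    unfolding chord_cost_def using r[of n] by (intro SUP_upper)
  ultimately show ?thesis by (intro LIMSEQ_le_const2) auto
qed

lemma riem_edist_le_polygon_cost:
  assumes h: "continuous_on UNIV h"
  shows "riem_edist h x y \<le> polygon_cost h x ds y"
proof (induction ds arbitrary: x)
  case Nil
  show ?case using riem_norm_le_chord_cost[OF h] by (auto intro: riem_edist_segment_le)
next
  case (Cons d ds)
  have "riem_edist h x d \<le> chord_cost h x d"
    using riem_norm_le_chord_cost[OF h] by (auto intro: riem_edist_segment_le)
  then have "riem_edist h x d + riem_edist h d y \<le> chord_cost h x d + polygon_cost h d ds y"
    using Cons by (rule add_mono)
  then show ?case using riem_edist_triangle[OF h, of x y d] by simp
qed

text \<open>For finite \<open>v = ennreal r\<close> the total error
  \<open>\<epsilon> * (r + 1)\<close> can be made smaller than any \<open>e\<close>; for infinite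
  \<open>v\<close> the claim is trivial.\<close>

lemma ennreal_le_of_perturbed:
  fixes u v :: ennreal
  assumes "\<And>\<epsilon>::real. 0 < \<epsilon> \<Longrightarrow> \<epsilon> \<le> 1 \<Longrightarrow> u \<le> ennreal (1 + \<epsilon>) * v + ennreal \<epsilon>"
  shows "u \<le> v"
proof (rule ennreal_le_epsilon)
  fix e :: real assume "v < top" "0 < e"
  then obtain r where r: "v = ennreal r" "0 \<le> r" by (cases v) auto
  define \<epsilon> where "\<epsilon> = min 1 (e / (r + 1))"
  have "\<epsilon> \<le> e / (r + 1)" by (simp add: \<epsilon>_def)
  then have "\<epsilon> * (r + 1) \<le> e" using r by (simp add: pos_le_divide_eq)
  moreover have "0 < \<epsilon>" "\<epsilon> \<le> 1" using \<open>0 < e\<close> r by (auto simp: \<epsilon>_def)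
  ultimately have \<epsilon>: "0 < \<epsilon>" "\<epsilon> \<le> 1" "\<epsilon> * (r + 1) \<le> e" by auto
  have "u \<le> ennreal ((1 + \<epsilon>) * r + \<epsilon>)"
    using assms[OF \<epsilon>(1,2)] r \<epsilon>(1) by (simp add: ennreal_mult)
  also have "\<dots> \<le> ennreal (r + e)" using \<epsilon> by (intro ennreal_leI) (simp add: algebra_simps)
  finally show "u \<le> v + ennreal e" using r \<open>0 < e\<close> by simp
qed

lemma polygon_dist_le_riem_length:
  fixes h :: "real^'n \<Rightarrow> real^'n^'n"
  assumes h: "continuous_on UNIV h" and pd: "\<And>x. h x \<in> pos_def_matrices"
    and D: "\<And>x e. 0 < e \<Longrightarrow> \<exists>d\<in>D. dist d x < e"
    and ab: "a \<le> b" and \<gamma>: "\<gamma> piecewise_C1_differentiable_on {a..b}"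
  shows "polygon_dist D h (\<gamma> a) (\<gamma> b) \<le> riem_length h a b \<gamma>"
proof (rule ennreal_le_of_perturbed)
  fix \<epsilon>0 :: real assume \<epsilon>0: "0 < \<epsilon>0" "\<epsilon>0 \<le> 1"
  \<comment> \<open>Two factors \<open>1 + \<epsilon>\<close> must fit into
    \<open>1 + \<epsilon>0\<close>, where \<open>\<epsilon>0 \<le> 1\<close>.\<close>
  define \<epsilon> where "\<epsilon> = \<epsilon>0 / 3"
  have \<epsilon>: "0 < \<epsilon>" and \<epsilon>_sq: "(1 + \<epsilon>) * (1 + \<epsilon>) \<le> 1 + \<epsilon>0"
    using \<epsilon>0 mult_mono[of \<epsilon>0 1 \<epsilon>0 \<epsilon>0] by (auto simp: \<epsilon>_def field_simps)
  have cont: "continuous_on {a..b} \<gamma>" using \<gamma> by (simp add: piecewise_C1_differentiable_on_def)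
  have "bounded (\<gamma> ` {a..b})" by (intro compact_imp_bounded compact_continuous_image cont) auto
  then obtain R where R: "\<And>r. r \<in> {a..b} \<Longrightarrow> norm (\<gamma> r) \<le> R" unfolding bounded_iff by blast
  define K where "K = cball (0::real^'n) (R + 1)"
  have K: "compact K" "convex K" by (auto simp: K_def)
  have inK: "z \<in> K" if "r \<in> {a..b}" "dist z (\<gamma> r) \<le> 1" for z r
    using R[OF that(1)] that(2) norm_triangle_ineq2[of z "\<gamma> r"] by (auto simp: K_def dist_norm)
  obtain C where C: "C > 0" "\<And>p w. p \<in> K \<Longrightarrow> riem_norm (h p) w \<le> C * norm w"
    using riem_norm_bounds[OF h pd K(1)] by metis
  obtain \<delta>0 where \<delta>0: "\<delta>0 > 0" "\<And>p q w. p \<in> K \<Longrightarrow> q \<in> K \<Longrightarrow> dist p q < \<delta>0 \<Longrightarrow>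
    riem_norm (h q) w \<le> (1 + \<epsilon>) * riem_norm (h p) w"
    using riem_norm_uniformly_comparable[OF h pd K(1) \<epsilon>] by blast
  \<comment> \<open>Consecutive vertices are less than \<open>3 * \<delta>\<close> apart:
    \<open>\<delta>\<close> for the piece of curve and \<open>\<delta>\<close> for the displacement
    of each vertex.\<close>
  define \<delta> where "\<delta> = min \<delta>0 1 / 3"
  have \<delta>: "0 < \<delta>" "3 * \<delta> \<le> \<delta>0" "3 * \<delta> \<le> 1" using \<delta>0 by (auto simp: \<delta>_def)
  define E where "E = ennreal (1 + \<epsilon>)"
  have segment: "p + t *\<^sub>R (q - p) \<in> K \<and> dist p (p + t *\<^sub>R (q - p)) \<le> dist p q" if "p \<in> K" "q \<in> K" "t \<in> {0..1}" for p q t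
  proof
    have "p + t *\<^sub>R (q - p) = (1 - t) *\<^sub>R p + t *\<^sub>R q" by (simp add: algebra_simps)
    then show "p + t *\<^sub>R (q - p) \<in> K" using convexD_alt[OF K(2) that(1,2)] that(3) by simp
    show "dist p (p + t *\<^sub>R (q - p)) \<le> dist p q"
      using that(3) by (simp add: dist_norm norm_minus_commute mult_left_le_one_le)
  qed
  have short_cost: "chord_cost h p q \<le> ennreal (C * dist p q)" if "p \<in> K" "q \<in> K" for p q
  proof (rule chord_cost_le)
    fix t :: real assume "t \<in> {0..1}"
    then show "riem_norm (h (p + t *\<^sub>R (q - p))) (q - p) \<le> C * dist p q"
      using C(2)[of "p + t *\<^sub>R (q - p)" "q - p"] segment[OF that] by (simp add: dist_norm norm_minus_commute)
  qed
  \<comment> \<open>The additive error \<open>\<eta>\<close> is arbitrary at every time, so each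
    step can ask its predecessor for a smaller one and the errors do not accumulate.\<close>
  define P where "P t \<longleftrightarrow> (\<forall>\<eta>>0. \<exists>d\<in>D. \<exists>ds\<in>lists D. dist d (\<gamma> t) < \<eta> \<and>
      polygon_cost h (\<gamma> a) ds d \<le> E * (E * riem_length h a t \<gamma>) + ennreal \<eta>)" for t
  have P_start: "P a"
    unfolding P_def
  proof (intro allI impI)
    fix \<eta> :: real assume "0 < \<eta>"
    define \<eta>1 where "\<eta>1 = min 1 (min \<eta> (\<eta> / C))"
    have \<eta>1: "0 < \<eta>1" "\<eta>1 \<le> 1" "\<eta>1 \<le> \<eta>" "C * \<eta>1 \<le> \<eta>"
      using \<open>0 < \<eta>\<close> C by (auto simp: \<eta>1_def min_def field_simps)
    obtain d where d: "d \<in> D" "dist d (\<gamma> a) < \<eta>1" using D \<eta>1 by blast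
    have "polygon_cost h (\<gamma> a) [] d \<le> ennreal (C * dist (\<gamma> a) d)"
      using d \<eta>1 ab inK[of a d] inK[of a "\<gamma> a"] by (auto intro!: short_cost)
    also have "\<dots> \<le> ennreal \<eta>"
      using d(2) C(1) by (intro ennreal_leI order_trans[OF mult_left_mono \<eta>1(4)]) (auto simp: dist_commute)
    finally have "polygon_cost h (\<gamma> a) [] d \<le> E * (E * riem_length h a a \<gamma>) + ennreal \<eta>"
      by (meson add_increasing zero_le)
    then show "\<exists>d\<in>D. \<exists>ds\<in>lists D. dist d (\<gamma> a) < \<eta> \<and>
      polygon_cost h (\<gamma> a) ds d \<le> E * (E * riem_length h a a \<gamma>) + ennreal \<eta>"
      using d \<eta>1 by (intro bexI[of _ d] bexI[of _ "[]"]) auto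
  qed
  have P_step: "P t" if "P s" and st: "a \<le> s" "s \<le> t" "t \<le> b" and near: "\<And>r. r \<in> {s..t} \<Longrightarrow> dist (\<gamma> r) (\<gamma> s) < \<delta>" for s t
    unfolding P_def
  proof (intro allI impI)
    fix \<eta> :: real assume "0 < \<eta>"
    \<comment> \<open>Of the budget \<open>\<eta>\<close>, the previous polygon takes
      \<open>\<eta>1\<close>, and the displacement of the two ends of the new chord takes
      \<open>2 * C * \<eta>1\<close>, enlarged by the factor \<open>1 + \<epsilon>\<close>.\<close>
    define \<eta>1 where "\<eta>1 = min \<delta> (min \<eta> (\<eta> / (1 + 2 * C * (1 + \<epsilon>))))"
    have pos: "0 < 1 + 2 * C * (1 + \<epsilon>)" using C \<epsilon> by (intro add_pos_pos mult_pos_pos) auto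
    have \<eta>1: "0 < \<eta>1" "\<eta>1 \<le> \<delta>" "\<eta>1 \<le> \<eta>"
      using \<open>0 < \<eta>\<close> \<delta> pos by (auto simp: \<eta>1_def)
    have "\<eta>1 \<le> \<eta> / (1 + 2 * C * (1 + \<epsilon>))" by (simp add: \<eta>1_def)
    then have \<eta>1_le: "\<eta>1 + (1 + \<epsilon>) * (2 * C * \<eta>1) \<le> \<eta>" using pos by (simp add: field_simps)
    obtain d ds where d: "d \<in> D" "ds \<in> lists D" "dist d (\<gamma> s) < \<eta>1"
      "polygon_cost h (\<gamma> a) ds d \<le> E * (E * riem_length h a s \<gamma>) + ennreal \<eta>1"
      using \<open>P s\<close> \<eta>1 unfolding P_def by blast
    obtain d' where d': "d' \<in> D" "dist d' (\<gamma> t) < \<eta>1" using D \<eta>1 by blast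
    have dK: "d \<in> K" "d' \<in> K"
      using d d' \<eta>1 \<delta> st by (auto intro!: inK[of s d] inK[of t d'])
    have "dist d d' \<le> dist d (\<gamma> s) + dist (\<gamma> t) (\<gamma> s) + dist d' (\<gamma> t)"
      using dist_triangle[of d d' "\<gamma> s"] dist_triangle[of "\<gamma> s" d' "\<gamma> t"] by (simp add: dist_commute)
    then have dd': "dist d d' < \<delta>0" using d d' near[of t] \<eta>1 \<delta> st by auto
    let ?A = "h d"
    have "chord_cost h d d' \<le> ennreal ((1 + \<epsilon>) * riem_norm ?A (d' - d))"
    proof (rule chord_cost_le)
      fix r :: real assume "r \<in> {0..1}"
      then show "riem_norm (h (d + r *\<^sub>R (d' - d))) (d' - d) \<le> (1 + \<epsilon>) * riem_norm ?A (d' - d)"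
        using segment[OF dK] dd' dK by (intro \<delta>0(2)) force+
    qed
    also have "riem_norm ?A (d' - d) \<le> riem_norm ?A (\<gamma> t - \<gamma> s) + 2 * C * \<eta>1"
    proof -
      have "d' - d = (\<gamma> t - \<gamma> s) + ((d' - \<gamma> t) + (\<gamma> s - d))" by simp
      then have "riem_norm ?A (d' - d) \<le> riem_norm ?A (\<gamma> t - \<gamma> s) + (riem_norm ?A (d' - \<gamma> t) + riem_norm ?A (\<gamma> s - d))"
        using riem_norm_triangle[OF pd, of d "\<gamma> t - \<gamma> s" "(d' - \<gamma> t) + (\<gamma> s - d)"] riem_norm_triangle[OF pd, of d "d' - \<gamma> t" "\<gamma> s - d"]
        by simp
      moreover have "riem_norm ?A (d' - \<gamma> t) \<le> C * \<eta>1"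
        using d'(2) C(1) by (intro order_trans[OF C(2)[OF dK(1)] mult_left_mono]) (auto simp: dist_norm)
      moreover have "riem_norm ?A (\<gamma> s - d) \<le> C * \<eta>1"
        using d(3) C(1) by (intro order_trans[OF C(2)[OF dK(1)] mult_left_mono]) (auto simp: dist_norm norm_minus_commute)
      ultimately show ?thesis by simp
    qed
    finally have chord: "chord_cost h d d' \<le> ennreal ((1 + \<epsilon>) * (riem_norm ?A (\<gamma> t - \<gamma> s) + 2 * C * \<eta>1))"
      using \<epsilon> by (simp add: ennreal_leI mult_left_mono)
    have "ennreal (riem_norm ?A (\<gamma> t - \<gamma> s)) \<le> riem_length (\<lambda>_. ?A) s t \<gamma>"
      by (rule riem_norm_displacement_le[OF \<gamma> pd st])
    also have "\<dots> \<le> E * riem_length h s t \<gamma>"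
      unfolding E_def
    proof (rule riem_length_scale_metric[OF piecewise_C1_on_Icc_subset[OF \<gamma> st(1,3)] h])
      fix r w assume r: "r \<in> {s..t}"
      have "dist (\<gamma> r) d < \<delta>0"
        using dist_triangle[of "\<gamma> r" d "\<gamma> s"] near[OF r] d(3) \<eta>1 \<delta> by (simp add: dist_commute)
      then show "riem_norm ?A w \<le> (1 + \<epsilon>) * riem_norm (h (\<gamma> r)) w"
        using r st dK inK[of r "\<gamma> r"] by (intro \<delta>0(2)) auto
    qed (use \<epsilon> in simp)
    finally have len: "ennreal (riem_norm ?A (\<gamma> t - \<gamma> s)) \<le> E * riem_length h s t \<gamma>" .
    have "ennreal ((1 + \<epsilon>) * (riem_norm ?A (\<gamma> t - \<gamma> s) + 2 * C * \<eta>1))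
        = E * ennreal (riem_norm ?A (\<gamma> t - \<gamma> s)) + ennreal ((1 + \<epsilon>) * (2 * C * \<eta>1))"
      using \<epsilon> C \<eta>1 pd by (simp add: E_def distrib_left ennreal_mult)
    also have "\<dots> \<le> E * (E * riem_length h s t \<gamma>) + ennreal ((1 + \<epsilon>) * (2 * C * \<eta>1))"
      by (intro add_right_mono mult_left_mono len) auto
    finally have chord': "chord_cost h d d' \<le> E * (E * riem_length h s t \<gamma>) + ennreal ((1 + \<epsilon>) * (2 * C * \<eta>1))"
      using chord by (rule order_trans[rotated])
    have "polygon_cost h (\<gamma> a) (ds @ [d]) d' \<le>
        (E * (E * riem_length h a s \<gamma>) + ennreal \<eta>1) + (E * (E * riem_length h s t \<gamma>) + ennreal ((1 + \<epsilon>) * (2 * C * \<eta>1)))"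
      unfolding polygon_cost_snoc by (intro add_mono d(4) chord')
    also have "\<dots> = E * (E * (riem_length h a s \<gamma> + riem_length h s t \<gamma>)) + ennreal (\<eta>1 + (1 + \<epsilon>) * (2 * C * \<eta>1))"
      using \<epsilon> C \<eta>1 by (simp add: distrib_left ac_simps)
    also have "riem_length h a s \<gamma> + riem_length h s t \<gamma> = riem_length h a t \<gamma>"
      using st by (intro riem_length_split[OF piecewise_C1_on_Icc_subset[OF \<gamma>] h, symmetric]) auto
    also have "E * (E * riem_length h a t \<gamma>) + ennreal (\<eta>1 + (1 + \<epsilon>) * (2 * C * \<eta>1)) \<le> E * (E * riem_length h a t \<gamma>) + ennreal \<eta>"
      by (intro add_left_mono ennreal_leI \<eta>1_le)
    finally show "\<exists>d\<in>D. \<exists>ds\<in>lists D. dist d (\<gamma> t) < \<eta> \<and>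
      polygon_cost h (\<gamma> a) ds d \<le> E * (E * riem_length h a t \<gamma>) + ennreal \<eta>"
      using d d' \<eta>1 by (intro bexI[of _ d'] bexI[of _ "ds @ [d]"]) auto
  qed
  have "uniformly_continuous_on {a..b} \<gamma>" by (intro compact_uniformly_continuous cont) auto
  then obtain \<rho> where \<rho>: "\<rho> > 0" "\<And>r s. r \<in> {a..b} \<Longrightarrow> s \<in> {a..b} \<Longrightarrow> dist r s < \<rho> \<Longrightarrow> dist (\<gamma> r) (\<gamma> s) < \<delta>"
    unfolding uniformly_continuous_on_def using \<delta>(1) by (metis dist_commute)
  obtain N where N: "(b - a) / \<rho> < real N" using reals_Archimedean2 by blast
  then have N0: "0 < real N" using ab \<rho> by (smt (verit) divide_nonneg_pos)
  define t where "t i = a + real i * ((b - a) / real N)" for i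
  have step: "(b - a) / real N < \<rho>" using N N0 \<rho> by (simp add: field_simps)
  have "0 \<le> (b - a) / real N" using ab by simp
  then have t_mono: "t i \<le> t (Suc i)" and t_ge: "a \<le> t i" for i
    unfolding t_def by (auto intro!: mult_right_mono mult_nonneg_nonneg simp del: times_divide_eq_right)
  have t_N: "t N = b" using N0 by (simp add: t_def)
  have t_le: "t i \<le> b" if "i \<le> N" for i
  proof -
    have "real i * ((b - a) / real N) \<le> real N * ((b - a) / real N)" using that ab by (intro mult_right_mono) auto
    then show ?thesis using N0 by (simp add: t_def)
  qed
  have "i \<le> N \<Longrightarrow> P (t i)" for i
  proof (induction i)
    case 0
    then show ?case using P_start by (simp add: t_def)
  next
    case (Suc i)
    show ?case
    proof (rule P_step[of "t i"])
      fix r assume r: "r \<in> {t i..t (Suc i)}"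
      have "t (Suc i) - t i = (b - a) / real N"
        by (simp add: t_def distrib_right del: times_divide_eq_right)
      then have "dist r (t i) < \<rho>" using r step by (auto simp: dist_real_def)
      then show "dist (\<gamma> r) (\<gamma> (t i)) < \<delta>" using r t_ge[of i] t_le[of "Suc i"] t_le[of i] Suc.prems by (intro \<rho>(2)) auto
    qed (use Suc t_mono t_ge t_le in auto)
  qed
  then have "P b" using t_N by (metis order_refl)
  \<comment> \<open>The last vertex lies in \<open>D\<close>; a final chord of cost at most
    \<open>C * \<eta>\<close> leads from it to the true end point.\<close>
  define \<eta> where "\<eta> = min 1 (\<epsilon>0 / (1 + C))"
  have "\<eta> \<le> \<epsilon>0 / (1 + C)" by (simp add: \<eta>_def)
  then have "\<eta> * (1 + C) \<le> \<epsilon>0" using C(1) by (simp add: pos_le_divide_eq)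
  moreover have "0 < \<eta>" "\<eta> \<le> 1" using \<epsilon>0 C(1) by (auto simp: \<eta>_def)
  ultimately have \<eta>: "0 < \<eta>" "\<eta> \<le> 1" "\<eta> + C * \<eta> \<le> \<epsilon>0" by (auto simp: distrib_left mult.commute)
  obtain d ds where d: "d \<in> D" "ds \<in> lists D" "dist d (\<gamma> b) < \<eta>"
      "polygon_cost h (\<gamma> a) ds d \<le> E * (E * riem_length h a b \<gamma>) + ennreal \<eta>"
    using \<open>P b\<close> \<eta> unfolding P_def by blast
  have "chord_cost h d (\<gamma> b) \<le> ennreal (C * dist d (\<gamma> b))"
    using d \<eta> ab inK[of b d] inK[of b "\<gamma> b"] by (auto intro!: short_cost)
  also have "\<dots> \<le> ennreal (C * \<eta>)" using d C by (intro ennreal_leI mult_left_mono) auto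
  finally have last: "chord_cost h d (\<gamma> b) \<le> ennreal (C * \<eta>)" .
  have "polygon_dist D h (\<gamma> a) (\<gamma> b) \<le> polygon_cost h (\<gamma> a) (ds @ [d]) (\<gamma> b)"
    unfolding polygon_dist_def using d by (intro INF_lower) auto
  also have "\<dots> \<le> (E * (E * riem_length h a b \<gamma>) + ennreal \<eta>) + ennreal (C * \<eta>)"
    unfolding polygon_cost_snoc by (intro add_mono d(4) last)
  also have "\<dots> = (E * E) * riem_length h a b \<gamma> + ennreal (\<eta> + C * \<eta>)"
    using \<eta> C by (simp add: ac_simps)
  also have "\<dots> \<le> ennreal (1 + \<epsilon>0) * riem_length h a b \<gamma> + ennreal \<epsilon>0"
  proof (intro add_mono mult_right_mono ennreal_leI \<eta>(3))
    have "E * E = ennreal ((1 + \<epsilon>) * (1 + \<epsilon>))" unfolding E_def using \<epsilon> by (intro ennreal_mult[symmetric]) auto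
    then show "E * E \<le> ennreal (1 + \<epsilon>0)" using \<epsilon>_sq by (simp only: ennreal_leI)
  qed simp
  finally show "polygon_dist D h (\<gamma> a) (\<gamma> b) \<le> ennreal (1 + \<epsilon>0) * riem_length h a b \<gamma> + ennreal \<epsilon>0" .
qed

lemma polygon_dist_eq_riem_edist:
  fixes h :: "real^'n \<Rightarrow> real^'n^'n"
  assumes h: "continuous_on UNIV h" and pd: "\<And>x. h x \<in> pos_def_matrices"
    and D: "\<And>x e. 0 < e \<Longrightarrow> \<exists>d\<in>D. dist d x < e"
  shows "polygon_dist D h x y = riem_edist h x y"
proof (rule antisym)
  show "polygon_dist D h x y \<le> riem_edist h x y"
    using polygon_dist_le_riem_length[OF h pd D] by (intro riem_edist_greatest) auto
  show "riem_edist h x y \<le> polygon_dist D h x y"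
    unfolding polygon_dist_def using riem_edist_le_polygon_cost[OF h] by (intro INF_greatest)
qed

section \<open>The distance of a single continuous metric\<close>

locale continuous_metric =
  fixes h :: "real^'n \<Rightarrow> real^'n^'n"
  assumes cont: "continuous_on UNIV h" and pd: "\<And>x. h x \<in> pos_def_matrices"
begin

lemma riem_edist_le_dist:
  obtains C where "C > 0" "\<And>x y. x \<in> cball 0 R \<Longrightarrow> y \<in> cball 0 R \<Longrightarrow> riem_edist h x y \<le> ennreal (C * dist x y)"
proof -
  obtain C where C: "C > 0" "\<And>p w. p \<in> cball 0 R \<Longrightarrow> riem_norm (h p) w \<le> C * norm w"
    using riem_norm_bounds[OF cont pd compact_cball] by metis
  show ?thesis
  proof (rule that[OF C(1)])
    fix x y :: "real^'n" assume xy: "x \<in> cball 0 R" "y \<in> cball 0 R"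
    show "riem_edist h x y \<le> ennreal (C * dist x y)"
    proof (rule riem_edist_segment_le, rule ennreal_leI)
      fix t :: real assume t: "t \<in> {0..1}"
      have "x + t *\<^sub>R (y - x) = (1 - t) *\<^sub>R x + t *\<^sub>R y" by (simp add: algebra_simps)
      then have "x + t *\<^sub>R (y - x) \<in> cball 0 R"
        using convexD_alt[OF convex_cball xy] t by simp
      then show "riem_norm (h (x + t *\<^sub>R (y - x))) (y - x) \<le> C * dist x y"
        using C(2) by (metis dist_commute dist_norm)
    qed
  qed
qed

lemma riem_edist_finite: "riem_edist h x y < top"
proof -
  obtain C where "C > 0" "\<And>u v. u \<in> cball 0 (max (norm x) (norm y)) \<Longrightarrow> v \<in> cball 0 (max (norm x) (norm y)) \<Longrightarrow>
      riem_edist h u v \<le> ennreal (C * dist u v)"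
    using riem_edist_le_dist by blast
  then have "riem_edist h x y \<le> ennreal (C * dist x y)" by simp
  then show ?thesis by (rule le_less_trans) simp
qed

lemma ennreal_riem_dist: "ennreal (riem_dist h x y) = riem_edist h x y"
  unfolding riem_dist_eq using riem_edist_finite by (simp add: less_top)

lemma pseudometric_riem_dist: "pseudometric (riem_dist h)"
  unfolding pseudometric_def
proof (intro conjI allI)
  fix x y z
  show "riem_dist h x y = riem_dist h y x"
    unfolding riem_dist_eq by (subst riem_edist_commute[OF cont]) simp
  have "ennreal (riem_dist h x z) \<le> ennreal (riem_dist h x y + riem_dist h y z)"
    using riem_edist_triangle[OF cont, of x z y]
    by (subst ennreal_plus) (auto simp: ennreal_riem_dist, simp_all add: riem_dist_eq)
  then show "riem_dist h x z \<le> riem_dist h x y + riem_dist h y z"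
    by (subst (asm) ennreal_le_iff) (auto simp: riem_dist_eq)
qed (auto simp: riem_dist_eq)

lemma riem_dist_small:
  assumes "0 < e"
  shows "\<exists>\<delta>>0. \<forall>y. dist x y < \<delta> \<longrightarrow> riem_dist h x y < e"
proof -
  obtain C where C: "C > 0" "\<And>u v. u \<in> cball 0 (norm x + 1) \<Longrightarrow> v \<in> cball 0 (norm x + 1) \<Longrightarrow>
      riem_edist h u v \<le> ennreal (C * dist u v)"
    using riem_edist_le_dist by blast
  have "riem_dist h x y < e" if "dist x y < min 1 (e / C)" for y
  proof -
    have "norm y \<le> norm x + 1" using that norm_triangle_ineq2[of y x] by (simp add: dist_norm norm_minus_commute)
    then have "ennreal (riem_dist h x y) \<le> ennreal (C * dist x y)"
      unfolding ennreal_riem_dist by (intro C(2)) auto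
    then have "riem_dist h x y \<le> C * dist x y"
      using C(1) by (simp add: ennreal_le_iff)
    also have "\<dots> < e" using that C(1) by (simp add: pos_less_divide_eq mult.commute)
    finally show ?thesis .
  qed
  then show ?thesis using assms C(1) by (intro exI[of _ "min 1 (e / C)"]) auto
qed

text \<open>A path of almost minimal length crosses the sphere of radius \<open>R\<close> around
  \<open>x\<close>, and its length splits at the crossing time. A minimising path need not exist,
  hence the error \<open>e\<close>.\<close>

lemma riem_dist_intermediate:
  assumes "0 \<le> R" "R \<le> dist x y" "0 < e"
  shows "\<exists>z. dist x z = R \<and> riem_dist h x z + riem_dist h z y \<le> riem_dist h x y + e"
proof -
  have "riem_edist h x y < ennreal (riem_dist h x y + e)"
    unfolding ennreal_riem_dist[symmetric] using assms(3) by (intro ennreal_lessI) (auto simp: riem_dist_eq add_nonneg_pos)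
  then obtain a b \<gamma> where p: "a \<le> b" "\<gamma> piecewise_C1_differentiable_on {a..b}" "\<gamma> a = x" "\<gamma> b = y"
    "riem_length h a b \<gamma> < ennreal (riem_dist h x y + e)"
    using riem_edist_lessE by blast
  have "continuous_on {a..b} (\<lambda>s. dist x (\<gamma> s))"
    using p(2) by (auto simp: piecewise_C1_differentiable_on_def intro!: continuous_intros)
  then obtain s where s: "a \<le> s" "s \<le> b" "dist x (\<gamma> s) = R"
    using IVT'[of "\<lambda>s. dist x (\<gamma> s)" a R b] p assms by auto
  have "ennreal (riem_dist h x (\<gamma> s) + riem_dist h (\<gamma> s) y) = riem_edist h x (\<gamma> s) + riem_edist h (\<gamma> s) y"
    by (subst ennreal_plus) (auto simp: ennreal_riem_dist, simp_all add: riem_dist_eq)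
  also have "\<dots> \<le> riem_length h a s \<gamma> + riem_length h s b \<gamma>"
    using p s by (intro add_mono riem_edist_le piecewise_C1_on_Icc_subset[OF p(2)]) auto
  also have "\<dots> = riem_length h a b \<gamma>"
    using riem_length_split[OF p(2) cont s(1,2)] by simp
  also have "\<dots> \<le> ennreal (riem_dist h x y + e)" using p(5) by simp
  finally have "riem_dist h x (\<gamma> s) + riem_dist h (\<gamma> s) y \<le> riem_dist h x y + e"
    using assms(3) by (subst (asm) ennreal_le_iff) (auto simp: riem_dist_eq)
  then show ?thesis using s by blast
qed

text \<open>Only the part of a path up to the first time at distance \<open>L\<close> from
  \<open>x\<close> is counted, since the metric may be arbitrarily small farther away. That part
  stays in a compact ball, where \<open>h\<close> dominates a multiple of the Euclidean metric, here
  \<open>mat 1\<close>.\<close>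

lemma riem_dist_crossing_pos:
  assumes L: "0 < L"
  obtains c where "c > 0" "\<And>x y. x \<in> ball x0 r \<Longrightarrow> L \<le> dist x y \<Longrightarrow> c \<le> riem_dist h x y"
proof -
  obtain c where c: "c > 0" "\<And>p w. p \<in> cball x0 (r + L) \<Longrightarrow> c * norm w \<le> riem_norm (h p) w"
    using riem_norm_bounds[OF cont pd compact_cball] by metis
  have mat1: "mat 1 \<in> (pos_def_matrices :: (real^'n^'n) set)"
    by (auto simp: pos_def_matrices_def)
  have norm1: "riem_norm (mat 1) w = norm w" for w :: "real^'n"
    by (simp add: riem_norm_def norm_eq_sqrt_inner)
  show ?thesis
  proof (rule that[of "c * L"])
    show "c * L > 0" using c L by simp
    fix x y assume xy: "x \<in> ball x0 r" "L \<le> dist x y"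
    have "ennreal (c * L) \<le> riem_edist h x y"
    proof (rule riem_edist_greatest)
      fix a b \<gamma> assume p: "a \<le> b" "\<gamma> piecewise_C1_differentiable_on {a..b}" "\<gamma> a = x" "\<gamma> b = y"
      let ?f = "\<lambda>s. dist x (\<gamma> s)"
      have f: "continuous_on {a..b} ?f"
        using p(2) by (auto simp: piecewise_C1_differentiable_on_def intro!: continuous_intros)
      \<comment> \<open>Compactness of this set of times yields a first one.\<close>
      define S where "S = {s \<in> {a..b}. ?f s = L}"
      have "S = {a..b} \<inter> ({a..b} \<inter> ?f -` {L})" by (auto simp: S_def)
      then have S1: "compact S"
        using continuous_closed_preimage[OF f, of "{L}"] by (simp only: compact_Int_closed compact_Icc closed_atLeastAtMost closed_singleton)
      have "\<exists>s\<ge>a. s \<le> b \<and> ?f s = L"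
        using p(3,4) xy L by (intro IVT'[OF _ _ p(1) f]) simp_all
      then have "S \<noteq> {}" by (force simp: S_def)
      from compact_attains_inf[OF S1 this] obtain s where s: "s \<in> S" "\<And>t. t \<in> S \<Longrightarrow> s \<le> t"
        by blast
      have before: "?f r \<le> L" if "r \<in> {a..s}" for r
      proof (rule ccontr)
        assume "\<not> ?f r \<le> L"
        have "\<exists>t\<ge>a. t \<le> r \<and> ?f t = L"
        proof (rule IVT')
          show "continuous_on {a..r} ?f" using that s(1) by (intro continuous_on_subset[OF f]) (auto simp: S_def)
        qed (use that p(3) L \<open>\<not> ?f r \<le> L\<close> in simp_all)
        then obtain t where "a \<le> t" "t \<le> r" "?f t = L" by blast
        moreover from this have "t \<in> S" using that s(1) by (auto simp: S_def)
        ultimately have "r = s" using s(2)[of t] that by auto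
        then show False using \<open>\<not> ?f r \<le> L\<close> s(1) by (simp add: S_def)
      qed
      have as: "a \<le> s" "s \<le> b" using s(1) by (auto simp: S_def)
      have "ennreal L = ennreal (riem_norm (mat 1) (\<gamma> s - \<gamma> a))"
        using s(1) p(3) by (simp add: norm1 S_def dist_norm norm_minus_commute)
      also have "\<dots> \<le> riem_length (\<lambda>_. mat 1) a s \<gamma>"
        using as by (intro riem_norm_displacement_le[OF p(2) mat1]) auto
      also have "\<dots> \<le> ennreal (1 / c) * riem_length h a s \<gamma>"
      proof (rule riem_length_scale_metric[OF piecewise_C1_on_Icc_subset[OF p(2)] cont])
        fix t w assume "t \<in> {a..s}"
        then have "dist x (\<gamma> t) \<le> L" by (rule before)
        then have "\<gamma> t \<in> cball x0 (r + L)"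
          using xy(1) dist_triangle[of x0 "\<gamma> t" x] by simp
        from c(2)[OF this, of w] show "riem_norm (mat 1) w \<le> 1 / c * riem_norm (h (\<gamma> t)) w"
          using c(1) by (simp add: norm1 field_simps)
      qed (use as c in auto)
      finally have "ennreal c * ennreal L \<le> ennreal c * (ennreal (1 / c) * riem_length h a s \<gamma>)"
        by (intro mult_left_mono) auto
      also have "\<dots> = riem_length h a s \<gamma>"
        using c(1) by (simp add: mult.assoc[symmetric] ennreal_mult'[symmetric])
      also have "\<dots> \<le> riem_length h a b \<gamma>"
        using riem_length_split[OF p(2) cont as] by simp
      finally show "ennreal (c * L) \<le> riem_length h a b \<gamma>"
        using c(1) L by (simp add: ennreal_mult)
    qed
    then show "c * L \<le> riem_dist h x y"
      using c(1) L unfolding ennreal_riem_dist[symmetric] by (subst (asm) ennreal_le_iff) (auto simp: riem_dist_eq)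
  qed
qed

lemma riem_edist_le_sum:
  "riem_edist h (p 0) (p n) \<le> (\<Sum>j<n. riem_edist h (p j) (p (Suc j)))"
proof (induction n)
  case (Suc n)
  show ?case
    using riem_edist_triangle[OF cont, of "p 0" "p (Suc n)" "p n"] Suc
    by (simp add: add_right_mono order_trans)
qed simp

text \<open>The segment from 0 to \<open>v\<close> is divided into \<open>n\<close> equal pieces,
  each with the metric of its initial point. Riemann sums are kept instead of their limit, so that
  the mean can later be taken term by term.\<close>

lemma riem_edist_le_liminf:
  "riem_edist h 0 v \<le> liminf (\<lambda>n. ennreal ((\<Sum>j<n. riem_norm (h ((real j / real n) *\<^sub>R v)) v) / real n))"
    (is "_ \<le> liminf ?S")
proof (rule ennreal_le_of_perturbed)
  fix \<epsilon> :: real assume \<epsilon>: "0 < \<epsilon>" "\<epsilon> \<le> 1"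
  let ?K = "cball (0::real^'n) (norm v)"
  obtain \<delta> where \<delta>: "\<delta> > 0" "\<And>p q w. p \<in> ?K \<Longrightarrow> q \<in> ?K \<Longrightarrow> dist p q < \<delta> \<Longrightarrow>
    riem_norm (h q) w \<le> (1 + \<epsilon>) * riem_norm (h p) w"
    using riem_norm_uniformly_comparable[OF cont pd compact_cball \<epsilon>(1)] by blast
  have bound: "riem_edist h 0 v \<le> ennreal (1 + \<epsilon>) * ?S n" if n: "norm v / \<delta> < real n" for n
  proof -
    have n0: "0 < real n" using n \<delta>(1) by (smt (verit) divide_nonneg_pos norm_ge_zero)
    define p where "p j = (real j / real n) *\<^sub>R v" for j :: nat
    have diff: "p (Suc j) - p j = (1 / real n) *\<^sub>R v" for j
      unfolding p_def scaleR_left_diff_distrib[symmetric] by (simp add: add_divide_distrib)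
    have step: "riem_edist h (p j) (p (Suc j)) \<le> ennreal ((1 + \<epsilon>) * (riem_norm (h (p j)) v / real n))" if j: "j < n" for j
    proof (rule riem_edist_segment_le, rule ennreal_leI, unfold diff)
      fix t :: real assume t: "t \<in> {0..1}"
      have eq: "p j + t *\<^sub>R ((1 / real n) *\<^sub>R v) = ((real j + t) / real n) *\<^sub>R v"
        by (simp add: p_def scaleR_left_distrib[symmetric] add_divide_distrib)
      have "(real j + t) / real n \<le> 1" using j t n0 by (simp add: field_simps)
      then have in1: "p j + t *\<^sub>R ((1 / real n) *\<^sub>R v) \<in> ?K"
        unfolding eq using t n0 mult_left_le_one_le[of "norm v" "(real j + t) / real n"] by simp
      have "p j \<in> ?K" using j n0 mult_left_le_one_le[of "norm v" "real j / real n"] unfolding p_def by simp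
      moreover have "dist (p j) (p j + t *\<^sub>R ((1 / real n) *\<^sub>R v)) < \<delta>"
      proof -
        have "dist (p j) (p j + t *\<^sub>R ((1 / real n) *\<^sub>R v)) = t * (norm v / real n)"
          using t by (simp add: dist_norm)
        also have "\<dots> \<le> norm v / real n" using t by (intro mult_left_le_one_le) auto
        also have "\<dots> < \<delta>" using n n0 \<delta>(1) by (simp add: field_simps)
        finally show ?thesis .
      qed
      ultimately have "riem_norm (h (p j + t *\<^sub>R ((1 / real n) *\<^sub>R v))) ((1 / real n) *\<^sub>R v)
          \<le> (1 + \<epsilon>) * riem_norm (h (p j)) ((1 / real n) *\<^sub>R v)"
        using in1 by (intro \<delta>(2))
      then show "riem_norm (h (p j + t *\<^sub>R ((1 / real n) *\<^sub>R v))) ((1 / real n) *\<^sub>R v)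
          \<le> (1 + \<epsilon>) * (riem_norm (h (p j)) v / real n)"
        by (simp add: riem_norm_scaleR)
    qed
    have "riem_edist h 0 v = riem_edist h (p 0) (p n)" using n0 by (simp add: p_def)
    also have "\<dots> \<le> (\<Sum>j<n. riem_edist h (p j) (p (Suc j)))" by (rule riem_edist_le_sum)
    also have "\<dots> \<le> (\<Sum>j<n. ennreal ((1 + \<epsilon>) * (riem_norm (h (p j)) v / real n)))"
      by (intro sum_mono step) auto
    also have "\<dots> = ennreal (\<Sum>j<n. (1 + \<epsilon>) * (riem_norm (h (p j)) v / real n))"
      using \<epsilon> pd by (intro sum_ennreal) auto
    also have "(\<Sum>j<n. (1 + \<epsilon>) * (riem_norm (h (p j)) v / real n)) = (1 + \<epsilon>) * ((\<Sum>j<n. riem_norm (h (p j)) v) / real n)"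
      by (simp add: sum_distrib_left sum_divide_distrib)
    also have "ennreal \<dots> = ennreal (1 + \<epsilon>) * ?S n"
      using \<epsilon> pd unfolding p_def by (intro ennreal_mult divide_nonneg_nonneg sum_nonneg) auto
    finally show ?thesis .
  qed
  have inv: "ennreal (1 / (1 + \<epsilon>)) * ennreal (1 + \<epsilon>) = 1"
    using \<epsilon> by (subst ennreal_mult'[symmetric]) (auto simp del: ennreal_plus)
  have "ennreal (1 / (1 + \<epsilon>)) * riem_edist h 0 v \<le> liminf ?S"
  proof (rule Liminf_bounded)
    have "eventually (\<lambda>n. norm v / \<delta> < real n) sequentially"
      using filterlim_real_sequentially filterlim_at_top_dense by blast
    then show "eventually (\<lambda>n. ennreal (1 / (1 + \<epsilon>)) * riem_edist h 0 v \<le> ?S n) sequentially"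
    proof eventually_elim
      case (elim n)
      have "ennreal (1 / (1 + \<epsilon>)) * riem_edist h 0 v \<le> ennreal (1 / (1 + \<epsilon>)) * (ennreal (1 + \<epsilon>) * ?S n)"
        by (intro mult_left_mono bound elim) auto
      also have "\<dots> = ?S n" by (simp only: mult.assoc[symmetric] inv mult_1)
      finally show ?case .
    qed
  qed
  then have "ennreal (1 + \<epsilon>) * (ennreal (1 / (1 + \<epsilon>)) * riem_edist h 0 v) \<le> ennreal (1 + \<epsilon>) * liminf ?S"
    by (intro mult_left_mono) auto
  also have "ennreal (1 + \<epsilon>) * (ennreal (1 / (1 + \<epsilon>)) * riem_edist h 0 v) = riem_edist h 0 v"
    by (simp only: mult.assoc[symmetric] inv mult.commute[of "ennreal (1 + \<epsilon>)"] mult_1)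
  finally show "riem_edist h 0 v \<le> ennreal (1 + \<epsilon>) * liminf ?S + ennreal \<epsilon>"
    by (meson add_increasing2 zero_le)
qed

end

section \<open>Renormalisation of fast crossings\<close>

text \<open>Testing only pairs in a countable set \<open>D\<close> makes the event measurable.
  Because the inequalities are strict, the test is equivalent to one over all pairs for distances
  that are continuous. The upper bound \<open>2 * L\<close> localises the event.\<close>

definition bad_event :: "(real^'n) set \<Rightarrow> real \<Rightarrow> real \<Rightarrow> real^'n \<Rightarrow> (real^'n \<Rightarrow> real^'n \<Rightarrow> real) set" where
  "bad_event D L t z = {\<phi> \<in> Collect pseudometric.
     \<exists>x\<in>D \<inter> ball z 1. \<exists>y\<in>D. L < dist x y \<and> dist x y < 2 * L \<and> \<phi> x y < t}"

lemma sets_bad_event: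
  assumes D: "countable D"
  shows "bad_event D L t z \<in> sets pseudometric_space"
proof -
  let ?P = "PiM UNIV (\<lambda>_. PiM UNIV (\<lambda>_. borel)) :: (real^'n \<Rightarrow> real^'n \<Rightarrow> real) measure"
  have m: "(\<lambda>\<phi>. \<phi> x y) \<in> borel_measurable ?P" for x y
    using measurable_compose[OF measurable_component_singleton[of x UNIV "\<lambda>_. PiM UNIV (\<lambda>_. borel)"]
        measurable_component_singleton[of y UNIV "\<lambda>_. borel"]] by simp
  have "{\<phi> \<in> space ?P. \<phi> x y < t} \<in> sets ?P" for x y
    using m by measurable
  then have *: "{\<phi>. \<phi> x y < t} \<in> sets ?P" for x y by (simp add: space_PiM)
  let ?S = "\<Union>x\<in>D \<inter> ball z 1. \<Union>y\<in>{y\<in>D. L < dist x y \<and> dist x y < 2 * L}. {\<phi>. \<phi> x y < t}"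
  have "(\<Union>y\<in>{y\<in>D. L < dist x y \<and> dist x y < 2 * L}. {\<phi>. \<phi> x y < t}) \<in> sets ?P" for x
    using * D by (intro sets.countable_UN' countable_Collect) auto
  then have "?S \<in> sets ?P"
    using D by (intro sets.countable_UN' countable_Int1) blast+
  moreover have "bad_event D L t z = Collect pseudometric \<inter> ?S" by (auto simp: bad_event_def)
  ultimately show ?thesis unfolding pseudometric_space_def sets_restrict_space by blast
qed

lemma bad_event_decreasing:
  assumes D: "countable D"
  shows "bad_event D L t z \<in> decreasing_events (ball z (1 + 2 * L))"
  unfolding decreasing_events_def
proof (intro CollectI conjI allI impI sets_bad_event[OF D])
  fix \<phi> \<psi> assume *: "\<phi> \<in> bad_event D L t z \<and> pseudometric \<psi> \<and> \<psi> \<le> \<phi>"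
  then obtain x y where xy: "x \<in> D \<inter> ball z 1" "y \<in> D" "L < dist x y" "dist x y < 2 * L" "\<phi> x y < t"
    by (auto simp: bad_event_def)
  have "\<psi> x y \<le> \<phi> x y" using * by (simp add: le_fun_def)
  then show "\<psi> \<in> bad_event D L t z"
    using * xy unfolding bad_event_def by (intro CollectI conjI bexI[of _ x] bexI[of _ y]) auto
next
  fix \<phi> \<psi> assume *: "\<phi> \<in> bad_event D L t z \<and> pseudometric \<psi> \<and>
    (\<forall>x\<in>ball z (1 + 2 * L). \<forall>y\<in>ball z (1 + 2 * L). \<phi> x y = \<psi> x y)"
  then obtain x y where xy: "x \<in> D \<inter> ball z 1" "y \<in> D" "L < dist x y" "dist x y < 2 * L" "\<phi> x y < t"
    by (auto simp: bad_event_def)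
  have "0 \<le> L" using xy zero_le_dist[of x y] by linarith
  then have "x \<in> ball z (1 + 2 * L)" "y \<in> ball z (1 + 2 * L)"
    using xy dist_triangle[of z y x] by auto
  then have "\<psi> x y = \<phi> x y" using * by auto
  then show "\<psi> \<in> bad_event D L t z"
    using * xy unfolding bad_event_def by (intro CollectI conjI bexI[of _ x] bexI[of _ y]) auto
qed

text \<open>The properties of a Riemannian distance on which the deterministic multiscale argument
  rests: \<open>small\<close> relates it to the Euclidean topology, and \<open>intermediate\<close>
  is an approximate length-space property with cuts along Euclidean spheres.\<close>

locale length_pseudometric =
  fixes \<phi> :: "real^'n \<Rightarrow> real^'n \<Rightarrow> real"
  assumes pseudo: "pseudometric \<phi>"
    and small: "\<And>x e. 0 < e \<Longrightarrow> \<exists>\<delta>>0. \<forall>y. dist x y < \<delta> \<longrightarrow> \<phi> x y < e"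
    and intermediate: "\<And>x y R e. 0 \<le> R \<Longrightarrow> R \<le> dist x y \<Longrightarrow> 0 < e \<Longrightarrow>
      \<exists>z. dist x z = R \<and> \<phi> x z + \<phi> z y \<le> \<phi> x y + e"
begin

lemma phi_nonneg: "0 \<le> \<phi> x y" and phi_commute: "\<phi> x y = \<phi> y x" and phi_triangle: "\<phi> x z \<le> \<phi> x y + \<phi> y z"
  using pseudo unfolding pseudometric_def by auto

text \<open>Steps of length exactly \<open>L\<close> are used below, whereas badness asks for more
  than \<open>L\<close>. So \<open>y\<close> is first pushed outward by \<open>s\<close> on the ray
  from \<open>x\<close>, and then both points are moved into \<open>D\<close>.\<close>

lemma not_bad_imp_ge:
  assumes D: "\<And>x e. 0 < e \<Longrightarrow> \<exists>d\<in>D. dist d x < e" and L: "0 < L"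
    and nb: "\<phi> \<notin> bad_event D L t z" and x: "x \<in> ball z 1" and xy: "L \<le> dist x y" "dist x y < 2 * L"
  shows "t \<le> \<phi> x y"
proof (rule ccontr)
  assume "\<not> t \<le> \<phi> x y"
  define e where "e = (t - \<phi> x y) / 3"
  have e: "0 < e" using \<open>\<not> t \<le> \<phi> x y\<close> by (simp add: e_def)
  obtain dx where dx: "dx > 0" "\<And>u. dist x u < dx \<Longrightarrow> \<phi> x u < e" using small[OF e] by blast
  obtain dy where dy: "dy > 0" "\<And>u. dist y u < dy \<Longrightarrow> \<phi> y u < e" using small[OF e] by blast
  \<comment> \<open>At most half of the room left below \<open>2 * L\<close>. Moving both points by
    less than \<open>s / 4\<close> afterwards changes the distance by less than
    \<open>s / 2\<close>, so it stays strictly between \<open>L\<close> and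
    \<open>2 * L\<close>.\<close>
  define s where "s = min (dy / 2) ((2 * L - dist x y) / 2)"
  have "s \<le> (2 * L - dist x y) / 2" unfolding s_def by (rule min.cobounded2)
  then have "2 * s \<le> 2 * L - dist x y" by (simp add: pos_le_divide_eq mult.commute)
  moreover have "0 < s" "s \<le> dy / 2" using dy xy by (auto simp: s_def)
  ultimately have s: "0 < s" "s \<le> dy / 2" "2 * s \<le> 2 * L - dist x y" by auto
  define y' where "y' = y + (s / dist x y) *\<^sub>R (y - x)"
  have dpos: "0 < dist x y" using L xy by linarith
  have yy': "dist y y' = s" using s dpos by (simp add: y'_def dist_norm norm_minus_commute)
  have "y' - x = (1 + s / dist x y) *\<^sub>R (y - x)" by (simp add: y'_def algebra_simps)
  then have "dist x y' = (1 + s / dist x y) * dist x y"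
    using s dpos by (metis abs_of_nonneg add_nonneg_nonneg dist_commute dist_norm divide_nonneg_pos less_imp_le norm_scaleR zero_le_one)
  then have xy': "dist x y' = dist x y + s" using dpos by (simp add: distrib_right)
  define r where "r = min (s / 4) (min dx (1 - dist z x))"
  have "0 < r" using s dx x by (auto simp: r_def)
  moreover have "r \<le> s / 4" unfolding r_def by (rule min.cobounded1)
  moreover have "r \<le> dx" "r \<le> 1 - dist z x" unfolding r_def by (rule min.coboundedI2, simp)+
  ultimately have r: "0 < r" "r \<le> s / 4" "r \<le> dx" "r \<le> 1 - dist z x" .
  obtain u where u: "u \<in> D" "dist u x < r" using D[OF r(1)] by blast
  obtain v where v: "v \<in> D" "dist v y' < r" using D[OF r(1)] by blast
  have "u \<in> ball z 1" using u r dist_triangle[of z u x] by (simp add: dist_commute)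
  moreover have "L < dist u v"
    using xy' xy(1) u v r s dist_triangle[of x y' u] dist_triangle[of u y' v] by (simp add: dist_commute)
  moreover have "dist u v < 2 * L"
    using xy' xy(2) u v r s dist_triangle[of u v x] dist_triangle[of x v y'] by (simp add: dist_commute)
  moreover have "\<phi> u v < t"
  proof -
    have "dist y v < dy" using dist_triangle[of y v y'] yy' v r s by (simp add: dist_commute)
    then have "\<phi> y v < e" by (rule dy(2))
    moreover have "\<phi> u x < e" using dx(2)[of u] u r by (simp add: dist_commute phi_commute[of u x])
    moreover have "\<phi> u v \<le> \<phi> u x + \<phi> x y + \<phi> y v"
      using phi_triangle[of u v x] phi_triangle[of x v y] by simp
    moreover have "3 * e = t - \<phi> x y" by (simp add: e_def)
    ultimately show ?thesis using e by linarith
  qed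
  ultimately have "\<phi> \<in> bad_event D L t z" using pseudo u v by (auto simp: bad_event_def)
  with nb show False by simp
qed

text \<open>The two end points are moved towards each other in steps of length \<open>L\<close>; at every stage
  at least one of them is far from the defect \<open>c\<close>, since the sum of their distances to \<open>c\<close> is at least
  their mutual distance.\<close>

lemma ge_of_single_defect:
  assumes L: "0 < L" and t: "0 \<le> t"
    and good: "\<And>x y. x \<in> ball x0 R \<Longrightarrow> 6 * L \<le> dist x c \<Longrightarrow> dist x y = L \<Longrightarrow> t \<le> \<phi> x y"
  shows "dist x x0 + real n * L < R \<Longrightarrow> dist y x0 + real n * L < R \<Longrightarrow> (real n + 12) * L \<le> dist x y \<Longrightarrow>
    real n * t \<le> \<phi> x y"
proof (induction n arbitrary: x y)
  case 0
  then show ?case by (simp add: phi_nonneg)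
next
  case (Suc n)
  have step: "real (Suc n) * t \<le> \<phi> x y"
    if x: "dist x x0 + real (Suc n) * L < R" and y: "dist y x0 + real (Suc n) * L < R"
      and far: "(real (Suc n) + 12) * L \<le> dist x y" and xc: "6 * L \<le> dist x c" for x y
  proof (rule field_le_epsilon)
    fix e :: real assume e: "0 < e"
    have nL: "0 \<le> real n * L" using L by simp
    have far': "(real n + 12) * L + L \<le> dist x y" using far by (simp add: algebra_simps)
    have "L \<le> dist x y" using far' nL L unfolding distrib_right by linarith
    then obtain z where z: "dist x z = L" "\<phi> x z + \<phi> z y \<le> \<phi> x y + e"
      using intermediate[of L x y e] L e by auto
    have "t \<le> \<phi> x z"
    proof (rule good[OF _ xc z(1)])
      show "x \<in> ball x0 R"
        using x nL L unfolding of_nat_Suc distrib_right mem_ball dist_commute[of x0 x] by linarith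
    qed
    moreover have "real n * t \<le> \<phi> z y"
    proof (rule Suc.IH)
      show "dist z x0 + real n * L < R"
        using x z(1) dist_triangle[of z x0 x] by (simp add: dist_commute algebra_simps)
      show "dist y x0 + real n * L < R" using y L by (simp add: algebra_simps)
      show "(real n + 12) * L \<le> dist z y" using far' z(1) dist_triangle[of x y z] by simp
    qed
    ultimately show "real (Suc n) * t \<le> \<phi> x y + e" using z(2) by (simp add: algebra_simps)
  qed
  have nL: "0 \<le> real n * L" using L by simp
  have "6 * L \<le> dist x c \<or> 6 * L \<le> dist y c"
    using Suc.prems(3) dist_triangle[of x y c] nL L unfolding distrib_right dist_commute[of c y] of_nat_Suc by linarith
  then show ?case
    using step[of x y] step[of y x] Suc.prems by (auto simp: dist_commute phi_commute)
qed

text \<open>By \<open>sep\<close>, all bad centres lie within \<open>2 + 5 * L\<close> of a chosen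
  one, \<open>c\<close>. A point at distance at least \<open>6 * L\<close> from \<open>c\<close>
  thus lies in a unit ball that is not bad, as \<open>6 * L - 1 \<ge> 2 + 5 * L\<close>. The radius
  \<open>1 + 3 * L'\<close> accommodates both end points, less than \<open>1 + 2 * L'\<close> away,
  and a margin \<open>L'\<close> for the \<open>n\<close> steps.\<close>

lemma not_bad_next_scale:
  assumes D: "\<And>x e. 0 < e \<Longrightarrow> \<exists>d\<in>D. dist d x < e" and L: "3 \<le> L" and t: "0 \<le> t"
    and cover: "ball x0 (1 + 3 * L') \<subseteq> (\<Union>z\<in>\<Lambda>. ball z 1)"
    and sep: "\<And>z z'. z \<in> \<Lambda> \<Longrightarrow> z' \<in> \<Lambda> \<Longrightarrow> 2 + 5 * L < dist z z' \<Longrightarrow>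
      \<not> (\<phi> \<in> bad_event D L t z \<and> \<phi> \<in> bad_event D L t z')"
    and n: "(real n + 12) * L \<le> L'" and t': "t' \<le> real n * t"
  shows "\<phi> \<notin> bad_event D L' t' x0"
proof
  assume "\<phi> \<in> bad_event D L' t' x0"
  then obtain x y where xy: "x \<in> ball x0 1" "L' < dist x y" "dist x y < 2 * L'" "\<phi> x y < t'"
    by (auto simp: bad_event_def)
  \<comment> \<open>If no ball of the cover is bad, any point can play the defect.\<close>
  define c where "c = (if \<exists>z\<in>\<Lambda>. \<phi> \<in> bad_event D L t z then SOME z. z \<in> \<Lambda> \<and> \<phi> \<in> bad_event D L t z else x0)"
  have c: "c \<in> \<Lambda> \<and> \<phi> \<in> bad_event D L t c" if "\<exists>z\<in>\<Lambda>. \<phi> \<in> bad_event D L t z"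
    unfolding c_def using that someI_ex[of "\<lambda>z. z \<in> \<Lambda> \<and> \<phi> \<in> bad_event D L t z"] by auto
  have nL: "real n * L \<le> L'" using n L by (simp add: algebra_simps)
  have "real n * t \<le> \<phi> x y"
  proof (rule ge_of_single_defect[of L t x0 "1 + 3 * L'" c])
    fix u v assume u: "u \<in> ball x0 (1 + 3 * L')" "6 * L \<le> dist u c" "dist u v = L"
    obtain z where z: "z \<in> \<Lambda>" "u \<in> ball z 1" using cover u(1) by blast
    have "\<phi> \<notin> bad_event D L t z"
    proof
      assume bad: "\<phi> \<in> bad_event D L t z"
      then have "c \<in> \<Lambda> \<and> \<phi> \<in> bad_event D L t c" using z c by blast
      moreover have "2 + 5 * L < dist z c"
        using u(2) z(2) L dist_triangle[of u c z] by (simp add: dist_commute)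
      ultimately show False using sep z bad by blast
    qed
    then show "t \<le> \<phi> u v" using u(3) L by (intro not_bad_imp_ge[OF D _ _ z(2), of L]) auto
  next
    show "dist x x0 + real n * L < 1 + 3 * L'"
      using xy nL L zero_le_dist[of x y] by (simp add: dist_commute)
    show "dist y x0 + real n * L < 1 + 3 * L'"
      using xy nL dist_triangle[of y x0 x] by (simp add: dist_commute)
  qed (use L t n xy in auto)
  with xy t' show False by simp
qed

end

text \<open>A grid of mesh \<open>1 / N\<close>, with \<open>N\<close> the dimension: rounding down
  costs less than \<open>1 / N\<close> in each coordinate, hence less than 1 in the l1 norm, which
  dominates the Euclidean norm. Each coordinate takes \<open>2 * M + 1\<close> values.\<close>

lemma unit_ball_cover:
  fixes x0 :: "real^'n"
  assumes R: "1 \<le> R"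
  obtains \<Lambda> where "finite \<Lambda>" "ball x0 R \<subseteq> (\<Union>z\<in>\<Lambda>. ball z 1)"
    "real (card \<Lambda>) \<le> ((2 * real CARD('n) + 3) * R) ^ CARD('n)"
proof -
  define N where "N = real CARD('n)"
  have N: "0 < N" by (simp add: N_def)
  define M where "M = \<lceil>R * N\<rceil>"
  have "0 < R * N" using R N by (intro mult_pos_pos) auto
  then have M0: "0 \<le> M" by (simp add: M_def)
  define F where "F = (PiE UNIV (\<lambda>_. {-M..M}) :: ('n \<Rightarrow> int) set)"
  define pt where "pt k = x0 + (\<chi> i. real_of_int (k i) / N)" for k :: "'n \<Rightarrow> int"
  have finF: "finite F" unfolding F_def by (intro finite_PiE) auto
  have "card F = nat (2 * M + 1) ^ CARD('n)" unfolding F_def by (simp add: card_PiE)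
  then have "real (card F) = real_of_int (2 * M + 1) ^ CARD('n)" using M0 by simp
  also have "\<dots> \<le> ((2 * N + 3) * R) ^ CARD('n)"
  proof (rule power_mono)
    have "real_of_int M \<le> R * N + 1" unfolding M_def by linarith
    then show "real_of_int (2 * M + 1) \<le> (2 * N + 3) * R" using R by (simp add: algebra_simps)
  qed (use M0 in simp)
  finally have cardF: "real (card F) \<le> ((2 * N + 3) * R) ^ CARD('n)" .
  show ?thesis
  proof (rule that[of "pt ` F"])
    show "finite (pt ` F)" using finF by simp
    have "card (pt ` F) \<le> card F" by (rule card_image_le[OF finF])
    then show "real (card (pt ` F)) \<le> ((2 * real CARD('n) + 3) * R) ^ CARD('n)"
      using cardF unfolding N_def by linarith
    show "ball x0 R \<subseteq> (\<Union>z\<in>pt ` F. ball z 1)"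
    proof
      fix x assume x: "x \<in> ball x0 R"
      define w where "w = x - x0"
      define k where "k i = \<lfloor>N * w $ i\<rfloor>" for i
      have w: "\<bar>w $ i\<bar> < R" for i
        using x component_le_norm_cart[of w i] by (simp add: w_def dist_norm norm_minus_commute)
      have "k \<in> F"
        unfolding F_def
      proof (intro PiE_I)
        fix i
        have "\<bar>N * w $ i\<bar> \<le> R * N" using w[of i] N by (simp add: abs_mult mult.commute)
        then have "\<bar>N * w $ i\<bar> \<le> real_of_int M" unfolding M_def by linarith
        then show "k i \<in> {-M..M}" unfolding k_def by (auto simp: le_floor_iff floor_le_iff)
      qed auto
      moreover have "dist (pt k) x < 1"
      proof -
        have "norm (x - pt k) \<le> (\<Sum>i\<in>UNIV. \<bar>(x - pt k) $ i\<bar>)" by (rule norm_le_l1_cart)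
        also have "\<dots> < (\<Sum>i\<in>(UNIV::'n set). 1 / N)"
        proof (rule sum_strict_mono)
          fix i
          have "(x - pt k) $ i = (N * w $ i - real_of_int (k i)) / N"
            using N by (simp add: pt_def w_def field_simps)
          moreover have "0 \<le> N * w $ i - real_of_int (k i)" "N * w $ i - real_of_int (k i) < 1"
            unfolding k_def by linarith+
          ultimately show "\<bar>(x - pt k) $ i\<bar> < 1 / N" using N by (simp add: divide_strict_right_mono)
        qed auto
        also have "\<dots> = 1" using N by (simp add: N_def)
        finally show ?thesis by (simp add: dist_norm norm_minus_commute)
      qed
      ultimately show "x \<in> (\<Union>z\<in>pt ` F. ball z 1)" by auto
    qed
  qed
qed

text \<open>The delicate point is homogeneity for real factors, as the limit runs over integer
  multiples. Subadditivity and the linear bound \<open>le\<close> make \<open>e\<close> Lipschitz,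
  so replacing \<open>n * c\<close> by its integer part changes \<open>e\<close> by a bounded
  amount.\<close>

lemma is_norm_subadditive_limit:
  fixes e :: "'a::real_normed_vector \<Rightarrow> real"
  assumes nonneg: "\<And>v. 0 \<le> e v" and sub: "\<And>v w. e (v + w) \<le> e v + e w" and sym: "\<And>v. e (- v) = e v"
    and le: "\<And>v. e v \<le> C * norm v"
    and lim: "\<And>v. (\<lambda>n. e (real n *\<^sub>R v) / real n) \<longlonglongrightarrow> \<mu> v"
    and pos: "\<And>v. v \<noteq> 0 \<Longrightarrow> 0 < \<mu> v"
  shows "is_norm \<mu>"
proof -
  have nonneg': "0 \<le> \<mu> v" for v
    by (rule LIMSEQ_le_const[OF lim]) (simp add: nonneg)
  have e0: "e 0 = 0" using le[of 0] nonneg[of 0] by simp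
  have \<mu>0: "\<mu> 0 = 0" using lim[of 0] e0 by (simp add: LIMSEQ_const_iff)
  have sub': "\<mu> (v + w) \<le> \<mu> v + \<mu> w" for v w
  proof (rule LIMSEQ_le[OF lim tendsto_add[OF lim lim]])
    have "e (real n *\<^sub>R (v + w)) / real n \<le> e (real n *\<^sub>R v) / real n + e (real n *\<^sub>R w) / real n" for n
      using sub[of "real n *\<^sub>R v" "real n *\<^sub>R w"]
      by (simp add: scaleR_add_right add_divide_distrib[symmetric] divide_right_mono)
    then show "\<exists>N. \<forall>n\<ge>N. e (real n *\<^sub>R (v + w)) / real n \<le> e (real n *\<^sub>R v) / real n + e (real n *\<^sub>R w) / real n" by blast
  qed
  have sym': "\<mu> (- v) = \<mu> v" for v
    using LIMSEQ_unique[OF lim[of "- v"]] lim[of v] by (simp add: sym)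
  have C: "0 \<le> C * norm v" for v :: 'a using le[of v] nonneg[of v] by linarith
  have lip: "\<bar>e v - e w\<bar> \<le> C * norm (v - w)" for v w
    using sub[of "v - w" w] sub[of "w - v" v] le[of "v - w"] le[of "w - v"] by (simp add: norm_minus_commute)
  have pos_scale: "\<mu> (c *\<^sub>R v) = c * \<mu> v" if c: "0 < c" for c v
  proof -
    define m where "m n = nat \<lfloor>real n * c\<rfloor>" for n
    have m: "real (m n) \<le> real n * c" "real n * c < real (m n) + 1" for n
      using c unfolding m_def by (auto simp: of_nat_nat) linarith?
    have m_lim: "filterlim m at_top sequentially"
    proof -
      have "filterlim (\<lambda>n. real n * c - 1) at_top sequentially"
        using c by real_asymp
      then have "filterlim (\<lambda>n. real (m n)) at_top sequentially"
        by (rule filterlim_at_top_mono) (use m in \<open>auto intro!: always_eventually less_imp_le simp: algebra_simps\<close>)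
      then show ?thesis by (simp add: filterlim_real_sequentially filterlim_sequentially_iff_filterlim_real)
    qed
    have ratio: "(\<lambda>n. real (m n) / real n) \<longlonglongrightarrow> c"
    proof (rule tendsto_sandwich[of "\<lambda>n. c - 1 / real n" _ _ "\<lambda>_. c"])
      show "eventually (\<lambda>n. c - 1 / real n \<le> real (m n) / real n) sequentially"
        using eventually_gt_at_top[of 0]
      proof eventually_elim
        case (elim n)
        have "(real n * c - 1) / real n \<le> real (m n) / real n"
          using m(2)[of n] by (intro divide_right_mono) auto
        then show ?case using elim by (simp add: diff_divide_distrib)
      qed
      show "eventually (\<lambda>n. real (m n) / real n \<le> c) sequentially"
        using eventually_gt_at_top[of 0] by eventually_elim (use m(1) in \<open>simp add: field_simps\<close>)
      show "(\<lambda>n. c - 1 / real n) \<longlonglongrightarrow> c" by real_asymp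
    qed auto
    have main: "(\<lambda>n. e (real (m n) *\<^sub>R v) / real (m n) * (real (m n) / real n)) \<longlonglongrightarrow> \<mu> v * c"
      by (intro tendsto_mult ratio filterlim_compose[OF lim m_lim])
    have close: "\<bar>e (real n *\<^sub>R (c *\<^sub>R v)) / real n - e (real (m n) *\<^sub>R v) / real (m n) * (real (m n) / real n)\<bar> \<le> C * norm v / real n" for n
    proof -
      \<comment> \<open>For \<open>m n = 0\<close> the left side is 0 through division by zero, and
        the right side because \<open>e 0 = 0\<close>.\<close>
      have 1: "e (real (m n) *\<^sub>R v) / real (m n) * (real (m n) / real n) = e (real (m n) *\<^sub>R v) / real n"
        by (cases "m n = 0") (auto simp: e0)
      have 2: "\<bar>e (real n *\<^sub>R (c *\<^sub>R v)) - e (real (m n) *\<^sub>R v)\<bar> \<le> C * norm v"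
      proof -
        have "\<bar>e (real n *\<^sub>R (c *\<^sub>R v)) - e (real (m n) *\<^sub>R v)\<bar> \<le> C * norm ((real n * c - real (m n)) *\<^sub>R v)"
          using lip[of "real n *\<^sub>R (c *\<^sub>R v)" "real (m n) *\<^sub>R v"] by (simp add: scaleR_diff_left)
        also have "\<dots> = \<bar>real n * c - real (m n)\<bar> * (C * norm v)" by simp
        also have "\<dots> \<le> 1 * (C * norm v)" using m[of n] C[of v] by (intro mult_right_mono) auto
        finally show ?thesis by simp
      qed
      show ?thesis
        unfolding 1 diff_divide_distrib[symmetric] abs_divide abs_of_nat
        using 2 by (rule divide_right_mono) simp
    qed
    have "(\<lambda>n. e (real n *\<^sub>R (c *\<^sub>R v)) / real n - e (real (m n) *\<^sub>R v) / real (m n) * (real (m n) / real n)) \<longlonglongrightarrow> 0"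
      by (rule Lim_null_comparison[OF _ lim_const_over_n[of "C * norm v"]]) (simp only: real_norm_def close eventually_True)
    with main have "(\<lambda>n. e (real n *\<^sub>R (c *\<^sub>R v)) / real n) \<longlonglongrightarrow> \<mu> v * c"
      by (rule Lim_transform)
    from LIMSEQ_unique[OF lim this] show ?thesis by (simp add: mult.commute)
  qed
  have scale: "\<mu> (c *\<^sub>R v) = \<bar>c\<bar> * \<mu> v" for c v
  proof -
    consider "c = 0" | "0 < c" | "c < 0" by linarith
    then show ?thesis
    proof cases
      case 3
      then show ?thesis using pos_scale[of "- c" "v"] sym'[of "c *\<^sub>R v"] by simp
    qed (auto simp: \<mu>0 pos_scale)
  qed
  have "\<mu> v = 0 \<longleftrightarrow> v = 0" for v using pos[of v] \<mu>0 by (cases "v = 0") auto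
  then show ?thesis unfolding is_norm_def using nonneg' scale sub' by blast
qed

section \<open>Recursion over scales\<close>

lemma eventually_power_mult_exp_small:
  fixes \<beta> K :: real
  assumes "0 < \<beta>"
  shows "eventually (\<lambda>L. K * L ^ m * exp (- (L powr \<beta>)) \<le> 1) at_top"
proof -
  have "((\<lambda>L. K * L ^ m * exp (- (L powr \<beta>))) \<longlongrightarrow> 0) at_top"
    using assms by real_asymp
  then have "eventually (\<lambda>L. K * L ^ m * exp (- (L powr \<beta>)) < 1) at_top"
    by (rule order_tendstoD) simp
  then show ?thesis by eventually_elim simp
qed

text \<open>Scales grow by \<open>L' = L * sqrt L\<close>, which makes the losses in the speed summable while the
  squaring of probabilities beats the entropy \<open>L' ^ (2 * N)\<close> of the union bound.\<close>

lemma multiscale_iteration: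
  fixes p :: "real \<Rightarrow> real \<Rightarrow> real" and N :: nat
  assumes N: "1 \<le> N" and \<beta>: "0 < \<beta>" and c: "1 \<le> c"
    and nonneg: "\<And>L t. 0 \<le> p L t"
    and mono: "\<And>L t t'. t \<le> t' \<Longrightarrow> p L t \<le> p L t'"
    and start: "\<And>L \<epsilon>. 0 < L \<Longrightarrow> 0 < \<epsilon> \<Longrightarrow> \<exists>t>0. p L t < \<epsilon>"
    and step: "\<And>L t n L' t'. L0 \<le> L \<Longrightarrow> 0 \<le> t \<Longrightarrow> (real n + 12) * L \<le> L' \<Longrightarrow> t' \<le> real n * t \<Longrightarrow>
      p L' t' \<le> ((c * L') ^ N)\<^sup>2 * ((p L t)\<^sup>2 + exp (- (L powr \<beta>)))"
  obtains \<delta> where "0 < \<delta>" "\<And>X. \<exists>L\<ge>X. p L (\<delta> * L) \<le> 1 / 2"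
proof -
  have "eventually (\<lambda>L. (2 * c ^ (2 * N)) * L ^ (15 * N) * exp (- (L powr \<beta>)) \<le> 1) at_top"
    using \<beta> by (rule eventually_power_mult_exp_small)
  then obtain L1 where L1: "\<And>L. L1 \<le> L \<Longrightarrow> (2 * c ^ (2 * N)) * L ^ (15 * N) * exp (- (L powr \<beta>)) \<le> 1"
    unfolding eventually_at_top_linorder by blast
  \<comment> \<open>1300 exceeds 36 squared, as \<open>sqrt_ge\<close> requires; \<open>L1\<close>
    makes the exponential term small, and \<open>2 * c\<^sup>2\<close> lets one power
    \<open>L ^ N\<close> absorb the constants.\<close>
  define M where "M = max 1300 (max L0 (max L1 (2 * c\<^sup>2)))"
  have M: "1300 \<le> M" "L0 \<le> M" "L1 \<le> M" "2 * c\<^sup>2 \<le> M" by (auto simp: M_def)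
  define Ls where "Ls = rec_nat M (\<lambda>_ L. L * sqrt L)"
  have Ls: "Ls 0 = M" "Ls (Suc k) = Ls k * sqrt (Ls k)" for k by (simp_all add: Ls_def)
  have Ls_ge: "16 ^ k * M \<le> Ls k" for k
  proof (induction k)
    case (Suc k)
    have "1 * M \<le> 16 ^ k * M" using M by (intro mult_right_mono) auto
    then have M_le: "M \<le> Ls k" using Suc by linarith
    have "(16::real)\<^sup>2 \<le> Ls k" using M_le M by simp
    then have "16 \<le> sqrt (Ls k)" by (rule real_le_rsqrt)
    then have "16 * (16 ^ k * M) \<le> sqrt (Ls k) * Ls k" using Suc M M_le by (intro mult_mono) auto
    then show ?case by (simp add: Ls mult.commute)
  qed (simp add: Ls)
  have M_le: "M \<le> Ls k" for k
  proof -
    have "1 * M \<le> 16 ^ k * M" using M by (intro mult_right_mono) auto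
    then show ?thesis using Ls_ge[of k] by linarith
  qed
  have sqrt_ge: "36 * 4 ^ k \<le> sqrt (Ls k)" for k
  proof (rule real_le_rsqrt)
    have "(36 * 4 ^ k)\<^sup>2 = 16 ^ k * (1296::real)" by (simp add: power_mult_distrib power2_eq_square flip: power_mult_distrib)
    also have "\<dots> \<le> 16 ^ k * M" using M by (intro mult_left_mono) auto
    also have "\<dots> \<le> Ls k" by (rule Ls_ge)
    finally show "(36 * 4 ^ k)\<^sup>2 \<le> Ls k" .
  qed
  \<comment> \<open>The scale \<open>M\<close> is fixed before \<open>t0\<close>. The resulting
    speed \<open>\<delta>0\<close> may be tiny, but only a factor 2 of it is lost over all later
    scales.\<close>
  obtain t0 where t0: "0 < t0" "p M t0 < 1 / M ^ (8 * N)"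
    using start[of M "1 / M ^ (8 * N)"] M by auto
  define \<delta>0 where "\<delta>0 = t0 / M"
  have \<delta>0: "0 < \<delta>0" using t0 M by (simp add: \<delta>0_def)
  \<comment> \<open>Decreases from \<open>\<delta>0\<close> towards \<open>\<delta>0 / 2\<close>.
    The loss at stage \<open>k\<close> is \<open>3 / 8 * (1 / 4) ^ k\<close> of
    \<open>\<delta>0\<close>; with \<open>sqrt L \<ge> 36 * 4 ^ k\<close> this covers the relative
    loss \<open>13 / sqrt L\<close>, because \<open>3 / 8 * 36 > 13\<close>.\<close>
  define \<delta> where "\<delta> k = \<delta>0 * (1 / 2 + (1 / 4) ^ k / 2)" for k
  have \<delta>_pos: "0 < \<delta> k" for k unfolding \<delta>_def using \<delta>0 by (intro mult_pos_pos add_pos_nonneg) auto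
  have \<delta>_le: "\<delta> k \<le> \<delta>0" for k
  proof -
    have "(1 / 4 :: real) ^ k \<le> 1" by (rule power_le_one) auto
    then show ?thesis unfolding \<delta>_def using \<delta>0 by (simp add: mult_left_le)
  qed
  \<comment> \<open>The exponent \<open>8 * N\<close> reproduces itself: squaring gives
    \<open>16 * N\<close>, the entropy costs \<open>3 * N\<close> powers of \<open>L\<close>, the
    constants one more \<open>N\<close>, and the remaining \<open>12 * N\<close> is
    \<open>8 * N\<close> at the scale \<open>L * sqrt L\<close>.\<close>
  have key: "p (Ls k) (\<delta> k * Ls k) \<le> 1 / Ls k ^ (8 * N)" for k
  proof (induction k)
    case 0
    show ?case using t0 M by (simp add: Ls \<delta>_def \<delta>0_def)
  next
    case (Suc k)
    define L where "L = Ls k"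
    define s where "s = sqrt L"
    have L: "1300 \<le> L" "L0 \<le> L" "L1 \<le> L" "2 * c\<^sup>2 \<le> L" using M M_le[of k] by (auto simp: L_def)
    have s: "36 * 4 ^ k \<le> s" "s * s = L" using sqrt_ge[of k] L by (auto simp: L_def s_def)
    have s36: "36 \<le> s"
    proof -
      have "(1::real) \<le> 4 ^ k" by simp
      then show ?thesis using s(1) by linarith
    qed
    \<comment> \<open>The largest number of steps with \<open>n + 12 \<le> sqrt L\<close>; rounding
      down makes the loss at most 13.\<close>
    define n where "n = nat \<lfloor>s\<rfloor> - 12"
    have n: "real n + 12 \<le> s" "s - 13 \<le> real n" using s36 unfolding n_def by linarith+
    have "(real n + 12) * L \<le> L * s" using n(1) L by (simp add: mult.commute)
    moreover have "\<delta> (Suc k) * (L * s) \<le> real n * (\<delta> k * L)"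
    proof -
      have diff: "\<delta> k - \<delta> (Suc k) = \<delta>0 * ((3 / 8) * (1 / 4) ^ k)" unfolding \<delta>_def by (simp add: field_simps)
      have "(1 / 4 :: real) ^ k * 4 ^ k = 1" by (simp flip: power_mult_distrib)
      then have "13 \<le> (3 / 8) * (1 / 4) ^ k * (36 * 4 ^ k :: real)" by (simp add: algebra_simps)
      also have "\<dots> \<le> (3 / 8) * (1 / 4) ^ k * s" using s(1) by (intro mult_left_mono) auto
      finally have "\<delta>0 * 13 \<le> \<delta>0 * ((3 / 8) * (1 / 4) ^ k * s)" using \<delta>0 by (intro mult_left_mono) auto
      also have "\<dots> = (\<delta> k - \<delta> (Suc k)) * s" by (simp add: diff)
      finally have "13 * \<delta> k \<le> (\<delta> k - \<delta> (Suc k)) * s" using \<delta>_le[of k] by linarith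
      then have "\<delta> (Suc k) * s \<le> (s - 13) * \<delta> k" by (simp add: algebra_simps)
      also have "\<dots> \<le> real n * \<delta> k" using n \<delta>_pos[of k] by (intro mult_right_mono) auto
      finally have "\<delta> (Suc k) * s * L \<le> real n * \<delta> k * L" using L by (intro mult_right_mono) auto
      then show ?thesis by (simp add: ac_simps)
    qed
    ultimately have "p (L * s) (\<delta> (Suc k) * (L * s)) \<le> ((c * (L * s)) ^ N)\<^sup>2 * ((p L (\<delta> k * L))\<^sup>2 + exp (- (L powr \<beta>)))"
      using L \<delta>_pos[of k] by (intro step) auto
    also have "\<dots> \<le> ((c * (L * s)) ^ N)\<^sup>2 * ((1 / L ^ (8 * N))\<^sup>2 + exp (- (L powr \<beta>)))"
      using Suc nonneg by (intro mult_left_mono add_right_mono power_mono) (auto simp: L_def)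
    also have "((c * (L * s)) ^ N)\<^sup>2 = c ^ (2 * N) * L ^ (3 * N)"
    proof -
      have "((c * (L * s)) ^ N)\<^sup>2 = (c\<^sup>2 * (L * L * (s * s))) ^ N"
        by (simp add: power2_eq_square power_mult_distrib ac_simps)
      also have "\<dots> = (c\<^sup>2 * L ^ 3) ^ N" by (simp add: s(2) power3_eq_cube)
      finally show ?thesis by (simp add: power_mult_distrib power_mult)
    qed
    also have "c ^ (2 * N) * L ^ (3 * N) * ((1 / L ^ (8 * N))\<^sup>2 + exp (- (L powr \<beta>)))
        \<le> 1 / 2 / L ^ (12 * N) + 1 / 2 / L ^ (12 * N)"
    proof -
      have "c ^ (2 * N) * L ^ (3 * N) * (1 / L ^ (8 * N))\<^sup>2 \<le> 1 / 2 / L ^ (12 * N)"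
      proof -
        have "2 * c ^ (2 * N) \<le> (2 * c\<^sup>2) ^ N"
          using N self_le_power[of "2::real" N] c by (simp add: power_mult_distrib power_mult)
        also have "\<dots> \<le> L ^ N" using L c by (intro power_mono) auto
        finally have *: "2 * c ^ (2 * N) \<le> L ^ N" .
        have "(1 / L ^ (8 * N))\<^sup>2 = 1 / (L ^ (3 * N) * L ^ N * L ^ (12 * N))"
          by (simp add: power_divide flip: power_add power_mult)
        then show ?thesis using * L by (simp add: field_simps)
      qed
      moreover have "c ^ (2 * N) * L ^ (3 * N) * exp (- (L powr \<beta>)) \<le> 1 / 2 / L ^ (12 * N)"
      proof -
        have "L ^ (15 * N) = L ^ (3 * N) * L ^ (12 * N)" by (simp flip: power_add)
        then show ?thesis using L1[OF L(3)] L by (simp add: field_simps)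
      qed
      ultimately show ?thesis by (simp add: distrib_left)
    qed
    also have "\<dots> = 1 / (L * s) ^ (8 * N)"
    proof -
      have "(L * s) ^ (8 * N) = (L ^ 8 * (s * s) ^ 4) ^ N"
        by (simp add: power_mult power_mult_distrib power2_eq_square[symmetric] flip: power_mult)
      also have "\<dots> = L ^ (12 * N)" by (simp add: s(2) power_mult flip: power_add)
      finally show ?thesis by simp
    qed
    finally show ?case by (simp add: Ls L_def s_def)
  qed
  show ?thesis
  proof (rule that[of "\<delta>0 / 2"])
    fix X :: real
    obtain k where k: "X < 16 ^ k" using real_arch_pow[of 16 X] by auto
    have "16 ^ k * 1 \<le> 16 ^ k * M" using M by (intro mult_left_mono) auto
    then have "X \<le> Ls k" using k Ls_ge[of k] by linarith
    moreover have "p (Ls k) (\<delta>0 / 2 * Ls k) \<le> 1 / 2"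
    proof -
      have "\<delta>0 / 2 \<le> \<delta> k" unfolding \<delta>_def using \<delta>0 by (simp add: distrib_left)
      then have "p (Ls k) (\<delta>0 / 2 * Ls k) \<le> p (Ls k) (\<delta> k * Ls k)"
        using M_le[of k] M by (intro mono mult_right_mono) auto
      also have "\<dots> \<le> 1 / Ls k ^ (8 * N)" by (rule key)
      also have "\<dots> \<le> 1 / 2"
      proof -
        have "2 \<le> Ls k" using M_le[of k] M by linarith
        also have "Ls k \<le> Ls k ^ (8 * N)" using \<open>2 \<le> Ls k\<close> N by (intro self_le_power) auto
        finally show ?thesis by (intro divide_left_mono) auto
      qed
      finally show ?thesis .
    qed
    ultimately show "\<exists>L\<ge>X. p L (\<delta>0 / 2 * L) \<le> 1 / 2" by blast
  qed (use \<delta>0 in simp)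
qed

section \<open>Stationary random metrics\<close>

lemma completion_AE_eq:
  assumes A: "A \<in> sets M" and B: "B \<subseteq> space M" and eq: "AE x in M. x \<in> B \<longleftrightarrow> x \<in> A"
  shows "B \<in> sets (completion M)" "measure (completion M) B = measure M A"
proof -
  have 1: "AE x in M. \<not> (x \<in> B \<and> x \<notin> A)" using eq by eventually_elim blast
  have 2: "AE x in M. \<not> (x \<in> A \<and> x \<notin> B)" using eq by eventually_elim blast
  have "{x \<in> space M. x \<in> B \<and> x \<notin> A} \<in> sets (completion M)" "{x \<in> space M. x \<in> A \<and> x \<notin> B} \<in> sets (completion M)"
    using sets_completion_AE[OF 1] sets_completion_AE[OF 2] unfolding pred_def by simp_all
  then have "(A \<union> {x \<in> space M. x \<in> B \<and> x \<notin> A}) - {x \<in> space M. x \<in> A \<and> x \<notin> B} \<in> sets (completion M)"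
    using A by auto
  also have "(A \<union> {x \<in> space M. x \<in> B \<and> x \<notin> A}) - {x \<in> space M. x \<in> A \<and> x \<notin> B} = B"
    using B sets.sets_into_space[OF A] by auto
  finally show *: "B \<in> sets (completion M)" .
  have "measure (completion M) B = measure (completion M) A"
    using * A AE_completion[OF eq] by (intro measure_eq_AE) auto
  then show "measure (completion M) B = measure M A" using A by simp
qed

lemma completion_AE_borel_measurable:
  fixes f f' :: "'a \<Rightarrow> real"
  assumes f: "f \<in> borel_measurable M" and eq: "AE x in M. f' x = f x"
  shows "f' \<in> borel_measurable (completion M)"
proof (rule borel_measurableI_le)
  fix a
  have "{x \<in> space M. f x \<le> a} \<in> sets M" using f by measurable
  moreover have "AE x in M. x \<in> {x \<in> space M. f' x \<le> a} \<longleftrightarrow> x \<in> {x \<in> space M. f x \<le> a}"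
    using eq by eventually_elim auto
  ultimately have "{x \<in> space M. f' x \<le> a} \<in> sets (completion M)"
    by (intro completion_AE_eq(1)) auto
  then show "{x \<in> space (completion M). f' x \<le> a} \<in> sets (completion M)" by simp
qed

lemma completion_AE_integral:
  fixes f f' :: "'a \<Rightarrow> real"
  assumes f: "f \<in> borel_measurable M" and eq: "AE x in M. f' x = f x"
  shows "integral\<^sup>L (completion M) f' = integral\<^sup>L M f"
    and "integrable M f \<Longrightarrow> integrable (completion M) f'"
proof -
  have f': "f' \<in> borel_measurable (completion M)" by (rule completion_AE_borel_measurable[OF assms])
  have eq': "AE x in completion M. f' x = f x" by (rule AE_completion[OF eq])
  have "integral\<^sup>L (completion M) f' = integral\<^sup>L (completion M) f"
    by (rule integral_cong_AE[OF f' measurable_completion[OF f] eq'])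
  then show "integral\<^sup>L (completion M) f' = integral\<^sup>L M f" using f by (simp add: integral_completion)
  assume "integrable M f"
  then have "integrable (completion M) f" using f by (simp add: integrable_completion)
  then show "integrable (completion M) f'"
    using integrable_cong_AE[OF f' measurable_completion[OF f] eq'] by simp
qed

lemma measurable_shift: "shift v \<in> measurable field_space field_space"
  unfolding shift_def field_space_def
  by (intro measurable_PiM_single') (auto intro: measurable_component_singleton)

lemma shift_0: "shift (0::'a::monoid_add) h = h"
  by (simp add: shift_def)

lemma shift_funpow:
  fixes v :: "'a::real_vector"
  shows "(shift v ^^ k) h = shift (real k *\<^sub>R v) h"
  by (induction k) (simp_all add: shift_def algebra_simps fun_eq_iff)

lemma riem_dist_shift: "riem_dist (shift v h) x y = riem_dist h (x + v) (y + v)"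
  by (simp add: riem_dist_eq riem_edist_shift)

lemma length_pseudometric_riem_dist:
  assumes "continuous_metric h"
  shows "length_pseudometric (riem_dist h)"
proof -
  interpret continuous_metric h by fact
  show ?thesis
    by unfold_locales (use pseudometric_riem_dist riem_dist_small riem_dist_intermediate in auto)
qed

text \<open>A description without \<open>D\<close>, and therefore compatible with translations,
  which need not preserve \<open>D\<close>.\<close>

lemma (in length_pseudometric) bad_event_iff:
  assumes D: "\<And>x e. 0 < e \<Longrightarrow> \<exists>d\<in>D. dist d x < e" and L: "0 < L"
  shows "\<phi> \<in> bad_event D L t z \<longleftrightarrow> (\<exists>x\<in>ball z 1. \<exists>y. L < dist x y \<and> dist x y < 2 * L \<and> \<phi> x y < t)"
proof
  assume "\<exists>x\<in>ball z 1. \<exists>y. L < dist x y \<and> dist x y < 2 * L \<and> \<phi> x y < t"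
  then show "\<phi> \<in> bad_event D L t z" using not_bad_imp_ge[OF D L] by (meson less_imp_le not_less)
qed (auto simp: bad_event_def)

section \<open>The stationary random metric and its measurable distance\<close>

locale random_metric = prob_space M for M :: "'w measure" +
  fixes g :: "'w \<Rightarrow> real^'n \<Rightarrow> real^'n^'n" and D :: "(real^'n) set"
  assumes random: "random_riem_metric M g"
    and ergodic: "translation_ergodic M g"
    and AE_cont: "AE \<omega> in M. continuous_on UNIV (g \<omega>)"
    and int: "\<And>v. integrable M (\<lambda>\<omega>. riem_norm (g \<omega> 0) v)"
    and countable_D: "countable D"
    and dense_D: "\<And>x e. 0 < e \<Longrightarrow> \<exists>d\<in>D. dist d x < e"
begin

text \<open>Defined and measurable on all fields; at continuous metrics it is the Riemannian
  distance, and other fields occur with probability 0.\<close>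

definition poly_dist :: "(real^'n \<Rightarrow> real^'n^'n) \<Rightarrow> real^'n \<Rightarrow> real^'n \<Rightarrow> real" where
  "poly_dist h x y = enn2real (polygon_dist D h x y)"

lemma measurable_poly_dist [measurable]: "(\<lambda>h. poly_dist h x y) \<in> borel_measurable field_space"
  unfolding poly_dist_def using measurable_polygon_dist[OF countable_D, of x y] by measurable

lemma poly_dist_nonneg [simp]: "0 \<le> poly_dist h x y" by (simp add: poly_dist_def)

lemma poly_dist_self [simp]: "poly_dist h x x = 0" by (simp add: poly_dist_def)

lemma measurable_g [measurable]: "g \<in> measurable M field_space"
  using random unfolding random_riem_metric_def field_space_def
  by (intro measurable_PiM_single') auto

lemma AE_metric: "AE \<omega> in M. continuous_metric (g \<omega>)"
  using AE_cont AE_space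
proof eventually_elim
  case (elim \<omega>)
  then show ?case using random by (auto simp: random_riem_metric_def continuous_metric_def)
qed

lemma poly_dist_eq: "continuous_metric h \<Longrightarrow> poly_dist h x y = riem_dist h x y"
  unfolding poly_dist_def riem_dist_eq continuous_metric_def
  by (subst polygon_dist_eq_riem_edist[OF _ _ dense_D]) auto

lemma continuous_metric_shift:
  assumes "continuous_metric h"
  shows "continuous_metric (shift v h)"
proof -
  interpret continuous_metric h by fact
  show ?thesis unfolding shift_def
    by unfold_locales (auto intro!: continuous_intros continuous_on_compose2[OF cont] pd)
qed

lemma poly_dist_shift: "continuous_metric h \<Longrightarrow> poly_dist (shift v h) x y = poly_dist h (x + v) (y + v)"
  by (simp add: poly_dist_eq continuous_metric_shift riem_dist_shift)

lemma sets_law [simp, measurable_cong]: "sets (field_law M g) = sets field_space"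
  by (simp add: field_law_def)

lemma space_field_space [simp]: "space field_space = UNIV"
  by (simp add: field_space_def space_PiM)

lemma space_law [simp]: "space (field_law M g) = UNIV"
  by (simp add: field_law_def)

lemma prob_space_law: "prob_space (field_law M g)"
  unfolding field_law_def by (intro prob_space_distr measurable_g)

lemma law_shift: "distr (field_law M g) field_space (shift v) = field_law M g"
proof (cases "v = 0")
  case True
  then show ?thesis using distr_id2[of field_space "field_law M g"] by (simp add: shift_0[abs_def] id_def[symmetric])
next
  case False
  then show ?thesis using ergodic by (simp add: translation_ergodic_def)
qed

lemma measurable_shift_law: "shift v \<in> measurable (field_law M g) (field_law M g)"
  using measurable_shift by (simp cong: measurable_cong_sets)

lemma ergodic_preserving_shift:
  assumes "v \<noteq> 0"
  shows "ergodic_preserving (field_law M g) (shift v)"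
proof -
  interpret P: prob_space "field_law M g" by (rule prob_space_law)
  show ?thesis
  proof unfold_locales
    show "shift v \<in> measurable (field_law M g) (field_law M g)" by (rule measurable_shift_law)
    have "distr (field_law M g) (field_law M g) (shift v) = distr (field_law M g) field_space (shift v)"
      by (intro distr_cong) auto
    then show "distr (field_law M g) (field_law M g) (shift v) = field_law M g" using law_shift by simp
    fix E assume "E \<in> sets (field_law M g)" "shift v -` E \<inter> space (field_law M g) = E"
    then show "measure (field_law M g) E = 0 \<or> measure (field_law M g) E = 1"
      using ergodic assms by (simp add: translation_ergodic_def)
  qed
qed

lemma distr_shift_g: "distr M field_space (\<lambda>\<omega>. shift v (g \<omega>)) = distr M field_space g"
  using law_shift[of v] distr_distr[OF measurable_shift measurable_g, of v]
  by (simp add: field_law_def o_def)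

lemma nn_integral_stationary:
  fixes F :: "(real^'n \<Rightarrow> real^'n^'n) \<Rightarrow> ennreal"
  assumes [measurable]: "F \<in> borel_measurable field_space"
  shows "(\<integral>\<^sup>+\<omega>. F (shift v (g \<omega>)) \<partial>M) = (\<integral>\<^sup>+\<omega>. F (g \<omega>) \<partial>M)"
proof -
  note [measurable] = measurable_compose[OF measurable_g measurable_shift]
  have "(\<integral>\<^sup>+\<omega>. F (shift v (g \<omega>)) \<partial>M) = (\<integral>\<^sup>+h. F h \<partial>distr M field_space (\<lambda>\<omega>. shift v (g \<omega>)))"
    by (subst nn_integral_distr) auto
  also have "\<dots> = (\<integral>\<^sup>+\<omega>. F (g \<omega>) \<partial>M)" unfolding distr_shift_g by (subst nn_integral_distr) auto
  finally show ?thesis .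
qed

lemma integral_stationary:
  fixes F :: "(real^'n \<Rightarrow> real^'n^'n) \<Rightarrow> real"
  assumes [measurable]: "F \<in> borel_measurable field_space"
  shows "(\<integral>\<omega>. F (shift v (g \<omega>)) \<partial>M) = (\<integral>\<omega>. F (g \<omega>) \<partial>M)"
    and "integrable M (\<lambda>\<omega>. F (g \<omega>)) \<Longrightarrow> integrable M (\<lambda>\<omega>. F (shift v (g \<omega>)))"
proof -
  note [measurable] = measurable_compose[OF measurable_g measurable_shift]
  have "(\<integral>\<omega>. F (shift v (g \<omega>)) \<partial>M) = (\<integral>h. F h \<partial>distr M field_space (\<lambda>\<omega>. shift v (g \<omega>)))"
    by (subst integral_distr) auto
  also have "\<dots> = (\<integral>\<omega>. F (g \<omega>) \<partial>M)" unfolding distr_shift_g by (subst integral_distr) auto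
  finally show "(\<integral>\<omega>. F (shift v (g \<omega>)) \<partial>M) = (\<integral>\<omega>. F (g \<omega>) \<partial>M)" .
  assume "integrable M (\<lambda>\<omega>. F (g \<omega>))"
  then have "integrable (distr M field_space g) F" by (subst integrable_distr_eq) auto
  then have "integrable (distr M field_space (\<lambda>\<omega>. shift v (g \<omega>))) F" by (simp only: distr_shift_g)
  then show "integrable M (\<lambda>\<omega>. F (shift v (g \<omega>)))" by (subst (asm) integrable_distr_eq) auto
qed

section \<open>Mean distance and existence of the time constant\<close>

definition mean_norm :: "real^'n \<Rightarrow> real" where
  "mean_norm v = (\<integral>\<omega>. riem_norm (g \<omega> 0) v \<partial>M)"

definition mean_dist :: "real^'n \<Rightarrow> real" where
  "mean_dist v = (\<integral>\<omega>. poly_dist (g \<omega>) 0 v \<partial>M)"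

lemma pos_def_g: "\<omega> \<in> space M \<Longrightarrow> g \<omega> x \<in> pos_def_matrices"
  using random by (auto simp: random_riem_metric_def)

text \<open>Fatou's lemma for the Riemann sums of \<open>riem_edist_le_liminf\<close>, all of whose
  terms have the same mean by stationarity. This is also the source of integrability of the
  distance.\<close>

lemma nn_integral_poly_dist_le: "(\<integral>\<^sup>+\<omega>. ennreal (poly_dist (g \<omega>) 0 v) \<partial>M) \<le> ennreal (mean_norm v)"
proof -
  let ?S = "\<lambda>n \<omega>. ennreal ((\<Sum>j<n. riem_norm (g \<omega> ((real j / real n) *\<^sub>R v)) v) / real n)"
  have eval [measurable]: "(\<lambda>\<omega>. g \<omega> x) \<in> borel_measurable M" for x
    using random by (auto simp: random_riem_metric_def)
  have nn: "(\<integral>\<^sup>+\<omega>. ennreal (riem_norm (g \<omega> x) v) \<partial>M) = ennreal (mean_norm v)" for x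
  proof -
    have "(\<integral>\<^sup>+\<omega>. ennreal (riem_norm (shift x (g \<omega>) 0) v) \<partial>M) = (\<integral>\<^sup>+\<omega>. ennreal (riem_norm (g \<omega> 0) v) \<partial>M)"
      by (rule nn_integral_stationary[where F = "\<lambda>h. ennreal (riem_norm (h 0) v)"]) measurable
    also have "\<dots> = ennreal (mean_norm v)"
      unfolding mean_norm_def using int pos_def_g by (intro nn_integral_eq_integral AE_I2) auto
    finally show ?thesis by (simp add: shift_def)
  qed
  have mean_nonneg: "0 \<le> mean_norm v"
    unfolding mean_norm_def using pos_def_g by (intro integral_nonneg_AE AE_I2) auto
  have "(\<integral>\<^sup>+\<omega>. ennreal (poly_dist (g \<omega>) 0 v) \<partial>M) \<le> (\<integral>\<^sup>+\<omega>. liminf (\<lambda>n. ?S n \<omega>) \<partial>M)"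
  proof (rule nn_integral_mono_AE)
    show "AE \<omega> in M. ennreal (poly_dist (g \<omega>) 0 v) \<le> liminf (\<lambda>n. ?S n \<omega>)"
      using AE_metric
    proof eventually_elim
      case (elim \<omega>)
      then show ?case using continuous_metric.riem_edist_le_liminf[OF elim, of v]
        by (simp add: poly_dist_eq continuous_metric.ennreal_riem_dist)
    qed
  qed
  also have "\<dots> \<le> liminf (\<lambda>n. \<integral>\<^sup>+\<omega>. ?S n \<omega> \<partial>M)"
    by (intro nn_integral_liminf) measurable
  also have "\<dots> \<le> ennreal (mean_norm v)"
  proof (rule order_trans[OF Liminf_le_Limsup Limsup_bounded], simp, rule always_eventually, rule allI)
    fix n
    have "(\<integral>\<^sup>+\<omega>. ?S n \<omega> \<partial>M) = (\<integral>\<^sup>+\<omega>. ennreal (1 / real n) * (\<Sum>j<n. ennreal (riem_norm (g \<omega> ((real j / real n) *\<^sub>R v)) v)) \<partial>M)"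
      using pos_def_g
      by (intro nn_integral_cong) (simp add: sum_ennreal sum_nonneg ennreal_mult'[symmetric])
    also have "\<dots> = ennreal (1 / real n) * (\<Sum>j<n. ennreal (mean_norm v))"
      by (subst nn_integral_cmult) (auto simp: nn_integral_sum nn)
    \<comment> \<open>The quotient is 0 for \<open>n = 0\<close> and 1 otherwise, hence at most 1 in
      either case.\<close>
    also have "\<dots> = ennreal (real n / real n * mean_norm v)"
      using mean_nonneg by (simp add: ennreal_of_nat_eq_real_of_nat ennreal_mult'[symmetric])
    also have "\<dots> \<le> ennreal (mean_norm v)"
      using mean_nonneg by (intro ennreal_leI) (auto simp: mult_left_le_one_le)
    finally show "(\<integral>\<^sup>+\<omega>. ?S n \<omega> \<partial>M) \<le> ennreal (mean_norm v)" .
  qed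
  finally show ?thesis .
qed

lemma measurable_poly_dist_g [measurable]: "(\<lambda>\<omega>. poly_dist (g \<omega>) x y) \<in> borel_measurable M"
  by (rule measurable_compose[OF measurable_g measurable_poly_dist])

lemma integrable_poly_dist: "integrable M (\<lambda>\<omega>. poly_dist (g \<omega>) 0 v)"
  using nn_integral_poly_dist_le[of v] by (intro integrableI_nonneg) (auto intro: le_less_trans)

lemma mean_dist_nonneg: "0 \<le> mean_dist v"
  unfolding mean_dist_def by (intro integral_nonneg_AE) simp

lemma mean_dist_le_mean_norm: "mean_dist v \<le> mean_norm v"
proof -
  have "ennreal (mean_dist v) \<le> ennreal (mean_norm v)"
    using nn_integral_poly_dist_le[of v] unfolding mean_dist_def
    by (subst (asm) nn_integral_eq_integral[OF integrable_poly_dist]) auto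
  moreover have "0 \<le> mean_norm v"
    unfolding mean_norm_def using pos_def_g by (intro integral_nonneg_AE AE_I2) auto
  ultimately show ?thesis by (simp add: ennreal_le_iff)
qed

text \<open>Expanding \<open>v\<close> in the standard basis bounds each random norm by its values
  at the basis vectors, which are integrable.\<close>

lemma mean_norm_le: "\<exists>C. \<forall>v. mean_norm v \<le> C * norm v"
proof (intro exI allI)
  fix v
  have "riem_norm A v \<le> norm v * (\<Sum>i\<in>UNIV. riem_norm A (axis i 1))" if A: "A \<in> pos_def_matrices" for A :: "real^'n^'n"
  proof -
    have sum_le: "riem_norm A (\<Sum>i\<in>I. f i) \<le> (\<Sum>i\<in>I. riem_norm A (f i))" if "finite I" for I :: "'n set" and f
      using that
    proof (induction I rule: finite_induct)
      case (insert i I)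
      then show ?case using riem_norm_triangle[OF A, of "f i" "sum f I"] by simp
    qed simp
    have "v = (\<Sum>i\<in>UNIV. v $ i *\<^sub>R axis i 1)"
      using basis_expansion[of v] by (simp add: scalar_mult_eq_scaleR)
    then have "riem_norm A v \<le> (\<Sum>i\<in>UNIV. riem_norm A (v $ i *\<^sub>R axis i 1))"
      using sum_le[of UNIV "\<lambda>i. v $ i *\<^sub>R axis i 1"] by simp
    also have "\<dots> \<le> (\<Sum>i\<in>UNIV. norm v * riem_norm A (axis i 1))"
      using A component_le_norm_cart[of v] by (intro sum_mono) (auto simp: riem_norm_scaleR intro!: mult_right_mono)
    finally show ?thesis by (simp add: sum_distrib_left)
  qed
  then have "mean_norm v \<le> (\<integral>\<omega>. norm v * (\<Sum>i\<in>UNIV. riem_norm (g \<omega> 0) (axis i 1)) \<partial>M)"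
    unfolding mean_norm_def using int pos_def_g by (intro integral_mono) auto
  also have "\<dots> = (\<Sum>i\<in>UNIV. mean_norm (axis i 1)) * norm v"
    using int by (simp add: mean_norm_def mult.commute)
  finally show "mean_norm v \<le> (\<Sum>i\<in>UNIV. mean_norm (axis i 1)) * norm v" .
qed

text \<open>The leg from \<open>v\<close> to \<open>v + w\<close> is the leg from 0 to
  \<open>w\<close> in the metric translated by \<open>v\<close>, which has the same law.\<close>

lemma mean_dist_triangle: "mean_dist (v + w) \<le> mean_dist v + mean_dist w"
proof -
  have int_shift: "integrable M (\<lambda>\<omega>. poly_dist (shift v (g \<omega>)) 0 w)"
    by (rule integral_stationary(2)[OF measurable_poly_dist integrable_poly_dist])
  have "mean_dist (v + w) \<le> (\<integral>\<omega>. poly_dist (g \<omega>) 0 v + poly_dist (shift v (g \<omega>)) 0 w \<partial>M)"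
    unfolding mean_dist_def
  proof (rule integral_mono_AE)
    show "AE \<omega> in M. poly_dist (g \<omega>) 0 (v + w) \<le> poly_dist (g \<omega>) 0 v + poly_dist (shift v (g \<omega>)) 0 w"
      using AE_metric
    proof eventually_elim
      case (elim \<omega>)
      then show ?case
        using continuous_metric.pseudometric_riem_dist[OF elim]
        by (simp add: poly_dist_shift poly_dist_eq pseudometric_def add.commute[of w])
    qed
  qed (use integrable_poly_dist int_shift in auto)
  also have "\<dots> = mean_dist v + mean_dist w"
    using integral_stationary(1)[where F = "\<lambda>h. poly_dist h 0 w" and v = v, OF measurable_poly_dist] integrable_poly_dist int_shift by (simp add: mean_dist_def)
  finally show ?thesis .
qed

text \<open>Translation by \<open>- v\<close> turns the pair \<open>0\<close>, \<open>v\<close> into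
  \<open>- v\<close>, \<open>0\<close>; symmetry of the distance and stationarity do the
  rest.\<close>

lemma mean_dist_minus: "mean_dist (- v) = mean_dist v"
proof -
  have "mean_dist (- v) = (\<integral>\<omega>. poly_dist (shift (- v) (g \<omega>)) 0 v \<partial>M)"
    unfolding mean_dist_def
  proof (rule integral_cong_AE)
    show "AE \<omega> in M. poly_dist (g \<omega>) 0 (- v) = poly_dist (shift (- v) (g \<omega>)) 0 v"
      using AE_metric
    proof eventually_elim
      case (elim \<omega>)
      then show ?case
        using continuous_metric.pseudometric_riem_dist[OF elim]
        by (simp add: poly_dist_shift poly_dist_eq pseudometric_def)
    qed
  qed (auto intro: measurable_compose[OF measurable_g] measurable_compose[OF measurable_shift measurable_poly_dist])
  also have "\<dots> = mean_dist v" unfolding mean_dist_def by (rule integral_stationary(1)) measurable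
  finally show ?thesis .
qed

text \<open>The shift acts on fields, not on the sample space, so the ergodic theorem is applied to
  the law of \<open>g\<close> and its conclusions are pulled back. Powers of the shift by
  \<open>v\<close> are shifts by nonzero multiples of \<open>v\<close>, again ergodic.\<close>

lemma ergodic_limit:
  assumes v: "v \<noteq> 0"
  obtains \<gamma> where "AE \<omega> in M. (\<lambda>n. riem_dist (g \<omega>) 0 (real n *\<^sub>R v) / real n) \<longlonglongrightarrow> \<gamma>"
    and "(\<lambda>n. mean_dist (real n *\<^sub>R v) / real n) \<longlonglongrightarrow> \<gamma>"
    and "(\<lambda>n. \<integral>\<omega>. \<bar>riem_dist (g \<omega>) 0 (real n *\<^sub>R v) / real n - \<gamma>\<bar> \<partial>completion M) \<longlonglongrightarrow> 0"
proof -
  let ?P = "field_law M g" and ?f = "\<lambda>n h. poly_dist h 0 (real n *\<^sub>R v)"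
  have [measurable]: "?f n \<in> borel_measurable ?P" for n by measurable
  have e1: "ergodic_preserving ?P (shift v)" using v by (rule ergodic_preserving_shift)
  interpret e: measure_preserving ?P "shift v"
    using e1 by (simp add: ergodic_preserving_def)
  have funpow: "shift v ^^ k = shift (real k *\<^sub>R v)" for k
    by (simp add: fun_eq_iff shift_funpow)
  have law_integral: "(\<integral>h. F h \<partial>?P) = (\<integral>\<omega>. F (g \<omega>) \<partial>M)" if "F \<in> borel_measurable field_space" for F :: "_ \<Rightarrow> real"
    unfolding field_law_def using that by (intro integral_distr measurable_g)
  obtain \<gamma> where \<gamma>: "AE h in ?P. (\<lambda>n. ?f n h / real n) \<longlonglongrightarrow> \<gamma>"
    "(\<lambda>n. (\<integral>h. ?f n h \<partial>?P) / real n) \<longlonglongrightarrow> \<gamma>"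
    "(\<lambda>n. \<integral>h. \<bar>?f n h / real n - \<gamma>\<bar> \<partial>?P) \<longlonglongrightarrow> 0"
  proof (rule e.subadditive_ergodic[of ?f])
    fix k :: nat assume "1 \<le> k"
    then show "ergodic_preserving ?P (shift v ^^ k)"
      unfolding funpow using v by (intro ergodic_preserving_shift) auto
  next
    fix n show "integrable ?P (?f n)"
      unfolding field_law_def using integrable_poly_dist by (subst integrable_distr_eq) auto
  next
    fix m n
    \<comment> \<open>An almost sure property of \<open>g\<close> passes to its law through a
      measurable set; this is where \<open>poly_dist\<close> must stand in for
      \<open>riem_dist\<close>.\<close>
    have meas: "{h \<in> space field_space. ?f (m + n) h \<le> ?f m h + ?f n ((shift v ^^ m) h)} \<in> sets field_space"
      unfolding funpow using measurable_compose[OF measurable_shift measurable_poly_dist] by measurable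
    have "AE \<omega> in M. ?f (m + n) (g \<omega>) \<le> ?f m (g \<omega>) + ?f n ((shift v ^^ m) (g \<omega>))"
      using AE_metric
    proof eventually_elim
      case (elim \<omega>)
      have "0 + real m *\<^sub>R v = real m *\<^sub>R v" "real n *\<^sub>R v + real m *\<^sub>R v = real (m + n) *\<^sub>R v"
        by (simp_all add: scaleR_add_left)
      then have "?f n ((shift v ^^ m) (g \<omega>)) = riem_dist (g \<omega>) (real m *\<^sub>R v) (real (m + n) *\<^sub>R v)"
        unfolding funpow by (simp only: poly_dist_shift[OF elim] poly_dist_eq[OF elim])
      then show ?case
        using continuous_metric.pseudometric_riem_dist[OF elim] poly_dist_eq[OF elim]
        unfolding pseudometric_def by metis
    qed
    then show "AE h in ?P. ?f (m + n) h \<le> ?f m h + ?f n ((shift v ^^ m) h)"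
      unfolding field_law_def by (subst AE_distr_iff[OF measurable_g meas])
  qed simp_all
  show ?thesis
  proof (rule that[of \<gamma>])
    have "AE \<omega> in M. (\<lambda>n. ?f n (g \<omega>) / real n) \<longlonglongrightarrow> \<gamma>"
      using \<gamma>(1) unfolding field_law_def by (rule AE_distrD[OF measurable_g])
    then show "AE \<omega> in M. (\<lambda>n. riem_dist (g \<omega>) 0 (real n *\<^sub>R v) / real n) \<longlonglongrightarrow> \<gamma>"
      using AE_metric by eventually_elim (simp add: poly_dist_eq)
    show "(\<lambda>n. mean_dist (real n *\<^sub>R v) / real n) \<longlonglongrightarrow> \<gamma>"
      using \<gamma>(2) by (simp add: law_integral mean_dist_def)
    have "(\<integral>\<omega>. \<bar>riem_dist (g \<omega>) 0 (real n *\<^sub>R v) / real n - \<gamma>\<bar> \<partial>completion M) = (\<integral>h. \<bar>?f n h / real n - \<gamma>\<bar> \<partial>?P)" for n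
    proof -
      have "(\<integral>\<omega>. \<bar>riem_dist (g \<omega>) 0 (real n *\<^sub>R v) / real n - \<gamma>\<bar> \<partial>completion M) = (\<integral>\<omega>. \<bar>?f n (g \<omega>) / real n - \<gamma>\<bar> \<partial>M)"
      proof (rule completion_AE_integral(1))
        show "AE \<omega> in M. \<bar>riem_dist (g \<omega>) 0 (real n *\<^sub>R v) / real n - \<gamma>\<bar> = \<bar>?f n (g \<omega>) / real n - \<gamma>\<bar>"
          using AE_metric by eventually_elim (simp add: poly_dist_eq)
      qed measurable
      also have "\<dots> = (\<integral>h. \<bar>?f n h / real n - \<gamma>\<bar> \<partial>?P)" by (rule law_integral[symmetric]) measurable
      finally show ?thesis .
    qed
    then show "(\<lambda>n. \<integral>\<omega>. \<bar>riem_dist (g \<omega>) 0 (real n *\<^sub>R v) / real n - \<gamma>\<bar> \<partial>completion M) \<longlonglongrightarrow> 0"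
      using \<gamma>(3) by simp
  qed
qed

lemma integrable_riem_dist: "integrable (completion M) (\<lambda>\<omega>. riem_dist (g \<omega>) 0 v)"
proof (rule completion_AE_integral(2)[OF _ _ integrable_poly_dist])
  show "AE \<omega> in M. riem_dist (g \<omega>) 0 v = poly_dist (g \<omega>) 0 v"
    using AE_metric by eventually_elim (simp add: poly_dist_eq)
qed measurable

lemma ex_time_constant:
  "\<exists>\<mu>. time_constant M (\<lambda>\<omega>. riem_dist (g \<omega>)) \<mu> \<and> (\<forall>v. (\<lambda>n. mean_dist (real n *\<^sub>R v) / real n) \<longlonglongrightarrow> \<mu> v)"
proof -
  have "\<forall>v. \<exists>\<gamma>. (AE \<omega> in M. (\<lambda>n. riem_dist (g \<omega>) 0 (real n *\<^sub>R v) / real n) \<longlonglongrightarrow> \<gamma>)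
    \<and> (\<lambda>n. mean_dist (real n *\<^sub>R v) / real n) \<longlonglongrightarrow> \<gamma>
    \<and> (\<lambda>n. \<integral>\<omega>. \<bar>riem_dist (g \<omega>) 0 (real n *\<^sub>R v) / real n - \<gamma>\<bar> \<partial>completion M) \<longlonglongrightarrow> 0"
  proof
    fix v
    show "\<exists>\<gamma>. (AE \<omega> in M. (\<lambda>n. riem_dist (g \<omega>) 0 (real n *\<^sub>R v) / real n) \<longlonglongrightarrow> \<gamma>)
    \<and> (\<lambda>n. mean_dist (real n *\<^sub>R v) / real n) \<longlonglongrightarrow> \<gamma>
    \<and> (\<lambda>n. \<integral>\<omega>. \<bar>riem_dist (g \<omega>) 0 (real n *\<^sub>R v) / real n - \<gamma>\<bar> \<partial>completion M) \<longlonglongrightarrow> 0"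
    \<comment> \<open>Ergodicity concerns nonzero translations; for \<open>v = 0\<close> all
      distances in question vanish.\<close>
    proof (cases "v = 0")
      case True
      then show ?thesis by (intro exI[of _ 0]) (simp add: riem_dist_eq mean_dist_def)
    next
      case False
      show ?thesis by (rule ergodic_limit[OF False]) blast
    qed
  qed
  then obtain \<mu> where "\<forall>v. (AE \<omega> in M. (\<lambda>n. riem_dist (g \<omega>) 0 (real n *\<^sub>R v) / real n) \<longlonglongrightarrow> \<mu> v)
    \<and> (\<lambda>n. mean_dist (real n *\<^sub>R v) / real n) \<longlonglongrightarrow> \<mu> v
    \<and> (\<lambda>n. \<integral>\<omega>. \<bar>riem_dist (g \<omega>) 0 (real n *\<^sub>R v) / real n - \<mu> v\<bar> \<partial>completion M) \<longlonglongrightarrow> 0"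
    by (rule choice[THEN exE])
  then show ?thesis
    unfolding time_constant_def using integrable_riem_dist by (intro exI[of _ \<mu>]) blast
qed

end

text \<open>A supremum of reals bounds its members only when the set is bounded above; here every
  member is at most 1, being the distance between two numbers of the unit interval.\<close>

lemma (in prob_space) Ind_minus_upper:
  fixes T :: "'a \<Rightarrow> 'b::metric_space \<Rightarrow> 'b \<Rightarrow> real"
  assumes "bounded A" "bounded B" "diameter A \<le> S" "diameter B \<le> S" "Q < setdist A B"
    and "EA \<in> decreasing_events A" "EB \<in> decreasing_events B"
  shows "\<bar>prob_in M T (EA \<inter> EB) - prob_in M T EA * prob_in M T EB\<bar> \<le> Ind_minus M T Q S"
proof -
  interpret C: prob_space "completion M" by (rule prob_space_completion)
  have P: "0 \<le> prob_in M T E" "prob_in M T E \<le> 1" for E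
    by (auto simp: prob_in_def)
  have "\<bar>prob_in M T E - prob_in M T F * prob_in M T G\<bar> \<le> 1" for E F G
    using P[of E] mult_le_one[OF P(2)[of F] P(1)[of G] P(2)[of G]] mult_nonneg_nonneg[OF P(1)[of F] P(1)[of G]]
    by (auto simp: abs_if)
  then have "bdd_above {\<bar>prob_in M T (EA \<inter> EB) - prob_in M T EA * prob_in M T EB\<bar> | A B EA EB.
     bounded A \<and> bounded B \<and> diameter A \<le> S \<and> diameter B \<le> S \<and> setdist A B > Q \<and>
     EA \<in> decreasing_events A \<and> EB \<in> decreasing_events B}"
    by (intro bdd_aboveI[of _ 1]) auto
  then show ?thesis
    unfolding Ind_minus_def using assms by (intro cSup_upper) blast+
qed

section \<open>Probabilities of fast crossings\<close>

context random_metric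
begin

text \<open>Badness of the distance as an event on the field, with \<open>poly_dist\<close> for the
  sake of measurability.\<close>

definition bad_field :: "real \<Rightarrow> real \<Rightarrow> real^'n \<Rightarrow> (real^'n \<Rightarrow> real^'n^'n) set" where
  "bad_field L t z = {h. \<exists>x\<in>D \<inter> ball z 1. \<exists>y\<in>D. L < dist x y \<and> dist x y < 2 * L \<and> poly_dist h x y < t}"

definition bad_prob :: "real \<Rightarrow> real \<Rightarrow> real" where
  "bad_prob L t = measure M {\<omega> \<in> space M. g \<omega> \<in> bad_field L t 0}"

lemma sets_bad_field [measurable]: "bad_field L t z \<in> sets field_space"
proof -
  have "{h \<in> space field_space. poly_dist h x y < t} \<in> sets field_space" for x y
    by measurable
  then have *: "{h. poly_dist h x y < t} \<in> sets field_space" for x y by simp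
  have "(\<Union>y\<in>{y\<in>D. L < dist x y \<and> dist x y < 2 * L}. {h. poly_dist h x y < t}) \<in> sets field_space" for x
    using * countable_D by (intro sets.countable_UN' countable_Collect) auto
  then have "(\<Union>x\<in>D \<inter> ball z 1. \<Union>y\<in>{y\<in>D. L < dist x y \<and> dist x y < 2 * L}. {h. poly_dist h x y < t}) \<in> sets field_space"
    using countable_D by (intro sets.countable_UN' countable_Int1) blast+
  also have "(\<Union>x\<in>D \<inter> ball z 1. \<Union>y\<in>{y\<in>D. L < dist x y \<and> dist x y < 2 * L}. {h. poly_dist h x y < t}) = bad_field L t z"
    by (auto simp: bad_field_def)
  finally show ?thesis .
qed

lemma bad_field_iff:
  assumes "continuous_metric h"
  shows "h \<in> bad_field L t z \<longleftrightarrow> riem_dist h \<in> bad_event D L t z"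
  using continuous_metric.pseudometric_riem_dist[OF assms]
  by (auto simp: bad_field_def bad_event_def poly_dist_eq[OF assms])

text \<open>Translated pairs leave \<open>D\<close>, so the argument passes through badness tested
  on all pairs.\<close>

lemma bad_field_shift:
  assumes h: "continuous_metric h" and L: "0 < L"
  shows "shift z h \<in> bad_field L t 0 \<longleftrightarrow> h \<in> bad_field L t z"
proof -
  note h' = continuous_metric_shift[OF h, of z]
  have "(\<exists>x\<in>ball 0 1. \<exists>y. L < dist x y \<and> dist x y < 2 * L \<and> riem_dist h (x + z) (y + z) < t)
    \<longleftrightarrow> (\<exists>x\<in>ball z 1. \<exists>y. L < dist x y \<and> dist x y < 2 * L \<and> riem_dist h x y < t)" (is "?l \<longleftrightarrow> ?r")
  proof
    assume ?l
    then obtain x y where xy: "x \<in> ball 0 1" "L < dist x y" "dist x y < 2 * L" "riem_dist h (x + z) (y + z) < t"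
      by blast
    then show ?r by (intro bexI[of _ "x + z"] exI[of _ "y + z"]) (auto simp: dist_norm)
  next
    assume ?r
    then obtain x y where xy: "x \<in> ball z 1" "L < dist x y" "dist x y < 2 * L" "riem_dist h x y < t"
      by blast
    then show ?l by (intro bexI[of _ "x - z"] exI[of _ "y - z"]) (auto simp: dist_norm norm_minus_commute)
  qed
  moreover have "shift z h \<in> bad_field L t 0 \<longleftrightarrow> (\<exists>x\<in>ball 0 1. \<exists>y. L < dist x y \<and> dist x y < 2 * L \<and> riem_dist (shift z h) x y < t)"
    unfolding bad_field_iff[OF h']
    by (rule length_pseudometric.bad_event_iff[OF length_pseudometric_riem_dist[OF h'] dense_D L])
  moreover have "h \<in> bad_field L t z \<longleftrightarrow> (\<exists>x\<in>ball z 1. \<exists>y. L < dist x y \<and> dist x y < 2 * L \<and> riem_dist h x y < t)"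
    unfolding bad_field_iff[OF h]
    by (rule length_pseudometric.bad_event_iff[OF length_pseudometric_riem_dist[OF h] dense_D L])
  ultimately show ?thesis by (simp only: riem_dist_shift)
qed

lemma measure_bad_field:
  assumes L: "0 < L"
  shows "measure M {\<omega> \<in> space M. g \<omega> \<in> bad_field L t z} = bad_prob L t"
proof -
  have shift_g: "(\<lambda>\<omega>. shift z (g \<omega>)) \<in> measurable M field_space"
    by (rule measurable_compose[OF measurable_g measurable_shift])
  have "measure M {\<omega> \<in> space M. g \<omega> \<in> bad_field L t z} = measure M {\<omega> \<in> space M. shift z (g \<omega>) \<in> bad_field L t 0}"
  proof (rule measure_eq_AE)
    show "AE \<omega> in M. \<omega> \<in> {\<omega> \<in> space M. g \<omega> \<in> bad_field L t z} \<longleftrightarrow> \<omega> \<in> {\<omega> \<in> space M. shift z (g \<omega>) \<in> bad_field L t 0}"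
      using AE_metric by eventually_elim (auto simp: bad_field_shift L)
    show "{\<omega> \<in> space M. shift z (g \<omega>) \<in> bad_field L t 0} \<in> sets M"
      using shift_g by measurable
  qed measurable
  also have "\<dots> = measure (distr M field_space (\<lambda>\<omega>. shift z (g \<omega>))) (bad_field L t 0)"
    using shift_g by (subst measure_distr) (auto simp: vimage_def Int_def conj_commute)
  also have "\<dots> = bad_prob L t"
    unfolding distr_shift_g bad_prob_def by (subst measure_distr) (auto simp: vimage_def Int_def conj_commute)
  finally show ?thesis .
qed

abbreviation T :: "'w \<Rightarrow> real^'n \<Rightarrow> real^'n \<Rightarrow> real" where
  "T \<omega> \<equiv> riem_dist (g \<omega>)"

lemma bad_event_completion:
  assumes L: "0 < L"
  shows "{\<omega> \<in> space M. T \<omega> \<in> bad_event D L t z} \<in> sets (completion M)"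
    and "prob_in M T (bad_event D L t z) = bad_prob L t"
proof -
  have eq: "AE \<omega> in M. \<omega> \<in> {\<omega> \<in> space M. T \<omega> \<in> bad_event D L t z} \<longleftrightarrow> \<omega> \<in> {\<omega> \<in> space M. g \<omega> \<in> bad_field L t z}"
    using AE_metric by eventually_elim (auto simp: bad_field_iff)
  have meas: "{\<omega> \<in> space M. g \<omega> \<in> bad_field L t z} \<in> sets M" by measurable
  show "{\<omega> \<in> space M. T \<omega> \<in> bad_event D L t z} \<in> sets (completion M)"
    by (rule completion_AE_eq(1)[OF meas _ eq]) auto
  show "prob_in M T (bad_event D L t z) = bad_prob L t"
    unfolding prob_in_def measure_bad_field[OF L, of t z, symmetric]
    by (rule completion_AE_eq(2)[OF meas _ eq]) auto
qed

lemma bad_prob_mono: "t \<le> t' \<Longrightarrow> bad_prob L t \<le> bad_prob L t'"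
proof -
  assume "t \<le> t'"
  then have "bad_field L t 0 \<subseteq> bad_field L t' 0" by (fastforce simp: bad_field_def)
  moreover have "{\<omega> \<in> space M. g \<omega> \<in> bad_field L t' 0} \<in> sets M" by measurable
  ultimately show ?thesis unfolding bad_prob_def by (intro finite_measure_mono) auto
qed

text \<open>Continuity from above as \<open>t\<close> decreases to 0: each continuous metric has a
  positive lower bound on its crossings from the unit ball, so almost no sample is bad for all
  \<open>t\<close>.\<close>

lemma bad_prob_small:
  assumes L: "0 < L" and e: "0 < e"
  shows "\<exists>t>0. bad_prob L t < e"
proof -
  define A where "A k = {\<omega> \<in> space M. g \<omega> \<in> bad_field L (1 / real (Suc k)) 0}" for k
  have [measurable]: "A k \<in> sets M" for k unfolding A_def by measurable
  have "(\<lambda>k. measure M (A k)) \<longlonglongrightarrow> measure M (\<Inter>k. A k)"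
  proof (rule finite_Lim_measure_decseq)
    show "decseq A"
    proof (rule decseq_SucI)
      fix k
      have "1 / real (Suc (Suc k)) \<le> 1 / real (Suc k)" by (simp add: field_simps)
      then show "A (Suc k) \<le> A k" unfolding A_def bad_field_def by (auto intro: less_le_trans)
    qed
  qed auto
  moreover have "measure M (\<Inter>k. A k) = 0"
  proof -
    have "AE \<omega> in M. \<omega> \<notin> (\<Inter>k. A k)"
      using AE_metric
    proof eventually_elim
      case (elim \<omega>)
      obtain c where c: "c > 0" "\<And>x y. x \<in> ball 0 1 \<Longrightarrow> L \<le> dist x y \<Longrightarrow> c \<le> riem_dist (g \<omega>) x y"
        using continuous_metric.riem_dist_crossing_pos[OF elim L, of 0 1] by blast
      obtain k where k: "inverse (real (Suc k)) < c" using reals_Archimedean[OF c(1)] by blast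
      have "\<omega> \<notin> A k"
      proof
        assume "\<omega> \<in> A k"
        then obtain x y where "x \<in> ball 0 1" "L < dist x y" "riem_dist (g \<omega>) x y < 1 / real (Suc k)"
          by (auto simp: A_def bad_field_def poly_dist_eq[OF elim])
        then show False using c(2)[of x y] k by (simp add: inverse_eq_divide)
      qed
      then show ?case by blast
    qed
    moreover have "(\<Inter>k. A k) \<in> sets M" by measurable
    ultimately show ?thesis by (simp add: prob_eq_0)
  qed
  ultimately have "eventually (\<lambda>k. measure M (A k) < e) sequentially"
    using e by (intro order_tendstoD) auto
  then obtain k where "measure M (A k) < e" by (auto simp: eventually_sequentially)
  then show ?thesis unfolding A_def bad_prob_def by (intro exI[of _ "1 / real (Suc k)"]) auto
qed

text \<open>Union bound over pairs of centres of the cover, whose number is at most the square of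
  its cardinality. Quasi independence at distance \<open>L\<close> and diameter \<open>L ^ 2\<close>
  bounds each pair by \<open>q\<close>, and stationarity makes both marginals equal to
  \<open>bad_prob L t\<close>.\<close>

lemma bad_prob_step:
  assumes ind: "Ind_minus M T L (L powr 2) \<le> exp (- (L powr \<beta>))"
    and L: "5 \<le> L" and t: "0 \<le> t" and n: "(real n + 12) * L \<le> L'" and t': "t' \<le> real n * t"
  shows "bad_prob L' t' \<le> (((2 * real CARD('n) + 3) * 4 * L') ^ CARD('n))\<^sup>2 * ((bad_prob L t)\<^sup>2 + exp (- (L powr \<beta>)))"
proof -
  interpret C: prob_space "completion M" by (rule prob_space_completion)
  have nL: "0 \<le> real n * L" using L by simp
  have L': "60 \<le> L'" using n nL L unfolding distrib_right by linarith
  obtain \<Lambda> where \<Lambda>: "finite \<Lambda>" "ball (0::real^'n) (1 + 3 * L') \<subseteq> (\<Union>z\<in>\<Lambda>. ball z 1)"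
    "real (card \<Lambda>) \<le> ((2 * real CARD('n) + 3) * (1 + 3 * L')) ^ CARD('n)"
    using unit_ball_cover[of "1 + 3 * L'" "0::real^'n"] L' by auto
  define q where "q = (bad_prob L t)\<^sup>2 + exp (- (L powr \<beta>))"
  have q0: "0 \<le> q" by (simp add: q_def)
  define I where "I = {(z, z'). z \<in> \<Lambda> \<and> z' \<in> \<Lambda> \<and> 2 + 5 * L < dist z z'}"
  have I: "I \<subseteq> \<Lambda> \<times> \<Lambda>" "finite I"
    using \<Lambda>(1) by (auto simp: I_def intro: finite_subset[of _ "\<Lambda> \<times> \<Lambda>"])
  let ?B = "\<lambda>z. bad_event D L t z"
  let ?F = "\<lambda>(z, z'). {\<omega> \<in> space M. T \<omega> \<in> ?B z \<inter> ?B z'}"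
  have F_sets: "?F i \<in> sets (completion M)" for i
  proof (cases i)
    case (Pair z z')
    have "{\<omega> \<in> space M. T \<omega> \<in> ?B z} \<inter> {\<omega> \<in> space M. T \<omega> \<in> ?B z'} \<in> sets (completion M)"
      using L by (intro sets.Int bad_event_completion(1)) auto
    moreover have "{\<omega> \<in> space M. T \<omega> \<in> ?B z} \<inter> {\<omega> \<in> space M. T \<omega> \<in> ?B z'} = ?F i" using Pair by auto
    ultimately show ?thesis by simp
  qed
  have F_le: "measure (completion M) (?F i) \<le> q" if "i \<in> I" for i
  proof (cases i)
    case (Pair z z')
    have far: "2 + 5 * L < dist z z'" using that Pair by (auto simp: I_def)
    have "\<bar>prob_in M T (?B z \<inter> ?B z') - prob_in M T (?B z) * prob_in M T (?B z')\<bar> \<le> Ind_minus M T L (L powr 2)"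
    proof (rule Ind_minus_upper)
      \<comment> \<open>The hypothesis \<open>L \<ge> 5\<close> serves to fit the diameter
        \<open>2 + 4 * L\<close> of the two balls below \<open>L ^ 2\<close>.\<close>
      have "5 * L \<le> L * L" using L by (intro mult_right_mono) auto
      moreover have "2 * (1 + 2 * L) \<le> 5 * L" using L by simp
      ultimately have "2 * (1 + 2 * L) \<le> L * L" by (rule order_trans[rotated])
      then have diam: "2 * (1 + 2 * L) \<le> L powr 2" using L by (simp only: powr_numeral power2_eq_square)
      show "diameter (ball z (1 + 2 * L)) \<le> L powr 2" "diameter (ball z' (1 + 2 * L)) \<le> L powr 2"
        using diam L by auto
      \<comment> \<open>Subtracting both radii from the separation \<open>2 + 5 * L\<close> leaves
        exactly \<open>L\<close>.\<close>
      have "dist z z' - 2 * (1 + 2 * L) \<le> setdist (ball z (1 + 2 * L)) (ball z' (1 + 2 * L))"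
      proof (rule le_setdistI)
        fix x y assume "x \<in> ball z (1 + 2 * L)" "y \<in> ball z' (1 + 2 * L)"
        then show "dist z z' - 2 * (1 + 2 * L) \<le> dist x y"
          using dist_triangle[of z z' x] dist_triangle[of x z' y] by (simp add: dist_commute)
      qed (use L in auto)
      moreover have "L < dist z z' - 2 * (1 + 2 * L)" using far by (simp add: algebra_simps)
      ultimately show "L < setdist (ball z (1 + 2 * L)) (ball z' (1 + 2 * L))" by (rule less_le_trans[rotated])
    qed (auto intro: bad_event_decreasing countable_D)
    then have "prob_in M T (?B z \<inter> ?B z') \<le> q"
      using ind L unfolding q_def by (simp add: bad_event_completion(2) power2_eq_square)
    then show ?thesis using Pair by (simp add: prob_in_def)
  qed
  have "bad_prob L' t' = measure (completion M) {\<omega> \<in> space M. T \<omega> \<in> bad_event D L' t' 0}"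
    using bad_event_completion(2)[of L' t' 0] L' by (simp add: prob_in_def)
  also have "\<dots> \<le> measure (completion M) (\<Union>i\<in>I. ?F i)"
  proof (rule C.finite_measure_mono_AE)
    show "(\<Union>i\<in>I. ?F i) \<in> sets (completion M)" using I(2) F_sets by (intro sets.finite_UN) auto
    have "AE \<omega> in M. \<omega> \<in> {\<omega> \<in> space M. T \<omega> \<in> bad_event D L' t' 0} \<longrightarrow> \<omega> \<in> (\<Union>i\<in>I. ?F i)"
      using AE_metric
    proof eventually_elim
      case (elim \<omega>)
      interpret l: length_pseudometric "T \<omega>" by (rule length_pseudometric_riem_dist[OF elim])
      show ?case
      proof (rule impI, rule ccontr)
        assume *: "\<omega> \<in> {\<omega> \<in> space M. T \<omega> \<in> bad_event D L' t' 0}" "\<omega> \<notin> (\<Union>i\<in>I. ?F i)"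
        have "T \<omega> \<notin> bad_event D L' t' 0"
        proof (rule l.not_bad_next_scale[OF dense_D _ t \<Lambda>(2) _ n t'])
          fix z z' assume "z \<in> \<Lambda>" "z' \<in> \<Lambda>" "2 + 5 * L < dist z z'"
          then have "(z, z') \<in> I" by (simp add: I_def)
          then show "\<not> (T \<omega> \<in> ?B z \<and> T \<omega> \<in> ?B z')" using * by auto
        qed (use L in auto)
        then show False using * by simp
      qed
    qed
    then show "AE \<omega> in completion M. \<omega> \<in> {\<omega> \<in> space M. T \<omega> \<in> bad_event D L' t' 0} \<longrightarrow> \<omega> \<in> (\<Union>i\<in>I. ?F i)"
      by (rule AE_completion)
  qed
  also have "\<dots> \<le> (\<Sum>i\<in>I. measure (completion M) (?F i))"
    by (intro measure_UNION_le I(2) F_sets)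
  also have "\<dots> \<le> real (card I) * q"
    using sum_bounded_above[of I "\<lambda>i. measure (completion M) (?F i)" q] F_le by simp
  also have "\<dots> \<le> (((2 * real CARD('n) + 3) * 4 * L') ^ CARD('n))\<^sup>2 * q"
  proof (rule mult_right_mono[OF _ q0])
    have "card I \<le> card \<Lambda> * card \<Lambda>"
      using card_mono[OF _ I(1)] \<Lambda>(1) by (simp add: card_cartesian_product)
    then have "real (card I) \<le> (real (card \<Lambda>))\<^sup>2"
      by (metis of_nat_le_iff of_nat_mult power2_eq_square)
    also have "\<dots> \<le> (((2 * real CARD('n) + 3) * 4 * L') ^ CARD('n))\<^sup>2"
    proof (rule power_mono)
      have "((2 * real CARD('n) + 3) * (1 + 3 * L')) ^ CARD('n) \<le> ((2 * real CARD('n) + 3) * (4 * L')) ^ CARD('n)"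
        using L' by (intro power_mono mult_left_mono) auto
      then show "real (card \<Lambda>) \<le> ((2 * real CARD('n) + 3) * 4 * L') ^ CARD('n)"
        using \<Lambda>(3) unfolding mult.assoc by (rule order_trans[rotated])
    qed simp
    finally show "real (card I) \<le> (((2 * real CARD('n) + 3) * 4 * L') ^ CARD('n))\<^sup>2" .
  qed
  finally show ?thesis unfolding q_def .
qed

text \<open>Markov's inequality: off the bad event, whose probability is at most 1/2, the points 0
  and \<open>v\<close> are at distance at least \<open>t\<close>.\<close>

lemma mean_dist_ge:
  assumes L: "0 < L" and t: "0 \<le> t" and small: "bad_prob L t \<le> 1 / 2" and v: "L < norm v" "norm v < 2 * L"
  shows "t / 2 \<le> mean_dist v"
proof -
  define A where "A = {\<omega> \<in> space M. g \<omega> \<in> bad_field L t 0}"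
  have [measurable]: "A \<in> sets M" unfolding A_def by measurable
  have int_ind: "integrable M (\<lambda>\<omega>. indicator (space M - A) \<omega> :: real)"
    by (rule integrable_const_bound[of _ 1]) (auto simp: indicator_def)
  have "t / 2 \<le> t * (1 - measure M A)" using small t unfolding A_def bad_prob_def
    using mult_left_mono[of "1 / 2" "1 - measure M {\<omega> \<in> space M. g \<omega> \<in> bad_field L t 0}" t] by simp
  also have "\<dots> = (\<integral>\<omega>. t * indicator (space M - A) \<omega> \<partial>M)"
    using int_ind by (simp add: prob_compl)
  also have "\<dots> \<le> mean_dist v"
    unfolding mean_dist_def
  proof (rule integral_mono_AE)
    show "AE \<omega> in M. t * indicator (space M - A) \<omega> \<le> poly_dist (g \<omega>) 0 v"
      using AE_metric
    proof eventually_elim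
      case (elim \<omega>)
      interpret l: length_pseudometric "T \<omega>" by (rule length_pseudometric_riem_dist[OF elim])
      show ?case
      proof (cases "\<omega> \<in> space M - A")
        case True
        then have "T \<omega> \<notin> bad_event D L t 0" by (simp add: A_def bad_field_iff[OF elim])
        from l.not_bad_imp_ge[OF dense_D L this, of 0 v] show ?thesis
          using v True by (simp add: poly_dist_eq[OF elim])
      qed simp
    qed
  qed (use int_ind integrable_poly_dist in auto)
  finally show ?thesis .
qed

text \<open>The multiscale bound holds at arbitrarily large scales, not at all of them, which
  suffices as the limit exists. A scale \<open>L\<close> is matched with the first \<open>n\<close>
  for which \<open>n v\<close> has norm above \<open>L\<close>; that norm is below
  \<open>2 * L\<close>, whence the constant \<open>\<delta> * norm v / 4\<close>.\<close>

lemma time_constant_pos: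
  assumes ind: "exp_quasi_independent M T" and v: "v \<noteq> 0"
    and lim: "(\<lambda>n. mean_dist (real n *\<^sub>R v) / real n) \<longlonglongrightarrow> m"
  shows "0 < m"
proof -
  obtain \<beta> where \<beta>: "0 < \<beta>" "\<And>\<alpha>. 0 < \<alpha> \<Longrightarrow> \<exists>Q0>0. \<forall>Q\<ge>Q0. Ind_minus M T Q (Q powr (1 + \<alpha>)) \<le> exp (- (Q powr \<beta>))"
    using ind unfolding exp_quasi_independent_def by blast
  obtain Q0 where Q0: "\<And>Q. Q0 \<le> Q \<Longrightarrow> Ind_minus M T Q (Q powr 2) \<le> exp (- (Q powr \<beta>))"
    using \<beta>(2)[of 1] by auto
  obtain \<delta> where \<delta>: "0 < \<delta>" "\<And>X. \<exists>L\<ge>X. bad_prob L (\<delta> * L) \<le> 1 / 2"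
  proof (rule multiscale_iteration[of "CARD('n)" \<beta> "(2 * real CARD('n) + 3) * 4" bad_prob "max 5 Q0"])
    show "1 \<le> CARD('n)" by (simp add: Suc_le_eq)
    show "0 \<le> bad_prob L t" for L t by (simp add: bad_prob_def)
    show "bad_prob L t \<le> bad_prob L t'" if "t \<le> t'" for L t t' using that by (rule bad_prob_mono)
    show "\<exists>t>0. bad_prob L t < e" if "0 < L" "0 < e" for L e using that by (rule bad_prob_small)
    fix L t n L' t' assume "max 5 Q0 \<le> L" "0 \<le> t" "(real n + 12) * L \<le> L'" "t' \<le> real n * t"
    then show "bad_prob L' t' \<le> (((2 * real CARD('n) + 3) * 4 * L') ^ CARD('n))\<^sup>2 * ((bad_prob L t)\<^sup>2 + exp (- (L powr \<beta>)))"
      by (intro bad_prob_step Q0) auto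
  qed (use \<beta> that in auto)
  have nv: "0 < norm v" using v by simp
  have "\<exists>\<^sub>F n in sequentially. \<delta> * norm v / 4 \<le> mean_dist (real n *\<^sub>R v) / real n"
    unfolding frequently_sequentially
  proof
    fix k
    \<comment> \<open>Above \<open>norm v\<close>, so that overshooting \<open>L\<close> by one step
      stays below \<open>2 * L\<close>; above \<open>k * norm v\<close>, so that the resulting
      \<open>n\<close> is at least \<open>k\<close>.\<close>
    obtain L where L: "max (norm v) (real k * norm v) + 1 \<le> L" "bad_prob L (\<delta> * L) \<le> 1 / 2"
      using \<delta>(2) by blast
    have L_pos: "norm v < L" "real k * norm v < L" using L(1) by auto
    define n where "n = Suc (nat \<lfloor>L / norm v\<rfloor>)"
    have "0 < L" using nv L_pos(1) by linarith
    then have "0 \<le> L / norm v" using nv by simp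
    then have n: "L / norm v < real n" "real n \<le> L / norm v + 1" unfolding n_def by linarith+
    have n1: "L < real n * norm v" using n(1) nv by (simp add: pos_divide_less_eq)
    have "real n * norm v \<le> (L / norm v + 1) * norm v" using n(2) nv by (intro mult_right_mono) auto
    then have n2: "real n * norm v < 2 * L" using nv L_pos by (simp add: distrib_right)
    have "real k * norm v < real n * norm v" using L_pos n1 by linarith
    then have "k \<le> n" using nv by simp
    have "\<delta> * L / 2 \<le> mean_dist (real n *\<^sub>R v)"
      using n1 n2 L_pos nv \<delta>(1) L(2) by (intro mean_dist_ge[of L]) auto
    moreover have "\<delta> * (real n * norm v) / 4 \<le> \<delta> * L / 2" using n2 \<delta>(1) by simp
    ultimately have "\<delta> * norm v / 4 * real n \<le> mean_dist (real n *\<^sub>R v)" by (simp add: ac_simps)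
    moreover have "0 < real n" by (simp add: n_def)
    ultimately have "\<delta> * norm v / 4 \<le> mean_dist (real n *\<^sub>R v) / real n" by (simp add: pos_le_divide_eq)
    then show "\<exists>n\<ge>k. \<delta> * norm v / 4 \<le> mean_dist (real n *\<^sub>R v) / real n" using \<open>k \<le> n\<close> by blast
  qed
  moreover have "eventually (\<lambda>n. mean_dist (real n *\<^sub>R v) / real n < \<delta> * norm v / 4) sequentially" if "m \<le> 0"
  proof (rule order_tendstoD(2)[OF lim])
    have "0 < \<delta> * norm v / 4" using \<delta>(1) nv by simp
    with that show "m < \<delta> * norm v / 4" by (rule le_less_trans)
  qed
  ultimately show ?thesis by (fastforce simp: frequently_def not_le not_less)
qed

end

theorem theorem3p17:
  fixes M :: "'w measure"
    and g :: "'w \<Rightarrow> real^'n \<Rightarrow> real^'n^'n"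
  assumes "prob_space M"
    and "random_riem_metric M g"
    and "translation_ergodic M g"
    and "AE \<omega> in M. continuous_on UNIV (g \<omega>)"
    and "\<And>v. integrable M (\<lambda>\<omega>. riem_norm (g \<omega> 0) v)"
    and "exp_quasi_independent M (\<lambda>\<omega>. riem_dist (g \<omega>))"
  shows "\<exists>\<mu>. time_constant M (\<lambda>\<omega>. riem_dist (g \<omega>)) \<mu> \<and> is_norm \<mu>"
proof -
  obtain D :: "(real^'n) set" where D: "countable D" "\<And>X. open X \<Longrightarrow> X \<noteq> {} \<Longrightarrow> \<exists>d\<in>D. d \<in> X"
    using countable_dense_setE by blast
  interpret random_metric M g D
  proof (intro random_metric.intro random_metric_axioms.intro assms D(1))
    fix x :: "real^'n" and e :: real assume "0 < e"
    then show "\<exists>d\<in>D. dist d x < e" using D(2)[of "ball x e"] by (auto simp: dist_commute)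
  qed
  obtain \<mu> where \<mu>: "time_constant M T \<mu>" "\<And>v. (\<lambda>n. mean_dist (real n *\<^sub>R v) / real n) \<longlonglongrightarrow> \<mu> v"
    using ex_time_constant by blast
  obtain C where "\<And>v. mean_norm v \<le> C * norm v" using mean_norm_le by blast
  then have "mean_dist v \<le> C * norm v" for v using mean_dist_le_mean_norm[of v] by (rule order_trans[rotated])
  then have "is_norm \<mu>"
    using mean_dist_nonneg mean_dist_triangle mean_dist_minus \<mu>(2) time_constant_pos[OF assms(6) _ \<mu>(2)]
    by (intro is_norm_subadditive_limit[where e = mean_dist])
  with \<mu>(1) show ?thesis by blast
qed

end
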